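(* Consider one time step, from $t^n$ to $t^{n+1}=t^n+\tau$, $n\ge 0$, of the ALE scheme version 1 or version 2 (defined in the context), and let $i\in\{1,\dots,N\}$. Let $$\lambda_{i,\max}^n:=\max_{j\in\mathcal I(S_i^n)}\ \max\big(\lambda_{\max}(\mathbf g_j^n,\mathbf n_{ij}^n,\mathbf U_i^n,\mathbf U_j^n),\ \lambda_{\max}(\mathbf g_i^n,\mathbf n_{ji}^n,\mathbf U_j^n,\mathbf U_i^n)\big).$$ Depending on the version of the algorithm, assume that $\tau$ is such that $$2\tau\frac{\lambda_{i,\max}^n}{\underline h_i^n}\,\kappa_i^n\,\frac{\sum_{l\in\mathcal L}\omega_l m_i(t_l^n)}{m_i^{n+1}}\le 1\quad\text{(for version 2)},\qquad\text{or}\qquad 2\tau\frac{\lambda_{i,\max}^n}{\underline h_i^n}\,\kappa_i^n\,\frac{\mathfrak m_i^n}{\mathfrak m_i^{n+1}}\le 1\quad\text{(for version 1)}.$$ Let $B\subset\mathcal A_{\mathbf f}$ be a convex invariant set for the flux $\mathbf f$ such that $\{\mathbf U_j^n : j\in\mathcal I(S_i^n)\}\subset B$. Then $\mathbf U_i^{n+1}\in B$.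
   Context: **Hyperbolic system.** Consider $\partial_t\mathbf u+\nabla\cdot\mathbf f(\mathbf u)=0$ on $\mathbb R^d\times\mathbb R_+$, $\mathbf u\in\mathbb R^m$, $\mathbf f(\mathbf u)\in\mathbb R^{m\times d}$. For $A\in\mathbb R^{m\times d}$ and $\mathbf n\in\mathbb R^d$, $A\cdot\mathbf n\in\mathbb R^m$ has entries $\sum_l A_{il}n_l$; $(\mathbf u\otimes\mathbf v)_{ij}=u_iv_j$; the divergence of an $m\times d$ matrix field is taken row by row. For a flux $\mathbf h$ (with values in $\mathbb R^{m\times d}$), $(\eta,\mathbf q)$ is an entropy pair if $\eta$ is convex and $\partial_{v_k}(\mathbf q(\mathbf v)\cdot\mathbf n)=\sum_{i=1}^m\partial_{v_i}\eta(\mathbf v)\,\partial_{v_k}(\mathbf h_i(\mathbf v)\cdot\mathbf n)$ for all $k$ and all unit $\mathbf n$ ($\mathbf h_i$ is the $i$-th row). Standing assumption: there is a nonempty admissible set $\mathcal A_{\mathbf h}\subset\mathbb R^m$ such that for all $\mathbf u_L,\mathbf u_R\in\mathcal A_{\mathbf h}$ and every unit vector $\mathbf n$ the Riemann problem $\partial_t\mathbf u+\partial_x(\mathbf h(\mathbf u)\cdot\mathbf n)=0$, $\mathbf u(x,0)=\mathbf u_L$ if $x<0$, $\mathbf u_R$ if $x>0$, has a unique entropy satisfying solution $\mathbf u(\mathbf h,\mathbf n,\mathbf u_L,\mathbf u_R)$ (i.e. $\partial_t\eta(\mathbf u)+\partial_x(\mathbf q(\mathbf u)\cdot\mathbf n)\le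 0$ in the distribution sense for every entropy pair), and this solution has finite speed of propagation: there are $\lambda_L\le\lambda_R$ (depending on $\mathbf h,\mathbf n,\mathbf u_L,\mathbf u_R$) such that it equals $\mathbf u_L$ for $x\le t\lambda_L$ and $\mathbf u_R$ for $x\ge t\lambda_R$. Set $\lambda_{\max}(\mathbf h,\mathbf n,\mathbf u_L,\mathbf u_R)=\max(|\lambda_L|,|\lambda_R|)$. **Invariant set.** A convex set $A\subset\mathcal A_{\mathbf h}$ is invariant for the flux $\mathbf h$ if for all $\mathbf v_L,\mathbf v_R\in A$, all unit $\mathbf n$ and all $t>0$, the average $\frac{1}{t(\lambda_R-\lambda_L)}\int_{\lambda_Lt}^{\lambda_Rt}\mathbf v(\mathbf h,\mathbf n,\mathbf v_L,\mathbf v_R)(x,t)\,dx$ of the entropy solution over the Riemann fan belongs to $A$. **Boundary conditions.** The problem is the Cauchy problem in $\mathbb R^d$ with data constant outside a compact set, or periodic boundary conditions are used (integrals over $\mathbb R^d$ then being over the periodic domain); no boundary terms arise in integrations by parts. **Finite elements.** $\mathcal T_h^n$ is a matching mesh at time $t^n$ with fixed connectivity. Every cell $K$ is $T_K^n(\widehat K)$, where $\widehat K$ is one of finitely many reference elements, $T_K^n(\widehat{\mathbf x})=\sum_{i=1}^{n_f^{geo}}\mathbf a^n_{\mathsf j^{geo}(i,K)}\widehat\theta_i^{geo}(\widehat{\mathbf x})$ is a diffeomorphism, $\{\mathbf a_i^n\}_{1\le i\le N_{geo}}$ are the geometric Lagrange nodes, $\widehat\theta_i^{geo}$ the reference Lagrange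 shape functions spanning $\widehat P^{geo}$, and $\mathsf j^{geo}$ the (time independent) geometric connectivity array. The approximation uses reference shape functions $\widehat\theta_i$ ($1\le i\le n_f$), spanning $\widehat P$, with $\widehat\theta_i\ge0$ and $\sum_i\widehat\theta_i=1$ on $\widehat K$. $P(\mathcal T_h^n)$ is the space of continuous scalar functions $v$ with $v|_K\circ T_K^n\in\widehat P$ for all $K$; $\mathbf P_d=[P]^d$, $\mathbf P_m=[P]^m$. Its global shape functions $\{\psi_i^n\}_{1\le i\le N}$ satisfy $\psi^n_{\mathsf j(i,K)}=\widehat\theta_i\circ(T_K^n)^{-1}$ on $K$, with time independent connectivity array $\mathsf j$, so $\psi_i^n\ge0$, $\sum_i\psi_i^n=1$. $S_i^n$ is the support of $\psi_i^n$, $S_{ij}^n=S_i^n\cap S_j^n$, and for a union of cells $E$, $\mathcal I(E)=\{j: |S_j^n\cap E|\ne0\}$ (independent of $n$). $m_i^n:=\int\psi_i^n\,d\mathbf x$. The approximate solution is $\mathbf u_h^n=\sum_i\mathbf U_i^n\psi_i^n\in\mathbf P_m(\mathcal T_h^n)$. **Version 1.** Given an ALE velocity $\mathbf w^n=\sum_i\mathbf W_i^n\psi_i^n\in\mathbf P_d(\mathcal T_h^n)$, nodes move by $\mathbf a_i^{n+1}=\mathbf a_i^n+\tau\mathbf w^n(\mathbf a_i^n)$, defining $\mathcal T_h^{n+1}$. Approximate masses: $\mathfrak m_i^0=m_i^0$, $\mathfrak m_i^{n+1}=\mathfrak m_i^n+\tau\int_{S_i^n}\psi_i^n\,\nabla\cdot\mathbf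 w^n\,d\mathbf x$, assumed positive. With $\mathbf c_{ij}^n=\int_{S_i^n}\psi_i^n\nabla\psi_j^n\,d\mathbf x$, $$\frac{\mathfrak m_i^{n+1}\mathbf U_i^{n+1}-\mathfrak m_i^n\mathbf U_i^n}{\tau}+\sum_{j\in\mathcal I(S_i^n)}\Big[(\mathbf f(\mathbf U_j^n)-\mathbf U_j^n\otimes\mathbf W_j^n)\cdot\mathbf c_{ij}^n-d_{ij}^n\mathbf U_j^n\Big]=0.$$ **Version 2.** Assume $\widehat P^{geo}\subset\widehat P$. The ALE velocity $\mathbf w^n=\sum_{i=1}^{N_{geo}}\mathbf W_i^{geo,n}\psi_i^{geo,n}$ is in $[P^{geo}(\mathcal T_h^n)]^d$ (defined like $P$ with $\widehat P^{geo}$ and the geometric shape functions $\psi^{geo,n}_{\mathsf j^{geo}(i,K)}=\widehat\theta_i^{geo}\circ(T_K^n)^{-1}$); $\mathbf W_j^n$ are its coefficients in the basis $\{\psi_j^n\}$: $\mathbf w^n=\sum_j\mathbf W_j^n\psi_j^n$. For $t\in[t^n,t^{n+1}]$, $\mathbf a_i(t)=\mathbf a_i^n+(t-t^n)\mathbf W_i^{geo,n}$ defines a mesh $\mathcal T_h(t)$, geometric maps $T_K(t)$, and shape functions $\varphi_i(\cdot,t)$ with $\varphi_{\mathsf j(i,K)}(\cdot,t)=\widehat\theta_i\circ T_K(t)^{-1}$ on the cell $T_K(t)(\widehat K)$, with supports $S_i(t)$, $S_{ij}(t)=S_i(t)\cap S_j(t)$; the mesh motion map $\boldsymbol\Phi_t$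 ($=T_K(t)\circ(T_K^n)^{-1}$ on $K$) is assumed invertible for $t\in[t^n,t^{n+1}]$; $\mathcal T_h^{n+1}=\mathcal T_h(t^{n+1})$ and $\psi_i^{n+1}=\varphi_i(\cdot,t^{n+1})$. $(\omega_l,\zeta_l)_{l\in\mathcal L}$ is a quadrature such that $\int_0^1 f(\zeta)\,d\zeta\simeq\sum_{l\in\mathcal L}\omega_l f(\zeta_l)$ is exact for all polynomials $f$ of degree at most $d-1$; $t_l^n=t^n+\tau\zeta_l$. Put $m_i(t)=\int\varphi_i(\mathbf x,t)\,d\mathbf x$, $m_i^{n+1}=\int\psi_i^{n+1}\,d\mathbf x$, $\mathbf c_{ij}(t_l^n)=\int\varphi_i(\mathbf x,t_l^n)\nabla\varphi_j(\mathbf x,t_l^n)\,d\mathbf x$, $\mathbf c_{ij}^n=\sum_{l}\omega_l\mathbf c_{ij}(t_l^n)$, and $$\frac{m_i^{n+1}\mathbf U_i^{n+1}-m_i^n\mathbf U_i^n}{\tau}+\sum_{j\in\mathcal I(S_i^n)}\Big[(\mathbf f(\mathbf U_j^n)-\mathbf U_j^n\otimes\mathbf W_j^n)\cdot\mathbf c_{ij}^n-d_{ij}^n\mathbf U_j^n\Big]=0.$$ **Artificial viscosity (both versions).** $\mathbf g_j^n(\mathbf v)=\mathbf f(\mathbf v)-\mathbf v\otimes\mathbf W_j^n$ (its Riemann solutions are translates of those of $\mathbf f$: $\mathcal A_{\mathbf g_j^n}=\mathcal A_{\mathbf f}$ and $\lambda_{L}(\mathbf g_j^n,\mathbf n,\cdot,\cdot)=\lambda_{L}(\mathbf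 f,\mathbf n,\cdot,\cdot)-\mathbf W_j^n\cdot\mathbf n$, likewise for $\lambda_R$), $\mathbf n_{ij}^n=\mathbf c_{ij}^n/\|\mathbf c_{ij}^n\|_{\ell^2}$ (terms with $\mathbf c_{ij}^n=0$ are omitted or counted as zero). For $i\neq j$, $j\in\mathcal I(S_i^n)$, $$d_{ij}^n=\max\big(\lambda_{\max}(\mathbf g_j^n,\mathbf n_{ij}^n,\mathbf U_i^n,\mathbf U_j^n)\|\mathbf c_{ij}^n\|_{\ell^2},\ \lambda_{\max}(\mathbf g_i^n,\mathbf n_{ji}^n,\mathbf U_j^n,\mathbf U_i^n)\|\mathbf c_{ji}^n\|_{\ell^2}\big),$$ $d_{ij}^n=0$ if $j\notin\mathcal I(S_i^n)$, and $d_{ii}^n=-\sum_{i\ne j\in\mathcal I(S_i^n)}d_{ji}^n$. **Mesh parameters.** For shape functions at time $t$ ($\varphi_i(\cdot,t)$, with $\varphi_i(\cdot,t^n)=\psi_i^n$), $\underline h_{ij}(t)=1/\big\|\,\|\nabla\varphi_j\|_{\ell^2}\big\|_{L^\infty(S_{ij}(t))}$ and $\underline h_i(t)=\min_{j\in\mathcal I(S_i(t))}\underline h_{ij}(t)$. Version 2: $\underline h_i^n=\min_{l\in\mathcal L}\underline h_i(t_l^n)$ and $\kappa_i^n=\frac{\sum_{i\ne j\in\mathcal I(S_i^n)}\sum_{l}\omega_l\int_{S_{ij}(t_l^n)}\varphi_i(\mathbf x,t_l^n)\,d\mathbf x}{\sum_{l}\omega_l m_i(t_l^n)}$. Version 1: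 $\underline h_i^n=\underline h_i(t^n)$ and $\kappa_i^n=\frac{\sum_{i\ne j\in\mathcal I(S_i^n)}\int_{S_{ij}^n}\psi_i^n\,d\mathbf x}{\int_{S_i^n}\psi_i^n\,d\mathbf x}$.
   Formalization: Version 1 also assumes the time-step condition with the exact mass m_i^n in place of the approximate mass (automatic for n=0); version 2 assumes nonnegative quadrature weights and nodes in [0,1]. Without the mass condition or nonnegative weights the claim is false. *)

theory Defs
  imports
    "HOL-Analysis.Analysis"
    "HOL-Computational_Algebra.Polynomial"
    "HOL-Probability.Essential_Supremum"
begin

section \<open>Fluxes, Riemann problems and invariant sets\<close>

type_synonym ('m, 'd) flux = "real^'m \<Rightarrow> real^'d^'m"

text \<open>The product of an \<open>m \<times> d\<close> matrix \<open>A\<close> with a vector \<open>n\<close> is \<open>A *v n\<close>.\<close>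

definition outer :: "real^'m \<Rightarrow> real^'d \<Rightarrow> real^'d^'m" where
  "outer u v = (\<chi> i j. u $ i * v $ j)"

definition ale_flux :: "('m::finite, 'd::finite) flux \<Rightarrow> real^'d \<Rightarrow> ('m, 'd) flux" where
  "ale_flux f w = (\<lambda>v. f v - outer v w)"

definition has_partial :: "(real^'m \<Rightarrow> real) \<Rightarrow> 'm::finite \<Rightarrow> real \<Rightarrow> real^'m \<Rightarrow> bool" where
  "has_partial g k D v \<longleftrightarrow> ((\<lambda>s. g (v + s *\<^sub>R axis k 1)) has_real_derivative D) (at 0)"

definition entropy_pair ::
  "('m::finite, 'd::finite) flux \<Rightarrow> (real^'m \<Rightarrow> real) \<Rightarrow> (real^'m \<Rightarrow> real^'d) \<Rightarrow> bool" where
  "entropy_pair h \<eta> q \<longleftrightarrow>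
     convex_on UNIV \<eta> \<and>
     (\<forall>n v k. norm n = 1 \<longrightarrow>
        (\<exists>D\<eta> Dh. (\<forall>i. has_partial \<eta> i (D\<eta> i) v) \<and>
                 (\<forall>i. has_partial (\<lambda>u. (h u *v n) $ i) k (Dh i) v) \<and>
                 has_partial (\<lambda>u. q u \<bullet> n) k (\<Sum>i\<in>UNIV. D\<eta> i * Dh i) v))"

text \<open>Functions of \<open>(x, t)\<close> are curried.  A test function is \<open>C\<^sup>\<infinity>\<close> with compact support in
  \<open>\<real>\<^sup>2\<close>: \<open>D i j\<close> is the mixed derivative of order \<open>i\<close> in \<open>x\<close> and \<open>j\<close> in \<open>t\<close>.  Its support may
  meet \<open>t = 0\<close>, so that the initial data enter the weak formulation.\<close>

definition test_function :: "(real \<Rightarrow> real \<Rightarrow> real) \<Rightarrow> bool" where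
  "test_function \<phi> \<longleftrightarrow>
     (\<exists>D :: nat \<Rightarrow> nat \<Rightarrow> real \<Rightarrow> real \<Rightarrow> real. D 0 0 = \<phi> \<and>
        (\<forall>i j. continuous_on UNIV (\<lambda>(x, t). D i j x t)) \<and>
        (\<forall>i j x t. ((\<lambda>y. D i j y t) has_real_derivative D (Suc i) j x t) (at x)) \<and>
        (\<forall>i j x t. ((\<lambda>s. D i j x s) has_real_derivative D i (Suc j) x t) (at t))) \<and>
     (\<exists>r. \<forall>x t. r < \<bar>x\<bar> \<or> r < \<bar>t\<bar> \<longrightarrow> \<phi> x t = 0)"

definition weak_form ::
  "(real \<Rightarrow> real \<Rightarrow> 'b::euclidean_space) \<Rightarrow> (real \<Rightarrow> real \<Rightarrow> 'b) \<Rightarrow> (real \<Rightarrow> 'b)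
    \<Rightarrow> (real \<Rightarrow> real \<Rightarrow> real) \<Rightarrow> 'b" where
  "weak_form E F E0 \<phi> =
     (LINT p:UNIV \<times> {0<..}|lborel.
        (case p of (x, t) \<Rightarrow> deriv (\<lambda>s. \<phi> x s) t *\<^sub>R E x t + deriv (\<lambda>y. \<phi> y t) x *\<^sub>R F x t)) +
     (LINT x|lborel. \<phi> x 0 *\<^sub>R E0 x)"

definition locally_integrable :: "(real \<Rightarrow> real \<Rightarrow> 'b::euclidean_space) \<Rightarrow> bool" where
  "locally_integrable E \<longleftrightarrow>
     (\<forall>r>0. set_integrable lborel ({-r..r} \<times> {0<..r}) (\<lambda>(x, t). E x t))"

definition riemann_datum :: "'b \<Rightarrow> 'b \<Rightarrow> real \<Rightarrow> 'b" where
  "riemann_datum uL uR x = (if x < 0 then uL else uR)"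

text \<open>The integrability of the time slices is what gives a meaning to averages of \<open>u\<close> over an
  interval in \<open>x\<close> at a fixed time \<open>t > 0\<close>; it selects a representative.\<close>

definition entropy_solution ::
  "('m::finite, 'd::finite) flux \<Rightarrow> real^'d \<Rightarrow> real^'m \<Rightarrow> real^'m \<Rightarrow> (real \<Rightarrow> real \<Rightarrow> real^'m) \<Rightarrow> bool"
where
  "entropy_solution h n uL uR u \<longleftrightarrow>
     locally_integrable u \<and> locally_integrable (\<lambda>x t. h (u x t) *v n) \<and>
     (\<forall>t>0. \<forall>r>0. set_integrable lborel {-r..r} (\<lambda>x. u x t)) \<and>
     (\<forall>\<phi>. test_function \<phi> \<longrightarrow>
        weak_form u (\<lambda>x t. h (u x t) *v n) (riemann_datum uL uR) \<phi> = 0) \<and>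
     (\<forall>\<eta> q. entropy_pair h \<eta> q \<longrightarrow>
        locally_integrable (\<lambda>x t. \<eta> (u x t)) \<and> locally_integrable (\<lambda>x t. q (u x t) \<bullet> n) \<and>
        (\<forall>\<phi>. test_function \<phi> \<and> (\<forall>x t. 0 \<le> \<phi> x t) \<longrightarrow>
           0 \<le> weak_form (\<lambda>x t. \<eta> (u x t)) (\<lambda>x t. q (u x t) \<bullet> n)
                 (\<lambda>x. \<eta> (riemann_datum uL uR x)) \<phi>))"

text \<open>Admissible set, solution \<open>u(h, n, u\<^sub>L, u\<^sub>R)(x, t)\<close> and speeds \<open>\<lambda>\<^sub>L\<close>, \<open>\<lambda>\<^sub>R\<close> of the Riemann
  problems, as functions of the flux \<open>h\<close>.\<close>

record ('m, 'd) riemann =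
  adm :: "('m, 'd) flux \<Rightarrow> (real^'m) set"
  rsol :: "('m, 'd) flux \<Rightarrow> real^'d \<Rightarrow> real^'m \<Rightarrow> real^'m \<Rightarrow> real \<Rightarrow> real \<Rightarrow> real^'m"
  lamL :: "('m, 'd) flux \<Rightarrow> real^'d \<Rightarrow> real^'m \<Rightarrow> real^'m \<Rightarrow> real"
  lamR :: "('m, 'd) flux \<Rightarrow> real^'d \<Rightarrow> real^'m \<Rightarrow> real^'m \<Rightarrow> real"

text \<open>Equality with \<open>u\<^sub>L\<close>, \<open>u\<^sub>R\<close> outside the fan is required for almost every \<open>x\<close> only: if
  \<open>\<lambda>\<^sub>L = \<lambda>\<^sub>R\<close> (a single discontinuity), both conditions apply on the line \<open>x = t \<lambda>\<^sub>L\<close>.\<close>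

definition riemann_solvable :: "('m::finite, 'd::finite) riemann \<Rightarrow> ('m, 'd) flux \<Rightarrow> bool" where
  "riemann_solvable R h \<longleftrightarrow>
     adm R h \<noteq> {} \<and>
     (\<forall>uL\<in>adm R h. \<forall>uR\<in>adm R h. \<forall>n. norm n = 1 \<longrightarrow>
        entropy_solution h n uL uR (rsol R h n uL uR) \<and>
        (\<forall>v. entropy_solution h n uL uR v \<longrightarrow>
           (AE p in lborel. 0 < snd p \<longrightarrow> v (fst p) (snd p) = rsol R h n uL uR (fst p) (snd p))) \<and>
        lamL R h n uL uR \<le> lamR R h n uL uR \<and>
        (\<forall>t>0. AE x in lborel.
           (x \<le> t * lamL R h n uL uR \<longrightarrow> rsol R h n uL uR x t = uL) \<and>
           (t * lamR R h n uL uR \<le> x \<longrightarrow> rsol R h n uL uR x t = uR)))"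

definition lam_max ::
  "('m::finite, 'd::finite) riemann \<Rightarrow> ('m, 'd) flux \<Rightarrow> real^'d \<Rightarrow> real^'m \<Rightarrow> real^'m \<Rightarrow> real" where
  "lam_max R h n uL uR = max \<bar>lamL R h n uL uR\<bar> \<bar>lamR R h n uL uR\<bar>"

text \<open>The Riemann solutions for \<open>f(v) - v \<otimes> w\<close> are translates of those for \<open>f\<close>.\<close>

definition ale_translates :: "('m::finite, 'd::finite) riemann \<Rightarrow> ('m, 'd) flux \<Rightarrow> bool" where
  "ale_translates R f \<longleftrightarrow>
     (\<forall>w. adm R (ale_flux f w) = adm R f \<and>
        (\<forall>uL\<in>adm R f. \<forall>uR\<in>adm R f. \<forall>n. norm n = 1 \<longrightarrow>
           lamL R (ale_flux f w) n uL uR = lamL R f n uL uR - w \<bullet> n \<and>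
           lamR R (ale_flux f w) n uL uR = lamR R f n uL uR - w \<bullet> n))"

text \<open>The average over the fan is defined only if \<open>\<lambda>\<^sub>L < \<lambda>\<^sub>R\<close>.\<close>

definition invariant_set ::
  "('m::finite, 'd::finite) riemann \<Rightarrow> ('m, 'd) flux \<Rightarrow> (real^'m) set \<Rightarrow> bool" where
  "invariant_set R h A \<longleftrightarrow>
     convex A \<and> A \<subseteq> adm R h \<and>
     (\<forall>vL\<in>A. \<forall>vR\<in>A. \<forall>n t. norm n = 1 \<and> 0 < t \<and> lamL R h n vL vR < lamR R h n vL vR \<longrightarrow>
        (1 / (t * (lamR R h n vL vR - lamL R h n vL vR))) *\<^sub>R
        (LINT x:{lamL R h n vL vR * t..lamR R h n vL vR * t}|lborel. rsol R h n vL vR x t) \<in> A)"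


section \<open>Domain and boundary conditions\<close>

text \<open>A function on the periodic domain is a function on \<open>\<real>\<^sup>d\<close> that is invariant under the
  lattice; integrals are over one period box.  For the whole space the lattice is trivial.\<close>

datatype 'd boundary = Whole_Space | Periodic "real^'d"

fun boundary_ok :: "'d::finite boundary \<Rightarrow> bool" where
  "boundary_ok Whole_Space \<longleftrightarrow> True"
| "boundary_ok (Periodic p) \<longleftrightarrow> (\<forall>k. 0 < p $ k)"

fun lattice :: "'d::finite boundary \<Rightarrow> (real^'d) set" where
  "lattice Whole_Space = {0}"
| "lattice (Periodic p) = {\<chi> k. p $ k * of_int (z k) |z. True}"

fun flow_domain :: "'d::finite boundary \<Rightarrow> (real^'d) set" where
  "flow_domain Whole_Space = UNIV"
| "flow_domain (Periodic p) = {x. \<forall>k. 0 \<le> x $ k \<and> x $ k < p $ k}"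


section \<open>Reference elements and meshes\<close>

definition C1_on :: "'a::euclidean_space set \<Rightarrow> ('a \<Rightarrow> 'b::euclidean_space) \<Rightarrow> bool" where
  "C1_on S g \<longleftrightarrow>
     (\<exists>g' :: 'a \<Rightarrow> 'a \<Rightarrow>\<^sub>L 'b.
        (\<forall>x\<in>S. (g has_derivative blinfun_apply (g' x)) (at x within S)) \<and> continuous_on S g')"

definition diffeo_on :: "'a::euclidean_space set \<Rightarrow> ('a \<Rightarrow> 'a) \<Rightarrow> bool" where
  "diffeo_on S g \<longleftrightarrow> C1_on S g \<and> (\<exists>k. C1_on (g ` S) k \<and> (\<forall>x\<in>S. k (g x) = x))"

record 'd ref_element =
  Khat :: "(real^'d) set"
  nf :: nat
  theta :: "nat \<Rightarrow> real^'d \<Rightarrow> real"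
  nf_geo :: nat
  theta_geo :: "nat \<Rightarrow> real^'d \<Rightarrow> real"
  node_geo :: "nat \<Rightarrow> real^'d"  \<comment> \<open>Lagrange nodes\<close>

definition Phat :: "'d::finite ref_element \<Rightarrow> (real^'d \<Rightarrow> real) set" where
  "Phat E = {v. \<exists>c. \<forall>x\<in>Khat E. v x = (\<Sum>i<nf E. c i * theta E i x)}"

definition Phat_geo :: "'d::finite ref_element \<Rightarrow> (real^'d \<Rightarrow> real) set" where
  "Phat_geo E = {v. \<exists>c. \<forall>x\<in>Khat E. v x = (\<Sum>i<nf_geo E. c i * theta_geo E i x)}"

definition ref_element_ok :: "'d::finite ref_element \<Rightarrow> bool" where
  "ref_element_ok E \<longleftrightarrow>
     compact (Khat E) \<and> convex (Khat E) \<and> interior (Khat E) \<noteq> {} \<and>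
     (\<forall>i<nf E. C1_on (Khat E) (theta E i)) \<and>
     (\<forall>i<nf E. \<forall>x\<in>Khat E. 0 \<le> theta E i x) \<and>
     (\<forall>x\<in>Khat E. (\<Sum>i<nf E. theta E i x) = 1) \<and>
     (\<forall>c. (\<forall>x\<in>Khat E. (\<Sum>i<nf E. c i * theta E i x) = 0) \<longrightarrow> (\<forall>i<nf E. c i = 0)) \<and>
     (\<forall>i<nf_geo E. C1_on (Khat E) (theta_geo E i)) \<and>
     (\<forall>j<nf_geo E. node_geo E j \<in> Khat E) \<and>
     (\<forall>i<nf_geo E. \<forall>j<nf_geo E. theta_geo E i (node_geo E j) = (if i = j then 1 else 0))"

text \<open>The time independent part of the mesh.  The set of cells, of geometric nodes and of shape
  functions is finite in the periodic case, but infinite (locally finite) on the whole space.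
  Local indices start from \<open>0\<close>.  In the periodic case a geometric node is a class modulo the
  lattice, and \<open>shift i K\<close> is the lattice vector that leads from the chosen representative to the
  \<open>i\<close>-th node of the cell \<open>K\<close>; on the whole space all shifts vanish.\<close>

record ('c, 'g, 'i, 'd) mesh_data =
  cells :: "'c set"
  geo_nodes :: "'g set"
  dofs :: "'i set"
  refel :: "'c \<Rightarrow> 'd ref_element"
  jgeo :: "nat \<Rightarrow> 'c \<Rightarrow> 'g"
  shift :: "nat \<Rightarrow> 'c \<Rightarrow> real^'d"
  jdof :: "nat \<Rightarrow> 'c \<Rightarrow> 'i"

definition mesh_data_ok :: "('c, 'g, 'i, 'd::finite) mesh_data \<Rightarrow> 'd boundary \<Rightarrow> bool" where
  "mesh_data_ok X bc \<longleftrightarrow>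
     finite (refel X ` cells X) \<and>
     (\<forall>K\<in>cells X. ref_element_ok (refel X K)) \<and>
     (\<forall>K\<in>cells X. inj_on (\<lambda>i. jgeo X i K) {..<nf_geo (refel X K)}) \<and>
     (\<forall>K\<in>cells X. inj_on (\<lambda>i. jdof X i K) {..<nf (refel X K)}) \<and>
     geo_nodes X = (\<Union>K\<in>cells X. (\<lambda>i. jgeo X i K) ` {..<nf_geo (refel X K)}) \<and>
     dofs X = (\<Union>K\<in>cells X. (\<lambda>i. jdof X i K) ` {..<nf (refel X K)}) \<and>
     (\<forall>j\<in>dofs X. finite {K \<in> cells X. j \<in> (\<lambda>i. jdof X i K) ` {..<nf (refel X K)}}) \<and>
     (\<forall>K\<in>cells X. \<forall>i<nf_geo (refel X K). shift X i K \<in> lattice bc)"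

definition geo_map ::
  "('c, 'g, 'i, 'd::finite) mesh_data \<Rightarrow> ('g \<Rightarrow> real^'d) \<Rightarrow> 'c \<Rightarrow> real^'d \<Rightarrow> real^'d" where
  "geo_map X a K xh =
     (\<Sum>i<nf_geo (refel X K). theta_geo (refel X K) i xh *\<^sub>R (a (jgeo X i K) + shift X i K))"

text \<open>\<open>dof_local X K j\<close> is \<open>theta i\<close> if \<open>j = jdof i K\<close>, and \<open>0\<close> if \<open>j\<close> is not an index of the cell
  \<open>K\<close> (there is at most one such \<open>i\<close>).  Likewise for \<open>geo_local\<close>.\<close>

definition dof_local :: "('c, 'g, 'i, 'd::finite) mesh_data \<Rightarrow> 'c \<Rightarrow> 'i \<Rightarrow> real^'d \<Rightarrow> real" where
  "dof_local X K j xh =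
     (\<Sum>i\<in>{i. i < nf (refel X K) \<and> jdof X i K = j}. theta (refel X K) i xh)"

definition geo_local :: "('c, 'g, 'i, 'd::finite) mesh_data \<Rightarrow> 'c \<Rightarrow> 'g \<Rightarrow> real^'d \<Rightarrow> real" where
  "geo_local X K j xh =
     (\<Sum>i\<in>{i. i < nf_geo (refel X K) \<and> jgeo X i K = j}. theta_geo (refel X K) i xh)"

text \<open>The function on the domain whose pull-back to the reference element of each cell \<open>K\<close> is
  \<open>loc K j\<close>; it exists and is continuous on meshes that satisfy \<open>conforming\<close>.\<close>

definition global_shape ::
  "('c, 'g, 'i, 'd::finite) mesh_data \<Rightarrow> 'd boundary \<Rightarrow> ('g \<Rightarrow> real^'d)
    \<Rightarrow> ('c \<Rightarrow> 'j \<Rightarrow> real^'d \<Rightarrow> real) \<Rightarrow> 'j \<Rightarrow> real^'d \<Rightarrow> real" where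
  "global_shape X bc a loc j x =
     (THE y. \<exists>K\<in>cells X. \<exists>xh\<in>Khat (refel X K). \<exists>l\<in>lattice bc.
        x = geo_map X a K xh + l \<and> y = loc K j xh)"

definition conforming ::
  "('c, 'g, 'i, 'd::finite) mesh_data \<Rightarrow> 'd boundary \<Rightarrow> ('g \<Rightarrow> real^'d)
    \<Rightarrow> ('c \<Rightarrow> 'j \<Rightarrow> real^'d \<Rightarrow> real) \<Rightarrow> 'j set \<Rightarrow> bool" where
  "conforming X bc a loc J \<longleftrightarrow>
     (\<forall>j\<in>J. continuous_on UNIV (global_shape X bc a loc j) \<and>
        (\<forall>K\<in>cells X. \<forall>xh\<in>Khat (refel X K). \<forall>l\<in>lattice bc.
           global_shape X bc a loc j (geo_map X a K xh + l) = loc K j xh))"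

definition psi ::
  "('c, 'g, 'i, 'd::finite) mesh_data \<Rightarrow> 'd boundary \<Rightarrow> ('g \<Rightarrow> real^'d) \<Rightarrow> 'i \<Rightarrow> real^'d \<Rightarrow> real" where
  "psi X bc a = global_shape X bc a (dof_local X)"

definition psi_geo ::
  "('c, 'g, 'i, 'd::finite) mesh_data \<Rightarrow> 'd boundary \<Rightarrow> ('g \<Rightarrow> real^'d) \<Rightarrow> 'g \<Rightarrow> real^'d \<Rightarrow> real" where
  "psi_geo X bc a = global_shape X bc a (geo_local X)"

text \<open>The nodes \<open>a\<close> define a matching mesh: the cells and their lattice translates cover the space
  in a locally finite way, two different ones meet in a common proper face (possibly empty), and
  the shape functions of the approximation space are continuous.\<close>

definition mesh_ok ::
  "('c, 'g, 'i, 'd::finite) mesh_data \<Rightarrow> 'd boundary \<Rightarrow> ('g \<Rightarrow> real^'d) \<Rightarrow> bool" where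
  "mesh_ok X bc a \<longleftrightarrow>
     (\<forall>K\<in>cells X. diffeo_on (Khat (refel X K)) (geo_map X a K)) \<and>
     (\<forall>x. \<exists>K\<in>cells X. \<exists>xh\<in>Khat (refel X K). \<exists>l\<in>lattice bc. x = geo_map X a K xh + l) \<and>
     (\<forall>r. finite {(K, l). K \<in> cells X \<and> l \<in> lattice bc \<and>
             cball 0 r \<inter> (\<lambda>xh. geo_map X a K xh + l) ` Khat (refel X K) \<noteq> {}}) \<and>
     (\<forall>K\<in>cells X. \<forall>K'\<in>cells X. \<forall>l\<in>lattice bc. K \<noteq> K' \<or> l \<noteq> 0 \<longrightarrow>
        (\<exists>F F'. F face_of Khat (refel X K) \<and> F \<noteq> Khat (refel X K) \<and>
                F' face_of Khat (refel X K') \<and> F' \<noteq> Khat (refel X K') \<and>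
                geo_map X a K ` Khat (refel X K) \<inter>
                  (\<lambda>xh. geo_map X a K' xh + l) ` Khat (refel X K') = geo_map X a K ` F \<and>
                geo_map X a K ` F = (\<lambda>xh. geo_map X a K' xh + l) ` F')) \<and>
     conforming X bc a (dof_local X) (dofs X)"


section \<open>Finite element functions and matrices\<close>

definition grad :: "(real^'d \<Rightarrow> real) \<Rightarrow> real^'d \<Rightarrow> real^'d::finite" where
  "grad g x = (\<chi> k. frechet_derivative g (at x) (axis k 1))"

definition divergence :: "(real^'d \<Rightarrow> real^'d) \<Rightarrow> real^'d::finite \<Rightarrow> real" where
  "divergence w x = (\<Sum>k\<in>UNIV. frechet_derivative w (at x) (axis k 1) $ k)"

text \<open>\<open>\<Sum>j. C j \<psi>\<^sub>j(x)\<close>; only finitely many terms are nonzero at a given \<open>x\<close>.\<close>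

definition fe_fun ::
  "('j \<Rightarrow> real^'d \<Rightarrow> real) \<Rightarrow> 'j set \<Rightarrow> ('j \<Rightarrow> 'b::real_vector) \<Rightarrow> real^'d \<Rightarrow> 'b" where
  "fe_fun \<Psi> J C x = (\<Sum>j\<in>{j \<in> J. \<Psi> j x \<noteq> 0}. \<Psi> j x *\<^sub>R C j)"

text \<open>In what follows \<open>\<Psi>\<close> is the family of shape functions on one mesh and \<open>\<Omega>\<close> the domain.\<close>

definition supp :: "('i \<Rightarrow> real^'d \<Rightarrow> real) \<Rightarrow> 'i \<Rightarrow> (real^'d::finite) set" where
  "supp \<Psi> i = closure {x. \<Psi> i x \<noteq> 0}"

definition nbrs :: "(real^'d::finite) set \<Rightarrow> 'i set \<Rightarrow> ('i \<Rightarrow> real^'d \<Rightarrow> real) \<Rightarrow> 'i \<Rightarrow> 'i set" where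
  "nbrs \<Omega> J \<Psi> i = {j \<in> J. emeasure lebesgue (supp \<Psi> j \<inter> supp \<Psi> i \<inter> \<Omega>) \<noteq> 0}"

definition mass :: "(real^'d::finite) set \<Rightarrow> ('i \<Rightarrow> real^'d \<Rightarrow> real) \<Rightarrow> 'i \<Rightarrow> real" where
  "mass \<Omega> \<Psi> i = (LINT x:\<Omega>|lebesgue. \<Psi> i x)"

definition overlap_mass :: "(real^'d::finite) set \<Rightarrow> ('i \<Rightarrow> real^'d \<Rightarrow> real) \<Rightarrow> 'i \<Rightarrow> 'i \<Rightarrow> real" where
  "overlap_mass \<Omega> \<Psi> i j = (LINT x:supp \<Psi> i \<inter> supp \<Psi> j \<inter> \<Omega>|lebesgue. \<Psi> i x)"

definition cvec :: "(real^'d::finite) set \<Rightarrow> ('i \<Rightarrow> real^'d \<Rightarrow> real) \<Rightarrow> 'i \<Rightarrow> 'i \<Rightarrow> real^'d" where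
  "cvec \<Omega> \<Psi> i j = (LINT x:supp \<Psi> i \<inter> \<Omega>|lebesgue. \<Psi> i x *\<^sub>R grad (\<Psi> j) x)"

text \<open>Mesh sizes are extended numbers because \<open>\<nabla>\<psi>\<^sub>j\<close> may vanish on \<open>S\<^sub>i\<^sub>j\<close>; then the size is \<open>\<infinity>\<close>
  (division by \<open>0\<close> in \<open>real\<close> would make it \<open>0\<close>).\<close>

definition mesh_size_pair ::
  "(real^'d::finite) set \<Rightarrow> ('i \<Rightarrow> real^'d \<Rightarrow> real) \<Rightarrow> 'i \<Rightarrow> 'i \<Rightarrow> ennreal" where
  "mesh_size_pair \<Omega> \<Psi> i j =
     1 / esssup (lebesgue_on (supp \<Psi> i \<inter> supp \<Psi> j \<inter> \<Omega>)) (\<lambda>x. ennreal (norm (grad (\<Psi> j) x)))"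

definition mesh_size ::
  "(real^'d::finite) set \<Rightarrow> 'i set \<Rightarrow> ('i \<Rightarrow> real^'d \<Rightarrow> real) \<Rightarrow> 'i \<Rightarrow> ennreal" where
  "mesh_size \<Omega> J \<Psi> i = (INF j\<in>nbrs \<Omega> J \<Psi> i. mesh_size_pair \<Omega> \<Psi> i j)"


section \<open>Artificial viscosity and update\<close>

text \<open>In this section \<open>I i\<close> stands for \<open>\<I>(S\<^sub>i)\<close>.  \<open>\<lambda>\<^sub>m\<^sub>a\<^sub>x\<close> in the direction of \<open>c\<close> is counted as zero
  if \<open>c = 0\<close>.\<close>

definition dir_speed ::
  "('m::finite, 'd::finite) riemann \<Rightarrow> ('m, 'd) flux \<Rightarrow> real^'d \<Rightarrow> real^'m \<Rightarrow> real^'m \<Rightarrow> real" where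
  "dir_speed R h c uL uR = (if c = 0 then 0 else lam_max R h (c /\<^sub>R norm c) uL uR)"

definition visc_off ::
  "('m::finite, 'd::finite) riemann \<Rightarrow> ('m, 'd) flux \<Rightarrow> ('i \<Rightarrow> 'i set) \<Rightarrow> ('i \<Rightarrow> real^'d)
    \<Rightarrow> ('i \<Rightarrow> 'i \<Rightarrow> real^'d) \<Rightarrow> ('i \<Rightarrow> real^'m) \<Rightarrow> 'i \<Rightarrow> 'i \<Rightarrow> real" where
  "visc_off R f I W c U i j =
     (if j \<in> I i then
        max (dir_speed R (ale_flux f (W j)) (c i j) (U i) (U j) * norm (c i j))
            (dir_speed R (ale_flux f (W i)) (c j i) (U j) (U i) * norm (c j i))
      else 0)"

definition visc ::
  "('m::finite, 'd::finite) riemann \<Rightarrow> ('m, 'd) flux \<Rightarrow> ('i \<Rightarrow> 'i set) \<Rightarrow> ('i \<Rightarrow> real^'d)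
    \<Rightarrow> ('i \<Rightarrow> 'i \<Rightarrow> real^'d) \<Rightarrow> ('i \<Rightarrow> real^'m) \<Rightarrow> 'i \<Rightarrow> 'i \<Rightarrow> real" where
  "visc R f I W c U i j =
     (if i = j then - (\<Sum>k\<in>I i - {i}. visc_off R f I W c U k i) else visc_off R f I W c U i j)"

definition lam_local ::
  "('m::finite, 'd::finite) riemann \<Rightarrow> ('m, 'd) flux \<Rightarrow> ('i \<Rightarrow> 'i set) \<Rightarrow> ('i \<Rightarrow> real^'d)
    \<Rightarrow> ('i \<Rightarrow> 'i \<Rightarrow> real^'d) \<Rightarrow> ('i \<Rightarrow> real^'m) \<Rightarrow> 'i \<Rightarrow> real" where
  "lam_local R f I W c U i =
     Max ((\<lambda>j. max (dir_speed R (ale_flux f (W j)) (c i j) (U i) (U j))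
                   (dir_speed R (ale_flux f (W i)) (c j i) (U j) (U i))) ` I i)"

definition ale_update ::
  "('m::finite, 'd::finite) riemann \<Rightarrow> ('m, 'd) flux \<Rightarrow> ('i \<Rightarrow> 'i set) \<Rightarrow> ('i \<Rightarrow> real^'d)
    \<Rightarrow> ('i \<Rightarrow> 'i \<Rightarrow> real^'d) \<Rightarrow> real \<Rightarrow> ('i \<Rightarrow> real) \<Rightarrow> ('i \<Rightarrow> real) \<Rightarrow> ('i \<Rightarrow> real^'m) \<Rightarrow> ('i \<Rightarrow> real^'m)
    \<Rightarrow> 'i \<Rightarrow> bool" where
  "ale_update R f I W c \<tau> m m' U U' i \<longleftrightarrow>
     (m' i *\<^sub>R U' i - m i *\<^sub>R U i) /\<^sub>R \<tau> +
     (\<Sum>j\<in>I i. (f (U j) - outer (U j) (W j)) *v c i j - visc R f I W c U i j *\<^sub>R U j) = 0"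

text \<open>The CFL number \<open>2 \<tau> (\<lambda> / h) \<kappa> \<rho>\<close>, where \<open>\<rho>\<close> is a ratio of masses.  All arguments are
  nonnegative where it is used.\<close>

definition cfl_number :: "real \<Rightarrow> real \<Rightarrow> ennreal \<Rightarrow> real \<Rightarrow> real \<Rightarrow> ennreal" where
  "cfl_number \<tau> lam h \<kappa> \<rho> = ennreal (2 * \<tau>) * (ennreal lam / h) * ennreal \<kappa> * ennreal \<rho>"


section \<open>Version 1\<close>

text \<open>\<open>t k\<close> is the \<open>k\<close>-th time, \<open>a k\<close> the nodes, \<open>W k\<close> the coefficients of the ALE velocity,
  \<open>\<mu> k\<close> the approximate masses and \<open>U k\<close> the coefficients of the solution.  The mesh motion and the approximate masses are defined by
  recursion from time \<open>0\<close>; the update of \<open>U\<close> is that of step \<open>n\<close>.\<close>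

definition version1 ::
  "('c, 'g, 'i, 'd::finite) mesh_data \<Rightarrow> 'd boundary \<Rightarrow> ('m::finite, 'd) riemann \<Rightarrow> ('m, 'd) flux
    \<Rightarrow> (nat \<Rightarrow> real) \<Rightarrow> (nat \<Rightarrow> 'g \<Rightarrow> real^'d) \<Rightarrow> (nat \<Rightarrow> 'i \<Rightarrow> real^'d) \<Rightarrow> (nat \<Rightarrow> 'i \<Rightarrow> real)
    \<Rightarrow> (nat \<Rightarrow> 'i \<Rightarrow> real^'m) \<Rightarrow> nat \<Rightarrow> bool" where
  "version1 X bc R f t a W \<mu> U n \<longleftrightarrow>
     (\<forall>k\<le>n. t k < t (Suc k)) \<and>
     (\<forall>k\<le>Suc n. mesh_ok X bc (a k)) \<and>
     (\<forall>k\<le>n. \<forall>g\<in>geo_nodes X.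
        a (Suc k) g = a k g + (t (Suc k) - t k) *\<^sub>R fe_fun (psi X bc (a k)) (dofs X) (W k) (a k g)) \<and>
     (\<forall>i\<in>dofs X. \<mu> 0 i = mass (flow_domain bc) (psi X bc (a 0)) i) \<and>
     (\<forall>k\<le>n. \<forall>i\<in>dofs X. \<mu> (Suc k) i = \<mu> k i + (t (Suc k) - t k) *
        (LINT x:supp (psi X bc (a k)) i \<inter> flow_domain bc|lebesgue.
           psi X bc (a k) i x * divergence (fe_fun (psi X bc (a k)) (dofs X) (W k)) x)) \<and>
     (\<forall>k\<le>Suc n. \<forall>i\<in>dofs X. 0 < \<mu> k i) \<and>
     (\<forall>i\<in>dofs X. ale_update R f (nbrs (flow_domain bc) (dofs X) (psi X bc (a n))) (W n)
        (cvec (flow_domain bc) (psi X bc (a n))) (t (Suc n) - t n) (\<mu> n) (\<mu> (Suc n)) (U n) (U (Suc n)) i)"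

definition kappa1 :: "(real^'d::finite) set \<Rightarrow> 'i set \<Rightarrow> ('i \<Rightarrow> real^'d \<Rightarrow> real) \<Rightarrow> 'i \<Rightarrow> real" where
  "kappa1 \<Omega> J \<Psi> i =
     (\<Sum>j\<in>nbrs \<Omega> J \<Psi> i - {i}. overlap_mass \<Omega> \<Psi> i j) / (LINT x:supp \<Psi> i \<inter> \<Omega>|lebesgue. \<Psi> i x)"

text \<open>The argument \<open>m\<close> is the mass at time \<open>t n\<close> that is divided by \<open>\<mu> (Suc n) i\<close>: the approximate
  mass \<open>\<mu> n i\<close> or the exact mass of \<open>\<psi>\<^sub>i\<close>.  Since the denominator of \<open>kappa1\<close> is the exact mass, the
  condition with \<open>\<mu> n i\<close> alone does not control the viscosity when \<open>\<mu> n i\<close> is the smaller one;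
  the two coincide for \<open>n = 0\<close>.\<close>

definition cfl1 ::
  "('c, 'g, 'i, 'd::finite) mesh_data \<Rightarrow> 'd boundary \<Rightarrow> ('m::finite, 'd) riemann \<Rightarrow> ('m, 'd) flux
    \<Rightarrow> (nat \<Rightarrow> real) \<Rightarrow> (nat \<Rightarrow> 'g \<Rightarrow> real^'d) \<Rightarrow> (nat \<Rightarrow> 'i \<Rightarrow> real^'d) \<Rightarrow> (nat \<Rightarrow> 'i \<Rightarrow> real)
    \<Rightarrow> (nat \<Rightarrow> 'i \<Rightarrow> real^'m) \<Rightarrow> nat \<Rightarrow> 'i \<Rightarrow> real \<Rightarrow> ennreal" where
  "cfl1 X bc R f t a W \<mu> U n i m =
     (let \<Psi> = psi X bc (a n); \<Omega> = flow_domain bc in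
      cfl_number (t (Suc n) - t n)
        (lam_local R f (nbrs \<Omega> (dofs X) \<Psi>) (W n) (cvec \<Omega> \<Psi>) (U n) i)
        (mesh_size \<Omega> (dofs X) \<Psi> i)
        (kappa1 \<Omega> (dofs X) \<Psi> i)
        (m / \<mu> (Suc n) i))"


section \<open>Version 2\<close>

text \<open>With negative weights the quantity \<open>\<kappa>\<^sub>i\<close> of version 2 could be negative, and the CFL condition
  void.\<close>

definition quadrature :: "'l set \<Rightarrow> ('l \<Rightarrow> real) \<Rightarrow> ('l \<Rightarrow> real) \<Rightarrow> nat \<Rightarrow> bool" where
  "quadrature L \<omega> \<zeta> k \<longleftrightarrow>
     finite L \<and> (\<forall>l\<in>L. 0 \<le> \<omega> l \<and> 0 \<le> \<zeta> l \<and> \<zeta> l \<le> 1) \<and>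
     (\<forall>p :: real poly. degree p \<le> k \<longrightarrow> (\<Sum>l\<in>L. \<omega> l * poly p (\<zeta> l)) = integral {0..1} (poly p))"

definition moved_nodes ::
  "(nat \<Rightarrow> real) \<Rightarrow> (nat \<Rightarrow> 'g \<Rightarrow> real^'d) \<Rightarrow> (nat \<Rightarrow> 'g \<Rightarrow> real^'d) \<Rightarrow> nat \<Rightarrow> real \<Rightarrow> 'g \<Rightarrow> real^'d" where
  "moved_nodes t a Wgeo n s g = a n g + (s - t n) *\<^sub>R Wgeo n g"

text \<open>Shape functions \<open>\<phi>\<^sub>i(\<cdot>, s)\<close> for \<open>s\<close> between \<open>t n\<close> and \<open>t (Suc n)\<close>.\<close>

definition phi ::
  "('c, 'g, 'i, 'd::finite) mesh_data \<Rightarrow> 'd boundary \<Rightarrow> (nat \<Rightarrow> real) \<Rightarrow> (nat \<Rightarrow> 'g \<Rightarrow> real^'d)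
    \<Rightarrow> (nat \<Rightarrow> 'g \<Rightarrow> real^'d) \<Rightarrow> nat \<Rightarrow> real \<Rightarrow> 'i \<Rightarrow> real^'d \<Rightarrow> real" where
  "phi X bc t a Wgeo n s = psi X bc (moved_nodes t a Wgeo n s)"

definition quad_time :: "(nat \<Rightarrow> real) \<Rightarrow> ('l \<Rightarrow> real) \<Rightarrow> nat \<Rightarrow> 'l \<Rightarrow> real" where
  "quad_time t \<zeta> n l = t n + (t (Suc n) - t n) * \<zeta> l"

definition cvec2 ::
  "('c, 'g, 'i, 'd::finite) mesh_data \<Rightarrow> 'd boundary \<Rightarrow> 'l set \<Rightarrow> ('l \<Rightarrow> real) \<Rightarrow> ('l \<Rightarrow> real)
    \<Rightarrow> (nat \<Rightarrow> real) \<Rightarrow> (nat \<Rightarrow> 'g \<Rightarrow> real^'d) \<Rightarrow> (nat \<Rightarrow> 'g \<Rightarrow> real^'d) \<Rightarrow> nat \<Rightarrow> 'i \<Rightarrow> 'i \<Rightarrow> real^'d" where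
  "cvec2 X bc L \<omega> \<zeta> t a Wgeo n i j =
     (\<Sum>l\<in>L. \<omega> l *\<^sub>R cvec (flow_domain bc) (phi X bc t a Wgeo n (quad_time t \<zeta> n l)) i j)"

definition version2 ::
  "('c, 'g, 'i, 'd::finite) mesh_data \<Rightarrow> 'd boundary \<Rightarrow> ('m::finite, 'd) riemann \<Rightarrow> ('m, 'd) flux
    \<Rightarrow> 'l set \<Rightarrow> ('l \<Rightarrow> real) \<Rightarrow> ('l \<Rightarrow> real)
    \<Rightarrow> (nat \<Rightarrow> real) \<Rightarrow> (nat \<Rightarrow> 'g \<Rightarrow> real^'d) \<Rightarrow> (nat \<Rightarrow> 'g \<Rightarrow> real^'d) \<Rightarrow> (nat \<Rightarrow> 'i \<Rightarrow> real^'d)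
    \<Rightarrow> (nat \<Rightarrow> 'i \<Rightarrow> real^'m) \<Rightarrow> nat \<Rightarrow> bool" where
  "version2 X bc R f L \<omega> \<zeta> t a Wgeo W U n \<longleftrightarrow>
     t n < t (Suc n) \<and>
     (\<forall>K\<in>cells X. Phat_geo (refel X K) \<subseteq> Phat (refel X K)) \<and>
     quadrature L \<omega> \<zeta> (CARD('d) - 1) \<and>
     conforming X bc (a n) (geo_local X) (geo_nodes X) \<and>
     (\<forall>x. fe_fun (psi_geo X bc (a n)) (geo_nodes X) (Wgeo n) x =
          fe_fun (psi X bc (a n)) (dofs X) (W n) x) \<and>
     (\<forall>s\<in>{t n..t (Suc n)}.
        mesh_ok X bc (moved_nodes t a Wgeo n s) \<and>
        (\<exists>\<Phi>. bij \<Phi> \<and>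
           (\<forall>K\<in>cells X. \<forall>xh\<in>Khat (refel X K). \<forall>l\<in>lattice bc.
              \<Phi> (geo_map X (a n) K xh + l) = geo_map X (moved_nodes t a Wgeo n s) K xh + l))) \<and>
     (\<forall>g\<in>geo_nodes X. a (Suc n) g = moved_nodes t a Wgeo n (t (Suc n)) g) \<and>
     (\<forall>i\<in>dofs X. ale_update R f (nbrs (flow_domain bc) (dofs X) (psi X bc (a n))) (W n)
        (cvec2 X bc L \<omega> \<zeta> t a Wgeo n) (t (Suc n) - t n)
        (mass (flow_domain bc) (psi X bc (a n))) (mass (flow_domain bc) (psi X bc (a (Suc n)))) (U n) (U (Suc n)) i)"

definition cfl2 ::
  "('c, 'g, 'i, 'd::finite) mesh_data \<Rightarrow> 'd boundary \<Rightarrow> ('m::finite, 'd) riemann \<Rightarrow> ('m, 'd) flux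
    \<Rightarrow> 'l set \<Rightarrow> ('l \<Rightarrow> real) \<Rightarrow> ('l \<Rightarrow> real)
    \<Rightarrow> (nat \<Rightarrow> real) \<Rightarrow> (nat \<Rightarrow> 'g \<Rightarrow> real^'d) \<Rightarrow> (nat \<Rightarrow> 'g \<Rightarrow> real^'d) \<Rightarrow> (nat \<Rightarrow> 'i \<Rightarrow> real^'d)
    \<Rightarrow> (nat \<Rightarrow> 'i \<Rightarrow> real^'m) \<Rightarrow> nat \<Rightarrow> 'i \<Rightarrow> ennreal" where
  "cfl2 X bc R f L \<omega> \<zeta> t a Wgeo W U n i =
     (let \<Omega> = flow_domain bc;
          I = nbrs \<Omega> (dofs X) (psi X bc (a n));
          \<phi> = (\<lambda>l. phi X bc t a Wgeo n (quad_time t \<zeta> n l));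
          M = (\<Sum>l\<in>L. \<omega> l * mass \<Omega> (\<phi> l) i);
          \<kappa> = (\<Sum>j\<in>I i - {i}. \<Sum>l\<in>L. \<omega> l * overlap_mass \<Omega> (\<phi> l) i j) / M in
      cfl_number (t (Suc n) - t n)
        (lam_local R f I (W n) (cvec2 X bc L \<omega> \<zeta> t a Wgeo n) (U n) i)
        (INF l\<in>L. mesh_size \<Omega> (dofs X) (\<phi> l) i)
        \<kappa>
        (M / mass \<Omega> (psi X bc (a (Suc n))) i))"

end

theory Submission
  imports Defs
begin

text \<open>
  The proof writes the update as a convex combination of states of \<open>B\<close>.  Two identities make this
  possible: \<open>\<Sum>\<^sub>j c\<^sub>i\<^sub>j = 0\<close>, because the shape functions sum up to one, and the geometric conservation
  law \<open>m\<^sub>i' = m\<^sub>i + \<tau> \<Sum>\<^sub>j W\<^sub>j \<bullet> c\<^sub>i\<^sub>j\<close>.  With the ALE fluxes \<open>g\<^sub>j(v) = f(v) - v \<otimes> W\<^sub>j\<close> they allow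
  \<open>g\<^sub>j(U\<^sub>i)\<close> to be subtracted from \<open>g\<^sub>j(U\<^sub>j)\<close> in the scheme, which then reads
    \<open>U\<^sub>i' = (1 - \<Sum>\<^sub>j 2 \<tau> d\<^sub>i\<^sub>j / m\<^sub>i') U\<^sub>i + \<Sum>\<^sub>j (2 \<tau> d\<^sub>i\<^sub>j / m\<^sub>i') V\<^sub>i\<^sub>j\<close>  with the bar states
    \<open>V\<^sub>i\<^sub>j = (U\<^sub>i + U\<^sub>j) / 2 - (g\<^sub>j(U\<^sub>j) - g\<^sub>j(U\<^sub>i)) c\<^sub>i\<^sub>j / (2 d\<^sub>i\<^sub>j)\<close>,
  sums over the neighbours \<open>j \<noteq> i\<close> (\<open>ale_update_in_invariant_set\<close>).

  The bar states belong to \<open>B\<close>.  Testing the weak form of a Riemann problem with a product of a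
  cut-off in \<open>x\<close> and a function of \<open>t\<close> gives, for almost every \<open>t\<close>, the integral of the solution over
  the fan in terms of the two states, their fluxes and the speeds (\<open>riemann_fan_identity\<close>).  Hence \<open>V\<^sub>i\<^sub>j\<close>
  is a combination of \<open>U\<^sub>i\<close>, \<open>U\<^sub>j\<close> and a fan average, whose weights are nonnegative exactly because
  \<open>d\<^sub>i\<^sub>j\<close> dominates the wave speeds times the norm of \<open>c\<^sub>i\<^sub>j\<close> (\<open>bar_state_in_invariant_set\<close>).

  The weight of \<open>U\<^sub>i\<close> is nonnegative under the time step restriction.  As \<open>c\<^sub>j\<^sub>i = - c\<^sub>i\<^sub>j\<close>
  (\<open>cvec_antisym\<close>), \<open>d\<^sub>i\<^sub>j\<close> is at most the maximal speed times the norm of \<open>c\<^sub>i\<^sub>j\<close>, which in turn is at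
  most the overlap mass divided by the mesh size (\<open>cvec_bound\<close>, \<open>viscosity_le_if_cfl\<close>).

  The geometric conservation law is the definition of the masses in version 1.  In version 2 it is
  proved on the reference elements: at every reference point the Jacobian determinant of the moving
  mesh is a polynomial in time of degree at most \<open>d\<close> without zeros during the step, so that the quadrature
  integrates the derivative of its absolute value exactly (\<open>quadrature_integrates_abs_det\<close>);
  multiplying by a shape function and integrating gives the law (\<open>mass_increment\<close>).  There the
  neighbours must not depend on time, which holds since they are determined by the reference
  elements alone (\<open>nb_iff_ref_supp\<close>).

  The analysis on the mesh rests on two facts: off a null set, the skeleton, the shape functions are
  differentiable, and they are locally Lipschitz (\<open>psi_locally_lipschitz\<close>).  Gradients are then limits
  of bounded difference quotients, and integration by parts follows from the invariance of the
  Lebesgue measure under translations, without boundary integrals over the faces.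
\<close>

section \<open>Smooth functions of one variable\<close>

text \<open>The witness is a set closed under differentiation, because such sets arise from inductive
  definitions; a sequence of derivatives is recovered by choice.\<close>

definition smooth :: "(real \<Rightarrow> real) \<Rightarrow> bool" where
  "smooth f \<longleftrightarrow> (\<exists>S. f \<in> S \<and> (\<forall>g\<in>S. \<exists>g'\<in>S. \<forall>x. (g has_real_derivative g' x) (at x)))"

lemma smooth_derivatives:
  assumes "smooth f"
  obtains D :: "nat \<Rightarrow> real \<Rightarrow> real" where "D 0 = f"
    "\<And>k x. (D k has_real_derivative D (Suc k) x) (at x)"
proof -
  obtain S where S: "f \<in> S" "\<forall>g\<in>S. \<exists>g'\<in>S. \<forall>x. (g has_real_derivative g' x) (at x)"
    using assms by (auto simp: smooth_def)
  have "\<exists>D. \<forall>k. (D k \<in> S \<and> (k = 0 \<longrightarrow> D k = f)) \<and> (\<forall>x. (D k has_real_derivative D (Suc k) x) (at x))"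
    by (rule dependent_nat_choice[where P = "\<lambda>k g. g \<in> S \<and> (k = 0 \<longrightarrow> g = f)"
          and Q = "\<lambda>k g g'. \<forall>x. (g has_real_derivative g' x) (at x)"]) (use S in auto)
  then show thesis using that by blast
qed

lemma smooth_antiderivative:
  assumes "smooth g" "\<And>x. (f has_real_derivative g x) (at x)"
  shows "smooth f"
proof -
  obtain S where S: "g \<in> S" "\<forall>g\<in>S. \<exists>g'\<in>S. \<forall>x. (g has_real_derivative g' x) (at x)"
    using assms by (auto simp: smooth_def)
  then show ?thesis unfolding smooth_def using assms(2)
    by (intro exI[of _ "insert f S"]) blast
qed

text \<open>The functions \<open>p(1/x) e\<^sup>-\<^sup>1\<^sup>/\<^sup>x\<close>, continued by zero: a family closed under differentiation whose
  member for \<open>p = 1\<close> is the standard smooth function that is flat at \<open>0\<close>.\<close>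

definition flat_exp :: "real poly \<Rightarrow> real \<Rightarrow> real" where
  "flat_exp p x = (if 0 < x then poly p (1 / x) * exp (- 1 / x) else 0)"

lemma poly_exp_decay: "((\<lambda>y. poly p y * exp (- y)) \<longlongrightarrow> 0) (at_top :: real filter)"
proof -
  have "((\<lambda>y. \<Sum>i\<le>degree p. coeff p i * (y ^ i / exp y)) \<longlongrightarrow> (\<Sum>i\<le>degree p. coeff p i * 0)) at_top"
    by (intro tendsto_intros tendsto_power_div_exp_0)
  moreover have "poly p y * exp (- y) = (\<Sum>i\<le>degree p. coeff p i * (y ^ i / exp y))" for y :: real
    by (simp add: poly_altdef sum_distrib_right exp_minus divide_inverse mult.assoc)
  ultimately show ?thesis by simp
qed

text \<open>At \<open>0\<close> the difference quotient is again a polynomial in \<open>1/h\<close> times \<open>e\<^sup>-\<^sup>1\<^sup>/\<^sup>h\<close> and tends to \<open>0\<close>.\<close>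

lemma flat_exp_derivative:
  "(flat_exp p has_real_derivative flat_exp ([:0, 0, 1:] * (p - pderiv p)) x) (at x)"
proof -
  consider "x < 0" | "x = 0" | "0 < x" by linarith
  then show ?thesis
  proof cases
    case 1
    have "((\<lambda>_. 0) has_real_derivative 0) (at x)" by simp
    then have "(flat_exp p has_real_derivative 0) (at x)"
      by (rule has_field_derivative_transform_within_open[of _ _ _ "{..<0}"])
        (use 1 in \<open>auto simp: flat_exp_def\<close>)
    then show ?thesis using 1 by (simp add: flat_exp_def)
  next
    case 2
    have "((\<lambda>y. poly (pCons 0 p) y * exp (- y)) \<longlongrightarrow> 0) (at_top :: real filter)"
      by (rule poly_exp_decay)
    then have "((\<lambda>h. poly (pCons 0 p) (inverse h) * exp (- inverse h)) \<longlongrightarrow> 0) (at_right (0::real))"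
      by (rule filterlim_compose) (rule filterlim_inverse_at_top_right)
    then have "((\<lambda>h. flat_exp p h / h) \<longlongrightarrow> 0) (at_right 0)"
      by (rule tendsto_cong[THEN iffD1, rotated])
        (auto simp: eventually_at_right_field flat_exp_def divide_inverse mult_ac intro!: exI[of _ 1])
    moreover have "((\<lambda>h. flat_exp p h / h) \<longlongrightarrow> 0) (at_left 0)"
      by (rule tendsto_eventually) (auto simp: eventually_at_left_field flat_exp_def intro!: exI[of _ "-1"])
    ultimately have "((\<lambda>h. flat_exp p h / h) \<longlongrightarrow> 0) (at 0)"
      by (simp add: filterlim_split_at)
    then show ?thesis using 2 by (simp add: DERIV_def) (simp add: flat_exp_def)
  next
    case 3
    have "((\<lambda>x. poly p (1 / x) * exp (- 1 / x)) has_real_derivative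
        flat_exp ([:0, 0, 1:] * (p - pderiv p)) x) (at x)"
      by (rule DERIV_cong)
        (use 3 in \<open>auto intro!: derivative_eq_intros simp: flat_exp_def field_simps power2_eq_square\<close>)
    then show ?thesis
      by (rule has_field_derivative_transform_within_open[of _ _ _ "{0<..}"])
        (use 3 in \<open>auto simp: flat_exp_def\<close>)
  qed
qed

text \<open>All bumps and cut-offs are built by these operations, so that their smoothness is a single induction
  on first derivatives.\<close>

inductive_set flat_algebra :: "(real \<Rightarrow> real) set" where
  const: "(\<lambda>_. c) \<in> flat_algebra"
| flat: "(\<lambda>x. flat_exp p (a * x + b)) \<in> flat_algebra"
| add: "f \<in> flat_algebra \<Longrightarrow> g \<in> flat_algebra \<Longrightarrow> (\<lambda>x. f x + g x) \<in> flat_algebra"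
| mult: "f \<in> flat_algebra \<Longrightarrow> g \<in> flat_algebra \<Longrightarrow> (\<lambda>x. f x * g x) \<in> flat_algebra"
| inverse: "f \<in> flat_algebra \<Longrightarrow> (\<And>x. f x \<noteq> 0) \<Longrightarrow> (\<lambda>x. inverse (f x)) \<in> flat_algebra"

lemma flat_algebra_derivative:
  assumes "f \<in> flat_algebra"
  shows "\<exists>f'\<in>flat_algebra. \<forall>x. (f has_real_derivative f' x) (at x)"
  using assms
proof induction
  case (const c)
  show ?case using flat_algebra.const[of 0] by (intro bexI[of _ "\<lambda>_. 0"]) auto
next
  case (flat p a b)
  have "((\<lambda>x. flat_exp p (a * x + b)) has_real_derivative
      a * flat_exp ([:0, 0, 1:] * (p - pderiv p)) (a * x + b)) (at x)" for x
    by (rule DERIV_cong, rule DERIV_chain2[OF flat_exp_derivative])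
      (auto intro!: derivative_eq_intros)
  then show ?case
    by (intro bexI[of _ "\<lambda>x. a * flat_exp ([:0, 0, 1:] * (p - pderiv p)) (a * x + b)"])
      (auto intro: flat_algebra.intros)
next
  case (add f g)
  then obtain f' g' where "f' \<in> flat_algebra" "g' \<in> flat_algebra"
    "\<forall>x. (f has_real_derivative f' x) (at x)" "\<forall>x. (g has_real_derivative g' x) (at x)" by blast
  then show ?case
    by (intro bexI[of _ "\<lambda>x. f' x + g' x"]) (auto intro: flat_algebra.intros derivative_intros)
next
  case (mult f g)
  then obtain f' g' where *: "f' \<in> flat_algebra" "g' \<in> flat_algebra"
    "\<forall>x. (f has_real_derivative f' x) (at x)" "\<forall>x. (g has_real_derivative g' x) (at x)" by blast
  have "((\<lambda>x. f x * g x) has_real_derivative f' x * g x + g' x * f x) (at x)" for x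
    using * by (intro DERIV_mult) auto
  then show ?case
    using * mult by (intro bexI[of _ "\<lambda>x. f' x * g x + g' x * f x"]) (auto intro: flat_algebra.intros)
next
  case (inverse f)
  then obtain f' where *: "f' \<in> flat_algebra" "\<forall>x. (f has_real_derivative f' x) (at x)" by blast
  have "((\<lambda>x. inverse (f x)) has_real_derivative (- 1) * (inverse (f x) * (f' x * inverse (f x)))) (at x)" for x
    using DERIV_inverse'[of f "f' x" x UNIV] * inverse(2) by (auto simp: mult_ac)
  moreover have "(\<lambda>x. (- 1) * (inverse (f x) * (f' x * inverse (f x)))) \<in> flat_algebra"
    by (intro flat_algebra.intros inverse *(1))
  ultimately show ?case
    by (intro bexI[of _ "\<lambda>x. (- 1) * (inverse (f x) * (f' x * inverse (f x)))"] allI)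
qed

lemma flat_algebra_continuous: "f \<in> flat_algebra \<Longrightarrow> continuous_on UNIV f"
  using flat_algebra_derivative[of f] DERIV_isCont continuous_at_imp_continuous_on by blast

lemma flat_algebra_smooth: "f \<in> flat_algebra \<Longrightarrow> smooth f"
  unfolding smooth_def using flat_algebra_derivative by (intro exI[of _ flat_algebra]) blast

text \<open>With \<open>e = flat_exp 1\<close> the step is \<open>e(kx - u) / (e(kx - u) + e(v - kx))\<close>; at least one argument is positive
  since \<open>u < v\<close>.  It rises for \<open>k = 1\<close> and falls for \<open>k = -1\<close>.\<close>

lemma flat_algebra_step:
  fixes u v k :: real
  assumes "u < v"
  obtains s where "s \<in> flat_algebra" "\<And>x. v \<le> k * x \<Longrightarrow> s x = 1" "\<And>x. k * x \<le> u \<Longrightarrow> s x = 0"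
proof -
  have fpos: "0 < flat_exp 1 y" if "0 < y" for y using that by (simp add: flat_exp_def)
  have f0: "flat_exp 1 y = 0" if "y \<le> 0" for y using that by (simp add: flat_exp_def)
  have fnn: "0 \<le> flat_exp 1 y" for y by (simp add: flat_exp_def)
  let ?p = "\<lambda>x. flat_exp 1 (k * x + (- u))" and ?q = "\<lambda>x. flat_exp 1 ((- k) * x + v)"
  have ne: "?p x + ?q x \<noteq> 0" for x
  proof -
    have "0 < k * x + - u \<or> 0 < (- k) * x + v" using assms by auto
    then show ?thesis using fpos fnn by (smt (verit))
  qed
  show thesis
  proof (rule that[of "\<lambda>x. ?p x * inverse (?p x + ?q x)"])
    show "(\<lambda>x. ?p x * inverse (?p x + ?q x)) \<in> flat_algebra"
      by (intro flat_algebra.mult flat_algebra.inverse flat_algebra.add flat_algebra.flat ne)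
    show "?p x * inverse (?p x + ?q x) = 1" if "v \<le> k * x" for x
      using that ne[of x] f0 by (simp add: field_simps)
    show "?p x * inverse (?p x + ?q x) = 0" if "k * x \<le> u" for x
      using that f0 by simp
  qed
qed

lemma flat_algebra_cutoff:
  fixes a b c d :: real
  assumes "a < b" "b \<le> c" "c < d"
  obtains \<beta> where "\<beta> \<in> flat_algebra" "\<And>x. b \<le> x \<Longrightarrow> x \<le> c \<Longrightarrow> \<beta> x = 1"
    "\<And>x. x \<le> a \<or> d \<le> x \<Longrightarrow> \<beta> x = 0"
proof -
  obtain s1 where s1: "s1 \<in> flat_algebra" "\<And>x. b \<le> 1 * x \<Longrightarrow> s1 x = 1" "\<And>x. 1 * x \<le> a \<Longrightarrow> s1 x = 0"
    using flat_algebra_step[OF assms(1), of 1] by blast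
  have "-d < -c" using assms by simp
  then obtain s2 where s2: "s2 \<in> flat_algebra" "\<And>x. -c \<le> (-1) * x \<Longrightarrow> s2 x = 1" "\<And>x. (-1) * x \<le> -d \<Longrightarrow> s2 x = 0"
    using flat_algebra_step[of "-d" "-c" "-1"] by blast
  show thesis
    by (rule that[of "\<lambda>x. s1 x * s2 x"]) (use s1 s2 in \<open>auto intro: flat_algebra.mult\<close>)
qed

lemma test_function_product:
  assumes "smooth \<beta>" "smooth \<theta>" "\<And>x. r < \<bar>x\<bar> \<Longrightarrow> \<beta> x = 0" "\<And>t. r < \<bar>t\<bar> \<Longrightarrow> \<theta> t = 0"
  shows "test_function (\<lambda>x t. \<beta> x * \<theta> t)"
proof -
  obtain C where C: "C 0 = \<beta>" "\<And>k x. (C k has_real_derivative C (Suc k) x) (at x)"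
    using smooth_derivatives[OF assms(1)] by blast
  obtain D where D: "D 0 = \<theta>" "\<And>k x. (D k has_real_derivative D (Suc k) x) (at x)"
    using smooth_derivatives[OF assms(2)] by blast
  have cC: "continuous_on UNIV (C i)" and cD: "continuous_on UNIV (D i)" for i
    using DERIV_isCont[OF C(2)] DERIV_isCont[OF D(2)] by (simp_all add: continuous_at_imp_continuous_on)
  show ?thesis unfolding test_function_def
  proof (intro conjI exI[of _ "\<lambda>i j x t. C i x * D j t"] exI[of _ r] allI impI)
    show "continuous_on UNIV (\<lambda>(x, t). C i x * D j t)" for i j
      unfolding case_prod_unfold
      by (intro continuous_intros continuous_on_compose2[OF cC] continuous_on_compose2[OF cD]) auto
    show "((\<lambda>y. C i y * D j t) has_real_derivative C (Suc i) x * D j t) (at x)" for i j x t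
      by (rule DERIV_cmult_right[OF C(2)])
    show "((\<lambda>s. C i x * D j s) has_real_derivative C i x * D (Suc j) t) (at t)" for i j x t
      by (rule DERIV_cmult[OF D(2)])
    show "\<beta> x * \<theta> t = 0" if "r < \<bar>x\<bar> \<or> r < \<bar>t\<bar>" for x t
      using that assms(3,4) by auto
  qed (simp add: C D)
qed

section \<open>The balance law over the Riemann fan\<close>

text \<open>The positive and the negative part of \<open>p\<close> are densities of two finite measures that agree on all
  half-lines; hence they are equal.\<close>

lemma AE_zero_if_integrals_zero_real:
  fixes p :: "real \<Rightarrow> real"
  assumes int: "set_integrable lborel {0<..<1} p"
    and zero: "\<And>a b. 0 \<le> a \<Longrightarrow> a < b \<Longrightarrow> b \<le> 1 \<Longrightarrow> (LINT t:{a<..<b}|lborel. p t) = 0"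
  shows "AE t in lborel. t \<in> {0<..<1} \<longrightarrow> p t = 0"
proof -
  define q where "q t = indicator {0<..<1} t * p t" for t
  have q[measurable]: "integrable lborel q"
    using int unfolding set_integrable_def q_def by (simp add: mult.commute)
  have meas[measurable]: "q \<in> borel_measurable lborel" using q by simp
  have z: "(LINT t:{x<..}|lborel. q t) = 0" for x
  proof (cases "x < 1")
    case True
    have "(LINT t:{x<..}|lborel. q t) = (LINT t:{max x 0<..<1}|lborel. p t)"
      unfolding set_lebesgue_integral_def q_def
      by (intro Bochner_Integration.integral_cong) (auto simp: indicator_def)
    then show ?thesis using zero[of "max x 0" 1] True by simp
  next
    case False
    then show ?thesis
      unfolding set_lebesgue_integral_def q_def
      by (intro integral_eq_zero_AE AE_I2) (auto simp: indicator_def)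
  qed
  let ?P = "density lborel (\<lambda>t. ennreal (q t))" and ?N = "density lborel (\<lambda>t. ennreal (- q t))"
  have iP: "integrable lborel (\<lambda>t. max (q t) 0 * indicator {x<..} t)"
    and iN: "integrable lborel (\<lambda>t. max (- q t) 0 * indicator {x<..} t)" for x
    by (intro integrable_real_mult_indicator integrable_max q integrable_zero Bochner_Integration.integrable_minus; simp)+
  have eP: "emeasure ?P {x<..} = ennreal (LINT t|lborel. max (q t) 0 * indicator {x<..} t)" for x
  proof -
    have "emeasure ?P {x<..} = (\<integral>\<^sup>+t. ennreal (q t) * indicator {x<..} t \<partial>lborel)"
      by (rule emeasure_density) auto
    also have "\<dots> = (\<integral>\<^sup>+t. ennreal (max (q t) 0 * indicator {x<..} t) \<partial>lborel)"
      by (rule nn_integral_cong) (auto simp: indicator_def max_def ennreal_neg)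
    also have "\<dots> = ennreal (LINT t|lborel. max (q t) 0 * indicator {x<..} t)"
      by (rule nn_integral_eq_integral[OF iP]) simp
    finally show ?thesis .
  qed
  have eN: "emeasure ?N {x<..} = ennreal (LINT t|lborel. max (- q t) 0 * indicator {x<..} t)" for x
  proof -
    have "emeasure ?N {x<..} = (\<integral>\<^sup>+t. ennreal (- q t) * indicator {x<..} t \<partial>lborel)"
      by (rule emeasure_density) auto
    also have "\<dots> = (\<integral>\<^sup>+t. ennreal (max (- q t) 0 * indicator {x<..} t) \<partial>lborel)"
      by (rule nn_integral_cong) (auto simp: indicator_def max_def ennreal_neg)
    also have "\<dots> = ennreal (LINT t|lborel. max (- q t) 0 * indicator {x<..} t)"
      by (rule nn_integral_eq_integral[OF iN]) simp
    finally show ?thesis .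
  qed
  have "(LINT t|lborel. max (q t) 0 * indicator {x<..} t) - (LINT t|lborel. max (- q t) 0 * indicator {x<..} t)
      = (LINT t:{x<..}|lborel. q t)" for x
    unfolding set_lebesgue_integral_def
    by (subst Bochner_Integration.integral_diff[symmetric, OF iP iN])
      (auto intro!: Bochner_Integration.integral_cong simp: max_def split: split_indicator)
  with z eP eN have "?P = ?N"
    by (intro measure_eqI_lessThan) auto
  then have "AE t in lborel. ennreal (q t) = ennreal (- q t)"
    by (subst (asm) sigma_finite_measure.density_unique_iff[OF sigma_finite_lborel]) auto
  then show ?thesis
  proof eventually_elim
    case (elim t)
    then have "max 0 (q t) = max 0 (- q t)" using enn2real_ennreal by (metis ennreal_inj max.cobounded1 ennreal_max_0)
    then have "q t = 0" by linarith
    then show ?case by (auto simp: q_def)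
  qed
qed

text \<open>The bumps \<open>flat_exp 1 (k (t - a)) * flat_exp 1 (k (b - t))\<close> are bounded by \<open>1\<close> and tend to the
  indicator of \<open>(a, b)\<close> as \<open>k\<close> grows, so that the integrals of \<open>P\<close> over all intervals vanish.\<close>

lemma AE_zero_if_smooth_moments_zero:
  fixes P :: "real \<Rightarrow> real^'m"
  assumes int: "set_integrable lborel {0<..<1} P"
    and zero: "\<And>g. g \<in> flat_algebra \<Longrightarrow> (\<And>t. t \<notin> {0<..<1} \<Longrightarrow> g t = 0) \<Longrightarrow>
          (LINT t:{0<..<1}|lborel. g t *\<^sub>R P t) = 0"
  shows "AE t in lborel. t \<in> {0<..<1} \<longrightarrow> P t = 0"
proof -
  have step: "(LINT t:{a<..<b}|lborel. P t) = 0" if ab: "0 \<le> a" "a < b" "b \<le> 1" for a b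
  proof -
    define g where "g k t = flat_exp 1 (real (Suc k) * t + - (real (Suc k) * a)) *
        flat_exp 1 (- real (Suc k) * t + real (Suc k) * b)" for k t
    have g_alg: "g k \<in> flat_algebra" for k
      unfolding g_def by (intro flat_algebra.intros)
    have g_in: "g k t = exp (- 1 / (real (Suc k) * (t - a))) * exp (- 1 / (real (Suc k) * (b - t)))"
      if "t \<in> {a<..<b}" for k t
    proof -
      have "real (Suc k) * t + - (real (Suc k) * a) = real (Suc k) * (t - a)"
        "- real (Suc k) * t + real (Suc k) * b = real (Suc k) * (b - t)" by (simp_all add: algebra_simps)
      then show ?thesis using that unfolding g_def flat_exp_def by simp
    qed
    have g_out: "g k t = 0" if "t \<notin> {a<..<b}" for k t
    proof -
      have "real (Suc k) * t + - (real (Suc k) * a) = real (Suc k) * (t - a)"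
        "- real (Suc k) * t + real (Suc k) * b = real (Suc k) * (b - t)" by (simp_all add: algebra_simps)
      moreover have "t - a \<le> 0 \<or> b - t \<le> 0" using that by auto
      ultimately show ?thesis unfolding g_def flat_exp_def
        by (auto simp: zero_less_mult_iff)
    qed
    have "(\<lambda>k. LINT t|lborel. indicator {0<..<1} t *\<^sub>R (g k t *\<^sub>R P t)) \<longlonglongrightarrow>
        (LINT t|lborel. indicator {a<..<b} t *\<^sub>R P t)"
    proof (rule integral_dominated_convergence[where w = "\<lambda>t. norm (indicator {0<..<1} t *\<^sub>R P t)"])
      have iP: "integrable lborel (\<lambda>t. indicator {0<..<1} t *\<^sub>R P t)"
        using int by (simp add: set_integrable_def)
      then show "integrable lborel (\<lambda>t. norm (indicator {0<..<1} t *\<^sub>R P t))"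
        by (rule integrable_norm)
      have [measurable]: "(\<lambda>t. indicator {0<..<1} t *\<^sub>R P t) \<in> borel_measurable lborel" using iP by simp
      have [measurable]: "g k \<in> borel_measurable borel" for k
        by (intro borel_measurable_continuous_onI flat_algebra_continuous g_alg)
      have "(\<lambda>t. g k t *\<^sub>R (indicator {0<..<1} t *\<^sub>R P t)) \<in> borel_measurable lborel" for k
        by measurable
      then show "(\<lambda>t. indicator {0<..<1} t *\<^sub>R (g k t *\<^sub>R P t)) \<in> borel_measurable lborel" for k
        by (simp only: scaleR_left_commute)
      have "(\<lambda>t. indicator {a<..<b} t *\<^sub>R (indicator {0<..<1} t *\<^sub>R P t)) \<in> borel_measurable lborel"
        by measurable
      also have "(\<lambda>t. indicator {a<..<b} t *\<^sub>R (indicator {0<..<1} t *\<^sub>R P t)) = (\<lambda>t. indicator {a<..<b} t *\<^sub>R P t)"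
        using ab by (auto simp: fun_eq_iff indicator_def)
      finally show "(\<lambda>t. indicator {a<..<b} t *\<^sub>R P t) \<in> borel_measurable lborel" .
      have "(\<lambda>k. indicator {0<..<1} t *\<^sub>R (g k t *\<^sub>R P t)) \<longlonglongrightarrow> indicator {a<..<b} t *\<^sub>R P t" for t
      proof (cases "t \<in> {a<..<b}")
        case True
        have "(\<lambda>k. exp (- (inverse (t - a)) * inverse (real (Suc k))) * exp (- (inverse (b - t)) * inverse (real (Suc k)))) \<longlonglongrightarrow>
            exp (- (inverse (t - a)) * 0) * exp (- (inverse (b - t)) * 0)"
          by (intro tendsto_intros LIMSEQ_inverse_real_of_nat)
        then have "(\<lambda>k. g k t) \<longlonglongrightarrow> 1"
          using g_in[OF True] by (simp add: field_simps del: of_nat_Suc)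
        then have "(\<lambda>k. g k t *\<^sub>R P t) \<longlonglongrightarrow> 1 *\<^sub>R P t" by (intro tendsto_intros)
        then show ?thesis using True ab by auto
      next
        case False then show ?thesis using g_out by auto
      qed
      then show "AE t in lborel. (\<lambda>k. indicator {0<..<1} t *\<^sub>R (g k t *\<^sub>R P t)) \<longlonglongrightarrow> indicator {a<..<b} t *\<^sub>R P t"
        by simp
      have "\<bar>g k t\<bar> \<le> 1" for k t
        using g_in[of t k] g_out[of t k] by (cases "t \<in> {a<..<b}") (auto intro!: mult_le_one)
      then show "AE t in lborel. norm (indicator {0<..<1} t *\<^sub>R (g k t *\<^sub>R P t)) \<le> norm (indicator {0<..<1} t *\<^sub>R P t)" for k
        by (auto simp: indicator_def mult_left_le_one_le)
    qed
    moreover have "(LINT t|lborel. indicator {0<..<1} t *\<^sub>R (g k t *\<^sub>R P t)) = 0" for k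
    proof -
      have "g k t = 0" if "t \<notin> {0<..<1}" for t using g_out[of t k] that ab by auto
      then show ?thesis using zero[OF g_alg[of k]] by (simp add: set_lebesgue_integral_def)
    qed
    ultimately show ?thesis unfolding set_lebesgue_integral_def
      by (simp add: LIMSEQ_const_iff)
  qed
  have "AE t in lborel. t \<in> {0<..<1} \<longrightarrow> P t $ k = 0" for k
  proof (rule AE_zero_if_integrals_zero_real)
    have *: "integrable lborel (\<lambda>t. indicator {a<..<b} t *\<^sub>R P t)" if "0 \<le> a" "a < b" "b \<le> 1" for a b
      using set_integrable_subset[OF int, of "{a<..<b}"] that by (simp add: set_integrable_def subset_eq)
    show "set_integrable lborel {0<..<1} (\<lambda>t. P t $ k)"
      using integrable_bounded_linear[OF bounded_linear_vec_nth *[of 0 1], of k] 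
      by (simp add: set_integrable_def)
    fix a b :: real assume ab: "0 \<le> a" "a < b" "b \<le> 1"
    show "(LINT t:{a<..<b}|lborel. P t $ k) = 0"
      using integral_bounded_linear[OF bounded_linear_vec_nth *[OF ab], of k] step[OF ab]
      by (simp add: set_lebesgue_integral_def)
  qed
  then have "AE t in lborel. \<forall>k. t \<in> {0<..<1} \<longrightarrow> P t $ k = 0"
    by (intro AE_all_countable[THEN iffD2] allI)
  then show ?thesis by eventually_elim (auto simp: vec_eq_iff)
qed

lemma antiderivative_vanishing_left:
  fixes g :: "real \<Rightarrow> real"
  assumes g: "continuous_on UNIV g" "\<And>t. t \<le> 0 \<Longrightarrow> g t = 0"
  obtains G where "\<And>t. (G has_real_derivative g t) (at t)" "\<And>t. t \<le> 0 \<Longrightarrow> G t = 0"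
proof -
  define G where "G t = integral {-1..t} g" for t
  have G0: "G t = 0" if "t \<le> 0" for t
    unfolding G_def using that g(2) integral_cong[of "{-1..t}" g "\<lambda>_. 0"] by auto
  have "(G has_real_derivative g t) (at t)" for t
  proof (cases "t < 0")
    case True
    have "(G has_real_derivative 0) (at t)"
      by (rule has_field_derivative_transform_within_open[of "\<lambda>_. 0" _ _ "{..<0}"]) (use True G0 in auto)
    then show ?thesis using g(2)[of t] True by simp
  next
    case False
    have "(G has_real_derivative g t) (at t within {-1..t+1})"
      unfolding G_def by (rule integral_has_real_derivative) (use False g(1) continuous_on_subset in auto)
    then show ?thesis using False at_within_Icc_at[of "-1" t "t+1"] by simp
  qed
  then show thesis using that G0 by blast
qed

lemma integrable_cutoff_product:
  fixes E :: "real \<Rightarrow> real \<Rightarrow> 'b::euclidean_space"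
  assumes E: "locally_integrable E" and a: "continuous_on UNIV a" and b: "continuous_on UNIV b"
    and a0: "\<And>x. \<rho> < \<bar>x\<bar> \<Longrightarrow> a x = 0" and \<rho>: "1 \<le> \<rho>"
  shows "integrable (lborel \<Otimes>\<^sub>M lborel) (\<lambda>(x, t). (a x * (indicator {0<..1} t * b t)) *\<^sub>R E x t)"
proof -
  define w where "w p = (indicator ({-\<rho>..\<rho>} \<times> {0<..\<rho>}) p :: real) *\<^sub>R (case p of (x, t) \<Rightarrow> E x t)" for p
  have w: "integrable (lborel \<Otimes>\<^sub>M lborel) w"
    using E \<rho> unfolding locally_integrable_def set_integrable_def w_def lborel_prod
    by (metis (no_types, lifting) less_le_trans zero_less_one)
  have [measurable]: "a \<in> borel_measurable borel" "b \<in> borel_measurable borel"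
    using a b by (auto intro: borel_measurable_continuous_onI)
  have "bounded (a ` {-\<rho>..\<rho>})" "bounded (b ` {0..1})"
    by (intro compact_imp_bounded compact_continuous_image continuous_on_subset[OF a] 
        continuous_on_subset[OF b]; simp)+
  then obtain A B where A: "\<forall>x\<in>{-\<rho>..\<rho>}. \<bar>a x\<bar> \<le> A" and B: "\<forall>x\<in>{0..1}. \<bar>b x\<bar> \<le> B"
    unfolding bounded_iff by auto
  have B0: "0 \<le> B" using B[rule_format, of 0] by auto
  have A0: "0 \<le> A" using A[rule_format, of 0] \<rho> by auto
  have eq: "(\<lambda>(x, t). (a x * (indicator {0<..1} t * b t)) *\<^sub>R E x t) =
     (\<lambda>p. (a (fst p) * (indicator {0<..1} (snd p) * b (snd p))) *\<^sub>R w p)"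
    using a0 \<rho> by (auto simp: fun_eq_iff w_def indicator_def) (meson abs_le_iff linorder_not_less minus_le_iff)+
  have wm[measurable]: "w \<in> borel_measurable (lborel \<Otimes>\<^sub>M lborel)" using w by simp
  show ?thesis unfolding eq
  proof (rule Bochner_Integration.integrable_bound)
    show "integrable (lborel \<Otimes>\<^sub>M lborel) (\<lambda>p. (A * B) *\<^sub>R w p)" using w by simp
    show "(\<lambda>p. (a (fst p) * (indicator {0<..1} (snd p) * b (snd p))) *\<^sub>R w p) \<in> borel_measurable (lborel \<Otimes>\<^sub>M lborel)"
      by measurable
    have "norm ((a (fst p) * (indicator {0<..1} (snd p) * b (snd p))) *\<^sub>R w p) \<le> norm ((A * B) *\<^sub>R w p)" for p
    proof (cases "fst p \<in> {-\<rho>..\<rho>} \<and> snd p \<in> {0<..1}")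
      case True
      then have "\<bar>a (fst p)\<bar> * \<bar>b (snd p)\<bar> \<le> A * B" using A B A0 by (intro mult_mono) auto
      then show ?thesis using True A0 B0 by (auto simp: abs_mult intro!: mult_right_mono)
    next
      case False
      then have "a (fst p) * (indicator {0<..1} (snd p) * b (snd p)) = 0"
        using a0[of "fst p"] by (auto simp: indicator_def)
      then show ?thesis by (simp only: scaleR_zero_left norm_zero norm_ge_zero)
    qed
    then show "AE p in lborel \<Otimes>\<^sub>M lborel. norm ((a (fst p) * (indicator {0<..1} (snd p) * b (snd p))) *\<^sub>R w p) \<le> norm ((A * B) *\<^sub>R w p)"
      by simp
  qed
qed

text \<open>The test functions are \<open>c(x) \<theta>(t)\<close>, where \<open>c\<close> is \<open>1\<close> on an interval that contains the fan up to
  time \<open>1\<close>.  The derivative of \<open>c\<close> lives where the solution is constant, so that the flux enters only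
  through its values at the two states; and the integral of \<open>c u\<close> in \<open>x\<close> differs from its initial value by
  \<open>Q(t) = \<integral>u - t (r uR - l uL)\<close>, the integral being over the fan.  The weak form then says that
  \<open>Q(t) - t (f uL - f uR) n\<close> is orthogonal to the smooth functions that vanish outside \<open>(0, 1)\<close>.\<close>

lemma riemann_fan_identity:
  fixes R :: "('m::finite, 'd::finite) riemann"
  assumes solv: "riemann_solvable R f" and L: "uL \<in> adm R f" and Rr: "uR \<in> adm R f" and n: "norm n = 1"
  defines "l \<equiv> lamL R f n uL uR" and "r \<equiv> lamR R f n uL uR"
  shows "AE t in lborel. t \<in> {0<..<1} \<longrightarrow>
     (LINT x:{l * t..r * t}|lborel. rsol R f n uL uR x t)
       = t *\<^sub>R (r *\<^sub>R uR - l *\<^sub>R uL - (f uR *v n - f uL *v n))"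
proof -
  define u where "u = rsol R f n uL uR"
  define F where "F x t = f (u x t) *v n" for x t
  define FL FR where "FL = f uL *v n" and "FR = f uR *v n"
  define N where "N t = (LINT x:{l * t..r * t}|lborel. u x t)" for t
  define Q where "Q t = N t + t *\<^sub>R (l *\<^sub>R uL - r *\<^sub>R uR)" for t
  \<comment> \<open>the fan stays in \<open>[-w, w]\<close> up to time \<open>1\<close>\<close>
  define w where "w = max \<bar>l\<bar> \<bar>r\<bar> + 1"
  note S = solv[unfolded riemann_solvable_def, THEN conjunct2, rule_format, OF L Rr n, folded u_def l_def r_def]
  have ent: "entropy_solution f n uL uR u" and lr: "l \<le> r" using S by auto
  have slice: "AE x in lborel. (x \<le> t * l \<longrightarrow> u x t = uL) \<and> (t * r \<le> x \<longrightarrow> u x t = uR)" if "0 < t" for t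
    using S that by blast
  have li_u: "locally_integrable u" and li_F: "locally_integrable F"
    and slice_int: "\<And>t \<rho>. 0 < t \<Longrightarrow> 0 < \<rho> \<Longrightarrow> set_integrable lborel {-\<rho>..\<rho>} (\<lambda>x. u x t)"
    and weak: "\<And>\<phi>. test_function \<phi> \<Longrightarrow> weak_form u F (riemann_datum uL uR) \<phi> = 0"
    using ent unfolding entropy_solution_def F_def by auto
  have w: "1 \<le> w" "\<bar>l\<bar> \<le> w" "\<bar>r\<bar> \<le> w" unfolding w_def by auto
  have tw: "-w \<le> t * l" "t * l \<le> t * r" "t * r \<le> w" if "0 < t" "t \<le> 1" for t
  proof -
    have "\<bar>t * l\<bar> \<le> 1 * w" "\<bar>t * r\<bar> \<le> 1 * w" unfolding abs_mult using that w by (intro mult_mono; simp)+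
    then show "-w \<le> t * l" "t * l \<le> t * r" "t * r \<le> w" using lr that by (auto simp: mult_left_mono)
  qed
  obtain c where c: "c \<in> flat_algebra" "\<And>x. -w \<le> x \<Longrightarrow> x \<le> w \<Longrightarrow> c x = 1"
    "\<And>x. x \<le> -w - 1 \<or> w + 1 \<le> x \<Longrightarrow> c x = 0"
    using flat_algebra_cutoff[of "-w - 1" "-w" w "w + 1"] w by auto
  obtain c' where c': "c' \<in> flat_algebra" "\<And>x. (c has_real_derivative c' x) (at x)"
    using flat_algebra_derivative[OF c(1)] by auto
  have c'0: "c' x = 0" if x: "(-w < x \<and> x < w) \<or> x < -w - 1 \<or> w + 1 < x" for x
  proof -
    consider "-w < x" "x < w" | "x < -w - 1" | "w + 1 < x" using x by blast
    then have "(c has_real_derivative 0) (at x)"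
    proof cases
      case 1
      show ?thesis by (rule has_field_derivative_transform_within_open[of "\<lambda>_. 1" _ _ "{-w<..<w}"]) (use 1 c in auto)
    next
      case 2
      show ?thesis by (rule has_field_derivative_transform_within_open[of "\<lambda>_. 0" _ _ "{..<-w-1}"]) (use 2 c in auto)
    next
      case 3
      show ?thesis by (rule has_field_derivative_transform_within_open[of "\<lambda>_. 0" _ _ "{w+1<..}"]) (use 3 c in auto)
    qed
    then show ?thesis using c'(2) DERIV_unique by blast
  qed
  define M0 where "M0 = (LINT x|lborel. c x *\<^sub>R riemann_datum uL uR x)"
  have cont: "continuous_on UNIV c" "continuous_on UNIV c'" using c c' flat_algebra_continuous by auto
  have [measurable]: "c \<in> borel_measurable borel" "c' \<in> borel_measurable borel"
    using cont by (auto intro: borel_measurable_continuous_onI)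
  have cbd: "\<exists>C. \<forall>x. \<bar>g x\<bar> \<le> C" if "continuous_on UNIV g" "\<And>x. x < -w - 1 \<or> w + 1 < x \<Longrightarrow> g x = 0" for g :: "real \<Rightarrow> real"
  proof -
    have "bounded (g ` {-w-1..w+1})"
      by (intro compact_imp_bounded compact_continuous_image continuous_on_subset[OF that(1)]) auto
    then obtain C where "\<forall>x\<in>{-w-1..w+1}. \<bar>g x\<bar> \<le> C" unfolding bounded_iff by auto
    then show ?thesis using that(2) by (intro exI[of _ "max C 0"]) (smt (verit) atLeastAtMost_iff)
  qed
  have slice_meas: "(\<lambda>x. indicator {-\<rho>..\<rho>} x *\<^sub>R u x t) \<in> borel_measurable lborel" if "0 < t" for t \<rho>
    using slice_int[OF that, of "max \<rho> 1"] set_integrable_subset[of lborel "{- max \<rho> 1..max \<rho> 1}" "\<lambda>x. u x t" "{-\<rho>..\<rho>}"]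
    by (auto simp: set_integrable_def)
  have d_meas[measurable]: "riemann_datum uL uR \<in> borel_measurable borel"
    unfolding riemann_datum_def[abs_def] by measurable
  have mom_u: "(LINT x|lborel. c x *\<^sub>R u x t) = M0 + Q t" if t: "0 < t" "t \<le> 1" for t
  proof -
    note tw = tw[OF t]
    let ?d = "riemann_datum uL uR"
    have iv: "integrable lborel (\<lambda>x. indicator {p..<q} x *\<^sub>R v)" "integrable lborel (\<lambda>x. indicator {p<..q} x *\<^sub>R v)"
      "integrable lborel (\<lambda>x. indicator {p..q} x *\<^sub>R v)" for p q :: real and v :: "real^'m"
      by (intro integrable_scaleR_left integrable_real_indicator; cases "p \<le> q"; auto)+
    have iu: "integrable lborel (\<lambda>x. indicator {-w..w} x *\<^sub>R u x t)"
      using slice_int[OF t(1), of w] w by (simp add: set_integrable_def)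
    have iN: "integrable lborel (\<lambda>x. indicator {l * t..r * t} x *\<^sub>R u x t)"
      using set_integrable_subset[OF iu[folded set_integrable_def], of "{l * t..r * t}"] tw
      by (simp add: set_integrable_def mult.commute)
    have d_eq: "(\<lambda>x. indicator {-w..w} x *\<^sub>R ?d x) = (\<lambda>x. indicator {-w..<0} x *\<^sub>R uL + indicator {0..w} x *\<^sub>R uR)"
      using w by (auto simp: fun_eq_iff riemann_datum_def indicator_def)
    have id: "integrable lborel (\<lambda>x. indicator {-w..w} x *\<^sub>R ?d x)"
      unfolding d_eq by (intro Bochner_Integration.integrable_add iv)
    have d: "(LINT x|lborel. indicator {-w..w} x *\<^sub>R ?d x) = w *\<^sub>R uL + w *\<^sub>R uR"
      unfolding d_eq using w by (subst Bochner_Integration.integral_add) (auto intro!: iv)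
    have "(LINT x|lborel. indicator {-w..w} x *\<^sub>R u x t) =
       (LINT x|lborel. indicator {-w..<t * l} x *\<^sub>R uL + indicator {l * t..r * t} x *\<^sub>R u x t + indicator {t * r<..w} x *\<^sub>R uR)"
    proof (rule integral_cong_AE)
      show "AE x in lborel. indicator {-w..w} x *\<^sub>R u x t = indicator {-w..<t * l} x *\<^sub>R uL + indicator {l * t..r * t} x *\<^sub>R u x t + indicator {t * r<..w} x *\<^sub>R uR"
        using slice[OF t(1)] by eventually_elim (use tw in \<open>auto simp: indicator_def mult.commute\<close>)
    qed (use iu iN iv in \<open>auto intro!: borel_measurable_add\<close>)
    also have "\<dots> = (t * l + w) *\<^sub>R uL + N t + (w - t * r) *\<^sub>R uR"
      using tw iv iN by (simp add: N_def set_lebesgue_integral_def)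
    finally have u: "(LINT x|lborel. indicator {-w..w} x *\<^sub>R u x t) = (t * l + w) *\<^sub>R uL + N t + (w - t * r) *\<^sub>R uR" .
    have icd: "integrable lborel (\<lambda>x. c x *\<^sub>R ?d x)"
    proof -
      obtain C where C: "\<And>x. \<bar>c x\<bar> \<le> C" using cbd[OF cont(1)] c(3) by (metis less_eq_real_def)
      show ?thesis
      proof (rule Bochner_Integration.integrable_bound)
      show "integrable lborel (\<lambda>x. indicator {-w-1..w+1} x *\<^sub>R (C * (norm uL + norm uR)))"
        using w by (intro integrable_scaleR_left integrable_real_indicator) auto
      show "AE x in lborel. norm (c x *\<^sub>R ?d x) \<le> norm (indicator {-w-1..w+1} x *\<^sub>R (C * (norm uL + norm uR)))"
      proof (rule AE_I2)
        fix x
        have "0 \<le> C" using C[of 0] by auto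
        then have "\<bar>c x\<bar> * norm (?d x) \<le> C * (norm uL + norm uR)"
          by (intro mult_mono C) (auto simp: riemann_datum_def)
        then show "norm (c x *\<^sub>R ?d x) \<le> norm (indicator {-w-1..w+1} x *\<^sub>R (C * (norm uL + norm uR)))"
          using c(3)[of x] by (auto simp: indicator_def)
      qed
      qed measurable
    qed
    have "(LINT x|lborel. c x *\<^sub>R u x t) =
        (LINT x|lborel. c x *\<^sub>R ?d x + (indicator {-w..w} x *\<^sub>R u x t - indicator {-w..w} x *\<^sub>R ?d x))"
    proof (rule integral_cong_AE)
      have "(\<lambda>x. c x *\<^sub>R (indicator {-(w+1)..w+1} x *\<^sub>R u x t)) \<in> borel_measurable lborel"
        using slice_meas[OF t(1), of "w+1"] by measurable
      also have "(\<lambda>x. c x *\<^sub>R (indicator {-(w+1)..w+1} x *\<^sub>R u x t)) = (\<lambda>x. c x *\<^sub>R u x t)"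
      proof
        show "c x *\<^sub>R (indicator {-(w+1)..w+1} x *\<^sub>R u x t) = c x *\<^sub>R u x t" for x
          using c(3)[of x] by (cases "x \<in> {-(w+1)..w+1}") auto
      qed
      finally show "(\<lambda>x. c x *\<^sub>R u x t) \<in> borel_measurable lborel" .
      show "(\<lambda>x. c x *\<^sub>R ?d x + (indicator {-w..w} x *\<^sub>R u x t - indicator {-w..w} x *\<^sub>R ?d x)) \<in> borel_measurable lborel"
        using icd iu id by auto
      show "AE x in lborel. c x *\<^sub>R u x t = c x *\<^sub>R ?d x + (indicator {-w..w} x *\<^sub>R u x t - indicator {-w..w} x *\<^sub>R ?d x)"
        using slice[OF t(1)]
      proof eventually_elim
        case (elim x)
        consider "x < -w" | "-w \<le> x" "x \<le> w" | "w < x" by linarith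
        then show ?case
        proof cases
          case 1 then have "u x t = ?d x" using elim tw w by (auto simp: riemann_datum_def)
          then show ?thesis using 1 by simp
        next
          case 2 then show ?thesis using c(2) by simp
        next
          case 3 then have "u x t = ?d x" using elim tw w by (auto simp: riemann_datum_def)
          then show ?thesis using 3 by simp
        qed
      qed
    qed
    also have "\<dots> = M0 + ((t * l + w) *\<^sub>R uL + N t + (w - t * r) *\<^sub>R uR - (w *\<^sub>R uL + w *\<^sub>R uR))"
      using icd iu id by (simp add: M0_def u d)
    finally show ?thesis unfolding Q_def by (simp add: algebra_simps)
  qed
  have mom_F: "(LINT x|lborel. c' x *\<^sub>R F x t) = FL - FR"
    if t: "0 < t" "t \<le> 1" and meas: "(\<lambda>x. c' x *\<^sub>R F x t) \<in> borel_measurable lborel" for t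
  proof -
    note tw = tw[OF t]
    have b: "has_bochner_integral lborel (\<lambda>x. c' x * indicator {p..q} x) (c q - c p)" if "p \<le> q" for p q
      by (rule has_bochner_integral_FTC_Icc_real) (use that c'(2) cont in \<open>auto intro: continuous_on_subset continuous_on_interior
        has_field_derivative_at_within\<close>)
    have "(LINT x|lborel. c' x *\<^sub>R F x t) =
        (LINT x|lborel. (c' x * indicator {-w-2..0} x) *\<^sub>R FL + (c' x * indicator {0..w+2} x) *\<^sub>R FR)"
    proof (rule integral_cong_AE)
      show "AE x in lborel. c' x *\<^sub>R F x t = (c' x * indicator {-w-2..0} x) *\<^sub>R FL + (c' x * indicator {0..w+2} x) *\<^sub>R FR"
        using slice[OF t(1)]
      proof eventually_elim
        case (elim x)
        consider "x < -w-1 \<or> w+1 < x \<or> (-w < x \<and> x < w)" | "-w-1 \<le> x" "x \<le> -w" | "w \<le> x" "x \<le> w+1" by linarith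
        then show ?case
        proof cases
          case 1 then have "c' x = 0" by (intro c'0) auto
          then show ?thesis by simp
        next
          case 2 then have "u x t = uL" using elim tw by auto
          then show ?thesis using 2 w by (simp add: F_def FL_def)
        next
          case 3 then have "u x t = uR" using elim tw by auto
          then show ?thesis using 3 w by (simp add: F_def FR_def)
        qed
      qed
      show "(\<lambda>x. (c' x * indicator {-w-2..0} x) *\<^sub>R FL + (c' x * indicator {0..w+2} x) *\<^sub>R FR) \<in> borel_measurable lborel"
        by measurable
      show "(\<lambda>x. c' x *\<^sub>R F x t) \<in> borel_measurable lborel"
        by (rule meas)
    qed
    also have "\<dots> = (c 0 - c (-w-2)) *\<^sub>R FL + (c (w+2) - c 0) *\<^sub>R FR"
      using b[of "-w-2" 0] b[of 0 "w+2"] w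
      by (intro has_bochner_integral_integral_eq has_bochner_integral_add has_bochner_integral_scaleR_left) auto
    also have "\<dots> = FL - FR" using c(2)[of 0] c(3)[of "-w-2"] c(3)[of "w+2"] w by simp
    finally show ?thesis .
  qed
  have c_out: "c x = 0" and c'_out: "c' x = 0" if "w + 2 < \<bar>x\<bar>" for x
  proof -
    have "x < -w - 1 \<or> w + 1 < x" using that by linarith
    then show "c x = 0" "c' x = 0" using c(3)[of x] c'0[of x] by auto
  qed
  have int_u: "integrable (lborel \<Otimes>\<^sub>M lborel) (\<lambda>(x, t). (c x * (indicator {0<..1} t * g t)) *\<^sub>R u x t)"
    and int_F: "integrable (lborel \<Otimes>\<^sub>M lborel) (\<lambda>(x, t). (c' x * (indicator {0<..1} t * g t)) *\<^sub>R F x t)"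
    if "continuous_on UNIV g" for g :: "real \<Rightarrow> real"
    by (rule integrable_cutoff_product[OF li_u cont(1) that, of "w + 2"] integrable_cutoff_product[OF li_F cont(2) that, of "w + 2"];
      use w c_out c'_out in simp)+
  have mom_F_AE: "AE t in lborel. t \<in> {0<..1} \<longrightarrow> (LINT x|lborel. c' x *\<^sub>R F x t) = FL - FR"
    using lborel_pair.AE_integrable_snd[OF int_F[OF continuous_on_const[of _ 1]]]
  proof eventually_elim
    case (elim t)
    show ?case
    proof
      assume t: "t \<in> {0<..1}"
      then have "(\<lambda>x. c' x *\<^sub>R F x t) \<in> borel_measurable lborel" using borel_measurable_integrable[OF elim] by simp
      then show "(LINT x|lborel. c' x *\<^sub>R F x t) = FL - FR" using mom_F[of t] t by auto
    qed
  qed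
  have slice_u: "(LINT x|lborel. (c x * (indicator {0<..1} t * g t)) *\<^sub>R u x t) = (indicator {0<..1} t * g t) *\<^sub>R (M0 + Q t)" for t g
  proof (cases "t \<in> {0<..1}")
    case True
    have "(LINT x|lborel. (c x * (indicator {0<..1} t * g t)) *\<^sub>R u x t) = (LINT x|lborel. g t *\<^sub>R (c x *\<^sub>R u x t))"
      using True by (simp add: mult.commute)
    also have "\<dots> = g t *\<^sub>R (LINT x|lborel. c x *\<^sub>R u x t)" by (rule integral_scaleR_right)
    finally show ?thesis using True mom_u[of t] by simp
  qed simp
  have slice_F: "(LINT x|lborel. (c' x * (indicator {0<..1} t * g t)) *\<^sub>R F x t) = (indicator {0<..1} t * g t) *\<^sub>R (LINT x|lborel. c' x *\<^sub>R F x t)" for t g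
  proof (cases "t \<in> {0<..1}")
    case True
    have "(LINT x|lborel. (c' x * (indicator {0<..1} t * g t)) *\<^sub>R F x t) = (LINT x|lborel. g t *\<^sub>R (c' x *\<^sub>R F x t))"
      using True by (simp add: mult.commute)
    also have "\<dots> = g t *\<^sub>R (LINT x|lborel. c' x *\<^sub>R F x t)" by (rule integral_scaleR_right)
    finally show ?thesis using True by simp
  qed simp
  have int_slice_u: "integrable lborel (\<lambda>t. (indicator {0<..1} t * g t) *\<^sub>R (M0 + Q t))" if "continuous_on UNIV g" for g
    using lborel_pair.integrable_snd[OF int_u[OF that]] unfolding slice_u by simp
  have ind_int: "integrable lborel (\<lambda>t. indicator {0<..1} t * g t)" if "continuous_on UNIV g" for g :: "real \<Rightarrow> real"
  proof -
    have "integrable lborel (\<lambda>t. g t * indicator {0..1} t)"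
      using borel_integrable_compact[of "{0..1}" g] continuous_on_subset[OF that subset_UNIV, of "{0..1}"]
      by (simp add: mult.commute compact_Icc)
    then have "integrable lborel (\<lambda>t. (g t * indicator {0..1} t) * indicator {0<..1} t)"
      by (rule integrable_real_mult_indicator[rotated]) simp
    also have "(\<lambda>t. (g t * indicator {0..1} t) * indicator {0<..1} t) = (\<lambda>t. indicator {0<..1} t * g t)"
      by (auto simp: fun_eq_iff indicator_def)
    finally show ?thesis .
  qed
  have const_int: "integrable lborel (\<lambda>t. (indicator {0<..1} t * g t) *\<^sub>R v)" if "continuous_on UNIV g" for g :: "real \<Rightarrow> real" and v :: "real^'m"
    by (rule integrable_scaleR_left) (rule ind_int[OF that])
  have int_Q: "integrable lborel (\<lambda>t. (indicator {0<..1} t * g t) *\<^sub>R Q t)" if "continuous_on UNIV g" for g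
    using Bochner_Integration.integrable_diff[OF int_slice_u[OF that] const_int[OF that, of M0]]
    by (simp add: algebra_simps)

  have "AE t in lborel. t \<in> {0<..<1} \<longrightarrow> Q t - t *\<^sub>R (FL - FR) = 0"
  proof (rule AE_zero_if_smooth_moments_zero)
    have "set_integrable lborel {0<..1} (\<lambda>t. Q t - t *\<^sub>R (FL - FR))"
      using Bochner_Integration.integrable_diff[OF int_Q[of "\<lambda>_. 1"] const_int[of "\<lambda>t. t" "FL - FR"]]
      by (simp add: set_integrable_def algebra_simps)
    then show "set_integrable lborel {0<..<1} (\<lambda>t. Q t - t *\<^sub>R (FL - FR))"
      by (rule set_integrable_subset) auto
    fix g assume g: "g \<in> flat_algebra" and g0: "\<And>t. t \<notin> {0<..<1} \<Longrightarrow> g t = 0"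
    have cg: "continuous_on UNIV g" by (rule flat_algebra_continuous[OF g])
    obtain G where G: "\<And>t. (G has_real_derivative g t) (at t)" "\<And>t. t \<le> 0 \<Longrightarrow> G t = 0"
      using antiderivative_vanishing_left[OF cg] g0 by auto
    have G1: "G t = G 1" if "1 \<le> t" for t
    proof (cases "t = 1")
      case False
      have "(G has_real_derivative 0) (at x)" if "1 < x" for x using G(1)[of x] g0[of x] that by simp
      moreover have "continuous_on {1..t} G"
        using DERIV_isCont[OF G(1)] by (simp add: continuous_at_imp_continuous_on)
      ultimately show ?thesis using that False DERIV_isconst_end[of 1 t G] by simp
    qed simp
    \<comment> \<open>\<open>G\<close> is constant for \<open>t \<ge> 1\<close> and need not vanish there.  Subtracting \<open>G 1 * s\<close> makes the support
        compact, and does not change the derivative for positive times.\<close>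
    obtain s where s: "s \<in> flat_algebra" "\<And>t. -1 \<le> 1 * t \<Longrightarrow> s t = 1" "\<And>t. 1 * t \<le> -2 \<Longrightarrow> s t = 0"
      using flat_algebra_step[of "-2" "-1" 1] by auto
    obtain s' where s': "s' \<in> flat_algebra" "\<And>t. (s has_real_derivative s' t) (at t)"
      using flat_algebra_derivative[OF s(1)] by auto
    have s'0: "s' t = 0" if "-1 < t" for t
    proof -
      have "(s has_real_derivative 0) (at t)"
        by (rule has_field_derivative_transform_within_open[of "\<lambda>_. 1" _ _ "{-1<..}"]) (use that s in auto)
      then show ?thesis using s'(2) DERIV_unique by blast
    qed
    define \<theta> where "\<theta> t = G t - G 1 * s t" for t
    define \<theta>' where "\<theta>' t = g t + (- G 1) * s' t" for t
    have \<theta>: "(\<theta> has_real_derivative \<theta>' t) (at t)" for t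
      unfolding \<theta>_def[abs_def] \<theta>'_def using DERIV_diff[OF G(1) DERIV_cmult[OF s'(2)]] by simp
    have "\<theta>' \<in> flat_algebra"
      unfolding \<theta>'_def[abs_def] by (rule flat_algebra.add[OF g flat_algebra.mult[OF flat_algebra.const s'(1)]])
    then have "smooth \<theta>" using smooth_antiderivative[OF flat_algebra_smooth \<theta>] by blast
    have \<theta>0: "\<theta> t = 0" if "1 \<le> t" for t using G1[OF that] s(2)[of t] that by (simp add: \<theta>_def)
    have \<theta>'g: "\<theta>' t = g t" if "0 < t" for t using s'0[of t] that by (simp add: \<theta>'_def)
    have c\<theta>: "continuous_on UNIV \<theta>" using DERIV_isCont[OF \<theta>] by (simp add: continuous_at_imp_continuous_on)
    let ?\<phi> = "\<lambda>x t. c x * \<theta> t"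
    have "test_function ?\<phi>"
    proof (rule test_function_product[of _ _ "w + 2"])
      show "\<theta> t = 0" if "w + 2 < \<bar>t\<bar>" for t
        using that w \<theta>0[of t] G(2)[of t] s(3)[of t] by (cases "0 \<le> t") (auto simp: \<theta>_def)
    qed (use c_out \<open>smooth \<theta>\<close> flat_algebra_smooth[OF c(1)] in auto)
    then have "0 = weak_form u F (riemann_datum uL uR) ?\<phi>" using weak by simp
    also have "\<dots> = (LINT p|lborel. (case p of (x, t) \<Rightarrow> (c x * (indicator {0<..1} t * g t)) *\<^sub>R u x t) +
        (case p of (x, t) \<Rightarrow> (c' x * (indicator {0<..1} t * \<theta> t)) *\<^sub>R F x t)) + \<theta> 0 *\<^sub>R M0"
    proof -
      have d1: "deriv (\<lambda>s. c x * \<theta> s) t = c x * \<theta>' t" for x t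
        by (rule DERIV_imp_deriv) (rule DERIV_cmult[OF \<theta>])
      have d2: "deriv (\<lambda>y. c y * \<theta> t) x = c' x * \<theta> t" for x t
        by (rule DERIV_imp_deriv) (rule DERIV_cmult_right[OF c'(2)])
      have "indicator (UNIV \<times> {0<..}) p *\<^sub>R (case p of (x, t) \<Rightarrow> (c x * \<theta>' t) *\<^sub>R u x t + (c' x * \<theta> t) *\<^sub>R F x t)
        = (case p of (x, t) \<Rightarrow> (c x * (indicator {0<..1} t * g t)) *\<^sub>R u x t) +
        (case p of (x, t) \<Rightarrow> (c' x * (indicator {0<..1} t * \<theta> t)) *\<^sub>R F x t)" for p
      proof -
        obtain x t where p: "p = (x, t)" by (cases p)
        consider "t \<le> 0" | "0 < t" "t \<le> 1" | "1 < t" by linarith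
        then show ?thesis using \<theta>'g[of t] \<theta>0[of t] g0[of t] by cases (auto simp: p)
      qed
      moreover have "(LINT x|lborel. (c x * \<theta> 0) *\<^sub>R riemann_datum uL uR x) = \<theta> 0 *\<^sub>R M0"
        unfolding M0_def integral_scaleR_right[symmetric] by (simp add: mult.commute)
      ultimately show ?thesis unfolding weak_form_def d1 d2 set_lebesgue_integral_def by simp
    qed
    also have "\<dots> = (LINT t|lborel. (indicator {0<..1} t * g t) *\<^sub>R (M0 + Q t)) +
        (LINT t|lborel. (indicator {0<..1} t * \<theta> t) *\<^sub>R (LINT x|lborel. c' x *\<^sub>R F x t)) + \<theta> 0 *\<^sub>R M0"
      using int_u[OF cg] int_F[OF c\<theta>] lborel_pair.integral_snd[OF int_u[OF cg]] lborel_pair.integral_snd[OF int_F[OF c\<theta>]]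
      unfolding slice_u slice_F by (simp add: lborel_prod)
    also have "(LINT t|lborel. (indicator {0<..1} t * \<theta> t) *\<^sub>R (LINT x|lborel. c' x *\<^sub>R F x t)) =
        (LINT t|lborel. (indicator {0<..1} t * \<theta> t) *\<^sub>R (FL - FR))"
    proof (rule integral_cong_AE)
      show "(\<lambda>t. (indicator {0<..1} t * \<theta> t) *\<^sub>R (LINT x|lborel. c' x *\<^sub>R F x t)) \<in> borel_measurable lborel"
        using lborel_pair.integrable_snd[OF int_F[OF c\<theta>]] unfolding slice_F by (rule borel_measurable_integrable)
      show "(\<lambda>t. (indicator {0<..1} t * \<theta> t) *\<^sub>R (FL - FR)) \<in> borel_measurable lborel"
        using const_int[OF c\<theta>] by (rule borel_measurable_integrable)
      show "AE t in lborel. (indicator {0<..1} t * \<theta> t) *\<^sub>R (LINT x|lborel. c' x *\<^sub>R F x t) = (indicator {0<..1} t * \<theta> t) *\<^sub>R (FL - FR)"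
        using mom_F_AE by eventually_elim (auto simp: indicator_def)
    qed
    finally have eq: "0 = (LINT t|lborel. (indicator {0<..1} t * g t) *\<^sub>R (M0 + Q t)) +
        (LINT t|lborel. (indicator {0<..1} t * \<theta> t) *\<^sub>R (FL - FR)) + \<theta> 0 *\<^sub>R M0" .
    have ftc: "(LINT t|lborel. (indicator {0<..1} t * h' t) *\<^sub>R v) = (h 1 - h 0) *\<^sub>R v"
      if h: "\<And>t. (h has_real_derivative h' t) (at t)" "continuous_on UNIV h'" for h h' and v :: "real^'m"
    proof -
      have "has_bochner_integral lborel (\<lambda>t. h' t * indicator {0..1} t) (h 1 - h 0)"
        by (rule has_bochner_integral_FTC_Icc_real) (use h in \<open>auto intro: continuous_on_subset
          continuous_on_interior has_field_derivative_at_within\<close>)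
      then have "(LINT t|lborel. h' t * indicator {0..1} t) = h 1 - h 0" by (rule has_bochner_integral_integral_eq)
      moreover have "(LINT t|lborel. (indicator {0<..1} t * h' t)) = (LINT t|lborel. h' t * indicator {0..1} t)"
      proof (rule integral_cong_AE)
        have [measurable]: "h' \<in> borel_measurable borel" using h(2) by (rule borel_measurable_continuous_onI)
        show "(\<lambda>t. indicator {0<..1} t * h' t) \<in> borel_measurable lborel" by measurable
        show "(\<lambda>t. h' t * indicator {0..1} t) \<in> borel_measurable lborel" by measurable
        show "AE t in lborel. indicator {0<..1} t * h' t = h' t * indicator {0..1} t"
          using AE_lborel_singleton[of "0::real"] by eventually_elim (auto simp: indicator_def)
      qed
      ultimately show ?thesis using integral_scaleR_left[OF ind_int[OF h(2)], of v] by simp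
    qed
    have I1: "(LINT t|lborel. (indicator {0<..1} t * g t) *\<^sub>R M0) = G 1 *\<^sub>R M0"
      using ftc[OF G(1) cg, of M0] G(2)[of 0] by simp
    \<comment> \<open>\<open>t \<theta>(t)\<close> vanishes at \<open>0\<close> and at \<open>1\<close>, so that the integral of \<open>\<theta>\<close> is that of \<open>- t g(t)\<close>\<close>
    have I2: "(LINT t|lborel. (indicator {0<..1} t * (\<theta> t + t * \<theta>' t)) *\<^sub>R (FL - FR)) = 0"
    proof -
      have "continuous_on UNIV \<theta>'" using \<open>\<theta>' \<in> flat_algebra\<close> by (rule flat_algebra_continuous)
      then have "continuous_on UNIV (\<lambda>t. \<theta> t + t * \<theta>' t)" using c\<theta> by (intro continuous_intros)
      moreover have "((\<lambda>t. t * \<theta> t) has_real_derivative \<theta> t + t * \<theta>' t) (at t)" for t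
        by (rule derivative_eq_intros \<theta> refl | simp add: algebra_simps)+
      ultimately show ?thesis using ftc[of "\<lambda>t. t * \<theta> t" "\<lambda>t. \<theta> t + t * \<theta>' t" "FL - FR"] \<theta>0[of 1] by simp
    qed
    have I3: "(indicator {0<..1} t * (\<theta> t + t * \<theta>' t)) *\<^sub>R (FL - FR) =
        (indicator {0<..1} t * \<theta> t) *\<^sub>R (FL - FR) + (indicator {0<..1} t * (g t * t)) *\<^sub>R (FL - FR)" for t
      using \<theta>'g[of t] by (auto simp: indicator_def algebra_simps)
    have cgt: "continuous_on UNIV (\<lambda>t. g t * t)" using cg by (intro continuous_intros)
    have I4: "(LINT t|lborel. (indicator {0<..1} t * \<theta> t) *\<^sub>R (FL - FR)) = - (LINT t|lborel. (indicator {0<..1} t * (g t * t)) *\<^sub>R (FL - FR))"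
      using I2 unfolding I3 using const_int[OF c\<theta>] const_int[OF cgt]
      by (simp add: eq_neg_iff_add_eq_0)
    have I5: "(LINT t|lborel. (indicator {0<..1} t * g t) *\<^sub>R (M0 + Q t)) = (LINT t|lborel. (indicator {0<..1} t * g t) *\<^sub>R Q t) + G 1 *\<^sub>R M0"
      unfolding scaleR_add_right using const_int[OF cg, of M0] int_Q[OF cg] I1 by simp
    have "\<theta> 0 = - G 1" using G(2)[of 0] s(2)[of 0] by (simp add: \<theta>_def)
    then have "(LINT t|lborel. (indicator {0<..1} t * g t) *\<^sub>R Q t) - (LINT t|lborel. (indicator {0<..1} t * (g t * t)) *\<^sub>R (FL - FR)) = 0"
      using eq unfolding I4 I5 by simp
    then have "(LINT t|lborel. (indicator {0<..1} t * g t) *\<^sub>R Q t - (indicator {0<..1} t * (g t * t)) *\<^sub>R (FL - FR)) = 0"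
      using int_Q[OF cg] const_int[OF cgt] by simp
    also have "(\<lambda>t. (indicator {0<..1} t * g t) *\<^sub>R Q t - (indicator {0<..1} t * (g t * t)) *\<^sub>R (FL - FR)) =
       (\<lambda>t. indicator {0<..<1} t *\<^sub>R (g t *\<^sub>R (Q t - t *\<^sub>R (FL - FR))))"
      using g0[of 1] by (auto simp: fun_eq_iff indicator_def algebra_simps)
    finally show "(LINT t:{0<..<1}|lborel. g t *\<^sub>R (Q t - t *\<^sub>R (FL - FR))) = 0"
      unfolding set_lebesgue_integral_def .
  qed
  then show ?thesis
    unfolding Q_def N_def u_def FL_def FR_def by eventually_elim (auto simp: algebra_simps)
qed

section \<open>Bar states and convex updates\<close>

lemma ale_flux_mult: "ale_flux f w v *v c = f v *v c - (w \<bullet> c) *\<^sub>R v"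
proof -
  have "outer v w *v c = (w \<bullet> c) *\<^sub>R v"
    by (simp add: outer_def matrix_vector_mult_def vec_eq_iff inner_vec_def sum_distrib_left sum_distrib_right mult_ac)
  then show ?thesis by (simp add: ale_flux_def matrix_vector_mult_diff_rdistrib)
qed

text \<open>One time at which the identity holds is enough, since the averages over the fan belong to \<open>B\<close> at all
  times.  For \<open>l = r\<close> there is no average; the identity is the Rankine-Hugoniot condition, in which
  the term with \<open>y\<close> vanishes.\<close>

lemma riemann_average_in_invariant_set:
  fixes R :: "('m::finite, 'd::finite) riemann"
  assumes "riemann_solvable R f" "invariant_set R f B" "uL \<in> B" "uR \<in> B" "norm n = 1"
  defines "l \<equiv> lamL R f n uL uR" and "r \<equiv> lamR R f n uL uR"
  obtains y where "y \<in> B" "l \<le> r" "f uR *v n - f uL *v n = r *\<^sub>R uR - l *\<^sub>R uL - (r - l) *\<^sub>R y"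
proof -
  have adm: "uL \<in> adm R f" "uR \<in> adm R f" using assms(2-4) by (auto simp: invariant_set_def)
  have lr: "l \<le> r" using assms(1,5) adm unfolding riemann_solvable_def l_def r_def by auto
  have "\<not> (AE t in lborel. \<not> t \<in> {0<..<1::real})"
    using AE_iff_null_sets[of "{0<..<1::real}" lborel] by (auto simp: null_sets_def)
  then have "\<exists>\<^sub>F t in ae_filter lborel. t \<in> {0<..<1::real}" by (simp only: frequently_def not_False_eq_True)
  from frequently_ex[OF frequently_eventually_frequently[OF this riemann_fan_identity[OF assms(1) adm assms(5)]]]
  obtain t where t: "0 < t" "t < 1"
    and eq: "(LINT x:{l * t..r * t}|lborel. rsol R f n uL uR x t) = t *\<^sub>R (r *\<^sub>R uR - l *\<^sub>R uL - (f uR *v n - f uL *v n))"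
    unfolding l_def r_def by auto
  show thesis
  proof (cases "l < r")
    case True
    let ?y = "(1 / (t * (r - l))) *\<^sub>R (LINT x:{l * t..r * t}|lborel. rsol R f n uL uR x t)"
    have "?y \<in> B"
      using assms(2-5) t True unfolding invariant_set_def l_def r_def by blast
    moreover have "(r - l) *\<^sub>R ?y = r *\<^sub>R uR - l *\<^sub>R uL - (f uR *v n - f uL *v n)"
      using t True unfolding eq by simp
    ultimately show ?thesis by (intro that[of ?y] lr) (auto simp: algebra_simps)
  next
    case False
    then have "l = r" using lr by simp
    have "AE x in lborel. indicator {l * t..r * t} x *\<^sub>R rsol R f n uL uR x t = 0"
      using AE_lborel_singleton[of "r * t"] by eventually_elim (auto simp: \<open>l = r\<close> indicator_def)
    then have "(LINT x:{l * t..r * t}|lborel. rsol R f n uL uR x t) = 0"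
      unfolding set_lebesgue_integral_def by (rule integral_eq_zero_AE)
    then have "r *\<^sub>R uR - l *\<^sub>R uL - (f uR *v n - f uL *v n) = 0" using eq t by auto
    then show ?thesis using \<open>l = r\<close> assms(3) by (intro that[of uL]) auto
  qed
qed

lemma convex_combination3:
  assumes "convex B" "x \<in> B" "y \<in> B" "z \<in> B" "0 \<le> a" "0 \<le> b" "0 \<le> c"
  shows "\<exists>v\<in>B. a *\<^sub>R x + b *\<^sub>R y + c *\<^sub>R z = (a + b + c) *\<^sub>R v"
proof (cases "a + b + c = 0")
  case True
  then have "a = 0" "b = 0" "c = 0" using assms by auto
  then show ?thesis using assms by auto
next
  case False
  let ?s = "a + b + c"
  have "[x, y, z] ! k \<in> B" "0 \<le> [a / ?s, b / ?s, c / ?s] ! k" if "k \<in> {0, 1, 2::nat}" for k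
    using that assms by auto
  then have "(\<Sum>k\<in>{0, 1, 2::nat}. [a / ?s, b / ?s, c / ?s] ! k *\<^sub>R [x, y, z] ! k) \<in> B"
    using False assms(1) by (intro convex_sum) (auto simp: add.assoc simp flip: add_divide_distrib)
  then have "(a / ?s) *\<^sub>R x + (b / ?s) *\<^sub>R y + (c / ?s) *\<^sub>R z \<in> B"
    by (simp add: add.assoc)
  moreover have "a *\<^sub>R x + b *\<^sub>R y + c *\<^sub>R z = ?s *\<^sub>R ((a / ?s) *\<^sub>R x + (b / ?s) *\<^sub>R y + (c / ?s) *\<^sub>R z)"
    using False by (simp add: scaleR_add_right)
  ultimately show ?thesis by blast
qed

text \<open>The left-hand side is \<open>2 d\<close> times the bar state; without the division it also covers \<open>d = 0\<close>.  If \<open>c \<noteq> 0\<close>, with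
  \<open>s = d / |c|\<close> it is \<open>|c|\<close> times the combination of \<open>uL\<close>, \<open>uR\<close> and a fan average with the weights
  \<open>s + (l - w \<bullet> n)\<close>, \<open>s - (r - w \<bullet> n)\<close> and \<open>r - l\<close>: they are nonnegative because \<open>s\<close> dominates the
  speeds \<open>l - w \<bullet> n\<close> and \<open>r - w \<bullet> n\<close> of the ALE flux, and their sum is \<open>2 s\<close>.\<close>

lemma bar_state_in_invariant_set:
  fixes R :: "('m::finite, 'd::finite) riemann"
  assumes solv: "riemann_solvable R f" and tr: "ale_translates R f" and inv: "invariant_set R f B"
    and u: "uL \<in> B" "uR \<in> B" and d: "dir_speed R (ale_flux f w) c uL uR * norm c \<le> d"
  shows "\<exists>y\<in>B. d *\<^sub>R (uL + uR) - (ale_flux f w uR *v c - ale_flux f w uL *v c) = (2 * d) *\<^sub>R y"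
proof (cases "c = 0")
  case True
  have "0 \<le> d" using d True by simp
  moreover have "convex B" using inv by (auto simp: invariant_set_def)
  ultimately show ?thesis using convex_combination3[OF _ u u(1), of d d 0] True by (auto simp: scaleR_add_right)
next
  case False
  define n where "n = c /\<^sub>R norm c"
  define l r where "l = lamL R f n uL uR" and "r = lamR R f n uL uR"
  have n: "norm n = 1" "c = norm c *\<^sub>R n" using False by (auto simp: n_def)
  obtain y where y: "y \<in> B" "l \<le> r" "f uR *v n - f uL *v n = r *\<^sub>R uR - l *\<^sub>R uL - (r - l) *\<^sub>R y"
    using riemann_average_in_invariant_set[OF solv inv u n(1)] unfolding l_def r_def by metis
  have adm: "uL \<in> adm R f" "uR \<in> adm R f" using inv u by (auto simp: invariant_set_def)
  define s where "s = d / norm c"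
  have ds: "d = norm c * s" using False by (simp add: s_def)
  have "lam_max R (ale_flux f w) n uL uR \<le> s"
    using d False by (simp add: dir_speed_def n_def s_def pos_le_divide_eq)
  moreover have "lamL R (ale_flux f w) n uL uR = l - w \<bullet> n" "lamR R (ale_flux f w) n uL uR = r - w \<bullet> n"
    using tr adm n(1) unfolding ale_translates_def l_def r_def by blast+
  ultimately have s: "0 \<le> s + (l - w \<bullet> n)" "0 \<le> s - (r - w \<bullet> n)"
    unfolding lam_max_def by auto
  have fc: "f v *v c = norm c *\<^sub>R (f v *v n)" for v
    by (subst n(2)) (simp add: matrix_vector_mult_scaleR)
  have wc: "w \<bullet> c = norm c * (w \<bullet> n)" by (subst n(2)) simp
  have "d *\<^sub>R (uL + uR) - (ale_flux f w uR *v c - ale_flux f w uL *v c)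
     = norm c *\<^sub>R (s *\<^sub>R (uL + uR) - (f uR *v n - f uL *v n) + (w \<bullet> n) *\<^sub>R (uR - uL))"
    unfolding ale_flux_mult fc wc ds by (simp add: algebra_simps)
  also have "\<dots> = norm c *\<^sub>R ((s + (l - w \<bullet> n)) *\<^sub>R uL + (s - (r - w \<bullet> n)) *\<^sub>R uR + (r - l) *\<^sub>R y)"
    unfolding y(3) by (simp add: algebra_simps)
  finally have eq: "d *\<^sub>R (uL + uR) - (ale_flux f w uR *v c - ale_flux f w uL *v c)
     = norm c *\<^sub>R ((s + (l - w \<bullet> n)) *\<^sub>R uL + (s - (r - w \<bullet> n)) *\<^sub>R uR + (r - l) *\<^sub>R y)" .
  obtain v where v: "v \<in> B" "(s + (l - w \<bullet> n)) *\<^sub>R uL + (s - (r - w \<bullet> n)) *\<^sub>R uR + (r - l) *\<^sub>R y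
      = ((s + (l - w \<bullet> n)) + (s - (r - w \<bullet> n)) + (r - l)) *\<^sub>R v"
    using convex_combination3[OF _ u y(1) s, of "r - l"] inv y(2) by (auto simp: invariant_set_def)
  show ?thesis
    by (rule bexI[OF _ v(1)]) (unfold eq v(2), simp add: ds)
qed

lemma visc_off_sym:
  assumes "j \<in> I i \<longleftrightarrow> i \<in> I j"
  shows "visc_off R f I W c U i j = visc_off R f I W c U j i"
  using assms by (simp add: visc_off_def max.commute)

lemma dir_speed_nonneg: "0 \<le> dir_speed R h c uL uR"
  by (simp add: dir_speed_def lam_max_def le_max_iff_disj)

lemma visc_off_nonneg: "0 \<le> visc_off R f I W c U i j"
  by (simp add: visc_off_def dir_speed_nonneg le_max_iff_disj)

text \<open>By \<open>c0\<close> and \<open>gcl\<close> the sum of \<open>g\<^sub>j(U\<^sub>i) c\<^sub>i\<^sub>j\<close> is \<open>- (m' - m) / \<tau> U\<^sub>i\<close>.  Subtracting it turns the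
  old mass in front of \<open>U\<^sub>i\<close> into the new one, and what remains is a convex combination of \<open>U\<^sub>i\<close> and
  the bar states.\<close>

lemma ale_update_in_invariant_set:
  fixes R :: "('m::finite, 'd::finite) riemann"
  assumes solv: "riemann_solvable R f" and tr: "ale_translates R f" and inv: "invariant_set R f B"
    and fin: "finite (I i)" and i: "i \<in> I i" and sym: "\<And>j. j \<in> I i \<Longrightarrow> i \<in> I j"
    and UB: "U ` I i \<subseteq> B" and \<tau>: "0 < \<tau>" and m': "0 < m' i"
    and upd: "ale_update R f I W c \<tau> m m' U U' i"
    and c0: "(\<Sum>j\<in>I i. c i j) = 0"
    and gcl: "m' i = m i + \<tau> * (\<Sum>j\<in>I i. W j \<bullet> c i j)"
    and cfl: "2 * \<tau> * (\<Sum>j\<in>I i - {i}. visc_off R f I W c U i j) \<le> m' i"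
  shows "U' i \<in> B"
proof -
  let ?J = "I i - {i}"
  define d where "d j = visc_off R f I W c U i j" for j
  define g where "g j v = ale_flux f (W j) v *v c i j" for j v
  have "\<exists>y\<in>B. d j *\<^sub>R (U i + U j) - (g j (U j) - g j (U i)) = (2 * d j) *\<^sub>R y" if "j \<in> ?J" for j
    unfolding g_def
    by (rule bar_state_in_invariant_set[OF solv tr inv]) (use that i UB in \<open>auto simp: d_def visc_off_def\<close>)
  then obtain y where y: "\<And>j. j \<in> ?J \<Longrightarrow> y j \<in> B"
    "\<And>j. j \<in> ?J \<Longrightarrow> d j *\<^sub>R (U i + U j) - (g j (U j) - g j (U i)) = (2 * d j) *\<^sub>R y j"
    by metis
  have visc_i: "visc R f I W c U i i = - (\<Sum>j\<in>?J. d j)"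
  proof -
    have "visc_off R f I W c U j i = d j" if "j \<in> ?J" for j
      unfolding d_def by (rule visc_off_sym) (use sym that i in blast)
    then show ?thesis by (simp add: visc_def)
  qed
  have visc_j: "visc R f I W c U i j = d j" if "j \<in> ?J" for j using that by (auto simp: visc_def d_def)
  have split: "(\<Sum>j\<in>I i. h j) = h i + (\<Sum>j\<in>?J. h j)" for h :: "_ \<Rightarrow> real^'m"
    using fin i by (rule sum.remove)
  have gi: "(\<Sum>j\<in>I i. g j (U i)) = - ((m' i - m i) / \<tau>) *\<^sub>R U i"
  proof -
    have "(\<Sum>j\<in>I i. g j (U i)) = f (U i) *v (\<Sum>j\<in>I i. c i j) - (\<Sum>j\<in>I i. W j \<bullet> c i j) *\<^sub>R U i"
      unfolding g_def ale_flux_mult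
      by (simp add: sum_subtractf linear_sum[OF matrix_vector_mul_linear] scaleR_sum_left)
    then show ?thesis using \<tau> unfolding c0 gcl by simp
  qed
  have "(m' i *\<^sub>R U' i - m i *\<^sub>R U i) /\<^sub>R \<tau> + (\<Sum>j\<in>I i. g j (U j) - visc R f I W c U i j *\<^sub>R U j) = 0"
    using upd unfolding ale_update_def g_def ale_flux_def .
  moreover have "\<tau> *\<^sub>R ((m' i *\<^sub>R U' i - m i *\<^sub>R U i) /\<^sub>R \<tau>) = m' i *\<^sub>R U' i - m i *\<^sub>R U i"
    using \<tau> by simp
  ultimately have e1: "m' i *\<^sub>R U' i = m i *\<^sub>R U i - \<tau> *\<^sub>R (\<Sum>j\<in>I i. g j (U j) - visc R f I W c U i j *\<^sub>R U j)"
    by (simp only: add_eq_0_iff2) (simp add: algebra_simps)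
  have e2: "(\<Sum>j\<in>I i. g j (U j) - visc R f I W c U i j *\<^sub>R U j) =
     (\<Sum>j\<in>I i. g j (U i)) + (\<Sum>j\<in>?J. (g j (U j) - g j (U i)) - d j *\<^sub>R (U j - U i))"
  proof -
    have "(\<Sum>j\<in>?J. visc R f I W c U i j *\<^sub>R U j) = (\<Sum>j\<in>?J. d j *\<^sub>R U j)"
      by (rule sum.cong) (simp_all add: visc_j)
    then show ?thesis
      unfolding split visc_i
      by (simp add: sum_subtractf scaleR_diff_right scaleR_sum_left)
  qed
  have e3: "(\<Sum>j\<in>?J. (g j (U j) - g j (U i)) - d j *\<^sub>R (U j - U i)) = (\<Sum>j\<in>?J. (2 * d j) *\<^sub>R U i - (2 * d j) *\<^sub>R y j)"
  proof (rule sum.cong[OF refl])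
    fix j assume j: "j \<in> ?J"
    have "(2 * d j) *\<^sub>R U i = d j *\<^sub>R U i + d j *\<^sub>R U i" by (simp flip: scaleR_add_left)
    then show "(g j (U j) - g j (U i)) - d j *\<^sub>R (U j - U i) = (2 * d j) *\<^sub>R U i - (2 * d j) *\<^sub>R y j"
      unfolding y(2)[OF j, symmetric] by (simp add: scaleR_diff_right scaleR_add_right)
  qed
  have e4: "m' i *\<^sub>R U' i = m' i *\<^sub>R U i + \<tau> *\<^sub>R (\<Sum>j\<in>?J. (2 * d j) *\<^sub>R y j - (2 * d j) *\<^sub>R U i)"
  proof -
    have "\<tau> *\<^sub>R (- ((m' i - m i) / \<tau>) *\<^sub>R U i) = m i *\<^sub>R U i - m' i *\<^sub>R U i"
      using \<tau> by (simp add: scaleR_diff_left)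
    moreover have "(\<Sum>j\<in>?J. (2 * d j) *\<^sub>R U i - (2 * d j) *\<^sub>R y j) = - (\<Sum>j\<in>?J. (2 * d j) *\<^sub>R y j - (2 * d j) *\<^sub>R U i)"
      by (simp flip: sum_negf)
    ultimately show ?thesis unfolding e1 e2 gi e3 by (simp only: scaleR_add_right scaleR_minus_right) simp
  qed
  \<comment> \<open>the weight of \<open>U\<^sub>i\<close> is what the bar states leave over; \<open>cfl\<close> makes it nonnegative\<close>
  define a where "a j = (if j = i then 1 - (\<Sum>k\<in>?J. 2 * \<tau> * d k / m' i) else 2 * \<tau> * d j / m' i)" for j
  define z where "z j = (if j = i then U i else y j)" for j
  have aJ: "(\<Sum>j\<in>?J. h (a j) (z j)) = (\<Sum>j\<in>?J. h (2 * \<tau> * d j / m' i) (y j))" for h :: "real \<Rightarrow> real^'m \<Rightarrow> real^'m"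
    by (rule sum.cong) (auto simp: a_def z_def)
  have aJ': "(\<Sum>j\<in>?J. a j) = (\<Sum>j\<in>?J. 2 * \<tau> * d j / m' i)"
    by (rule sum.cong) (auto simp: a_def)
  have "(\<Sum>j\<in>I i. a j *\<^sub>R z j) \<in> B"
  proof (rule convex_sum[OF fin])
    show "convex B" using inv by (auto simp: invariant_set_def)
    show "sum a (I i) = 1" unfolding sum.remove[OF fin i] aJ' by (simp add: a_def)
    show "z j \<in> B" if "j \<in> I i" for j using that y(1) UB i by (auto simp: z_def)
    have "(\<Sum>k\<in>?J. 2 * \<tau> * d k / m' i) \<le> 1"
      using cfl m' by (simp add: d_def flip: sum_divide_distrib sum_distrib_left)
    moreover have "0 \<le> d j" for j unfolding d_def by (rule visc_off_nonneg)
    ultimately show "0 \<le> a j" for j using \<tau> m' by (cases "j = i") (simp_all add: a_def)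
  qed
  also have "(\<Sum>j\<in>I i. a j *\<^sub>R z j) = U i + (\<tau> / m' i) *\<^sub>R (\<Sum>j\<in>?J. (2 * d j) *\<^sub>R y j - (2 * d j) *\<^sub>R U i)"
    unfolding split aJ[of "\<lambda>a z. a *\<^sub>R z"]
    by (simp add: a_def z_def scaleR_sum_right sum_subtractf scaleR_diff_right scaleR_diff_left scaleR_sum_left mult_ac)
  also have "\<dots> = inverse (m' i) *\<^sub>R (m' i *\<^sub>R U' i)"
    unfolding e4 using m' by (simp add: scaleR_add_right divide_inverse mult.commute)
  also have "\<dots> = U' i" using m' by simp
  finally show ?thesis .
qed

section \<open>Determinants along a line of matrices\<close>

text \<open>The Leibniz formula for \<open>det (A + s B)\<close>, read in \<open>\<real>[s]\<close>, so that the degree in \<open>s\<close> is visible.\<close>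

definition det_poly :: "real^'n^'n \<Rightarrow> real^'n^'n \<Rightarrow> real poly" where
  "det_poly A B = (\<Sum>p | p permutes UNIV. [:of_int (sign p):] * (\<Prod>i\<in>UNIV. [:A $ i $ p i, B $ i $ p i:]))"

lemma poly_det_poly: "poly (det_poly A B) s = det (A + s *\<^sub>R B)"
  by (simp add: det_poly_def det_def poly_sum poly_prod mult.commute)

lemma degree_det_poly: "degree (det_poly (A :: real^'n^'n) B) \<le> CARD('n)"
  unfolding det_poly_def
proof (rule degree_sum_le)
  fix p :: "'n \<Rightarrow> 'n"
  have "degree ([:of_int (sign p):] * (\<Prod>i\<in>UNIV. [:A $ i $ p i, B $ i $ p i:])) \<le> 0 + degree (\<Prod>i\<in>UNIV. [:A $ i $ p i, B $ i $ p i:])"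
    by (rule order.trans[OF degree_mult_le]) simp
  also have "\<dots> \<le> (\<Sum>i\<in>(UNIV::'n set). degree [:A $ i $ p i, B $ i $ p i:])"
    using degree_prod_sum_le[OF finite, of "\<lambda>i. [:A $ i $ p i, B $ i $ p i:]" UNIV]
      by (simp only: comp_def)
  also have "\<dots> \<le> (\<Sum>i\<in>(UNIV::'n set). 1)" by (rule sum_mono) simp
  finally show "degree ([:of_int (sign p):] * (\<Prod>i\<in>UNIV. [:A $ i $ p i, B $ i $ p i:])) \<le> CARD('n)" by simp
qed (simp add: finite_permutations)

lemma pderiv_det_poly_at_identity: "poly (pderiv (det_poly (mat 1) M)) 0 = trace (M :: real^'n^'n)"
proof -
  have perm: "poly (pderiv ([:of_int (sign p):] * (\<Prod>i\<in>UNIV. [:(mat 1 :: real^'n^'n) $ i $ p i, M $ i $ p i:]))) 0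
      = (if p = id then trace M else 0)" if "p permutes UNIV" for p
  proof -
    have "poly (pderiv ([:of_int (sign p):] * (\<Prod>i\<in>UNIV. [:(mat 1 :: real^'n^'n) $ i $ p i, M $ i $ p i:]))) 0
      = of_int (sign p) * (\<Sum>k\<in>UNIV. (\<Prod>i\<in>UNIV - {k}. (mat 1 :: real^'n^'n) $ i $ p i) * M $ k $ p k)"
      by (simp add: pderiv_smult pderiv_prod poly_sum poly_prod pderiv_pCons mult.commute)
    also have "\<dots> = (if p = id then trace M else 0)"
    proof (cases "p = id")
      case True then show ?thesis by (simp add: trace_def mat_def)
    next
      case False
      have "(\<Prod>i\<in>UNIV - {k}. (mat 1 :: real^'n^'n) $ i $ p i) = 0" for k
      proof -
        \<comment> \<open>a permutation that fixes all indices but one is the identity\<close>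
        have "\<exists>i. i \<noteq> k \<and> p i \<noteq> i"
        proof (rule ccontr)
          assume "\<not> ?thesis"
          then have fix_: "p i = i" if "i \<noteq> k" for i using that by auto
          moreover have "p k = k" using fix_ permutes_inj[OF \<open>p permutes UNIV\<close>] by (metis injD)
          ultimately have "p = id" by (metis eq_id_iff)
          then show False using False by simp
        qed
        then obtain i where "i \<in> UNIV - {k}" "(mat 1 :: real^'n^'n) $ i $ p i = 0" by (auto simp: mat_def)
        then show ?thesis by (intro prod_zero) auto
      qed
      then show ?thesis using False by (simp only: mult_zero_left sum.neutral_const mult_zero_right if_False)
    qed
    finally show ?thesis .
  qed
  have "poly (pderiv (det_poly (mat 1) M)) 0 =
      (\<Sum>p | p permutes UNIV. poly (pderiv ([:of_int (sign p):] * (\<Prod>i\<in>UNIV. [:(mat 1 :: real^'n^'n) $ i $ p i, M $ i $ p i:]))) 0)"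
  proof -
    have "pderiv (sum q P) = (\<Sum>p\<in>P. pderiv (q p))" for q :: "('n \<Rightarrow> 'n) \<Rightarrow> real poly" and P
      by (induction P rule: infinite_finite_induct) (auto simp: pderiv_add)
    then show ?thesis unfolding det_poly_def by (simp only: poly_sum)
  qed
  also have "\<dots> = (\<Sum>p | p permutes (UNIV :: 'n set). if p = id then trace M else 0)"
    by (rule sum.cong) (use perm in auto)
  also have "\<dots> = trace M" by (simp add: permutes_id finite_permutations)
  finally show ?thesis .
qed

text \<open>Jacobi's formula.  With \<open>C = A + s B\<close> and its inverse \<open>D\<close>, \<open>C + h B = C (1 + h D B)\<close> reduces it to the
  derivative at the identity matrix.\<close>

lemma pderiv_det_poly:
  fixes A B :: "real^'n^'n"
  assumes inv: "D ** (A + s *\<^sub>R B) = mat 1"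
  shows "poly (pderiv (det_poly A B)) s = det (A + s *\<^sub>R B) * trace (B ** D)"
proof -
  let ?C = "A + s *\<^sub>R B"
  have inv': "?C ** D = mat 1" using inv matrix_left_right_inverse by blast
  have "det (A + (s + h) *\<^sub>R B) = det ?C * poly (det_poly (mat 1) (D ** B)) h" for h
  proof -
    have "?C ** (mat 1 + h *\<^sub>R (D ** B)) = ?C + h *\<^sub>R (?C ** (D ** B))"
      by (simp only: matrix_add_ldistrib matrix_mul_rid matrix_scalar_ac scalar_matrix_assoc[symmetric])
    also have "\<dots> = A + (s + h) *\<^sub>R B"
      by (simp only: matrix_mul_assoc inv' matrix_mul_lid) (simp add: algebra_simps)
    finally have "A + (s + h) *\<^sub>R B = ?C ** (mat 1 + h *\<^sub>R (D ** B))" ..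
    then show ?thesis by (simp add: det_mul poly_det_poly)
  qed
  then have "pcompose (det_poly A B) [:s, 1:] = smult (det ?C) (det_poly (mat 1) (D ** B))"
    unfolding poly_eq_poly_eq_iff[symmetric] by (simp add: fun_eq_iff poly_pcompose poly_det_poly)
  then have "poly (pderiv (pcompose (det_poly A B) [:s, 1:])) 0 = poly (pderiv (smult (det ?C) (det_poly (mat 1) (D ** B)))) 0"
    by simp
  then have "poly (pderiv (det_poly A B)) s = det ?C * trace (D ** B)"
    by (simp add: pderiv_pcompose poly_pcompose pderiv_smult pderiv_det_poly_at_identity pderiv_pCons)
  then show ?thesis using trace_mul_sym[of D B] by simp
qed

text \<open>The determinant has no zero for \<open>s\<close> in \<open>[0, 1]\<close>, hence a constant sign, so that its absolute value is a
  polynomial of degree at most \<open>n\<close>; the quadrature is exact for the derivative, of degree \<open>n - 1\<close>.\<close>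

lemma quadrature_integrates_abs_det:
  fixes A B :: "real^'n^'n"
  assumes quad: "quadrature L \<omega> \<zeta> (CARD('n) - 1)"
    and inv: "\<And>s. 0 \<le> s \<Longrightarrow> s \<le> 1 \<Longrightarrow> D s ** (A + s *\<^sub>R B) = mat 1"
  shows "\<bar>det (A + B)\<bar> - \<bar>det A\<bar> = (\<Sum>l\<in>L. \<omega> l * (\<bar>det (A + \<zeta> l *\<^sub>R B)\<bar> * trace (B ** D (\<zeta> l))))"
proof -
  let ?p = "det_poly A B"
  have nz: "poly ?p s \<noteq> 0" if "0 \<le> s" "s \<le> 1" for s
  proof
    assume "poly ?p s = 0"
    then have "det (D s ** (A + s *\<^sub>R B)) = 0" by (simp add: det_mul poly_det_poly)
    then show False using inv[OF that] by simp
  qed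
  define \<sigma> where "\<sigma> = sgn (poly ?p 0)"
  have sgn: "\<bar>poly ?p s\<bar> = \<sigma> * poly ?p s" if s: "0 \<le> s" "s \<le> 1" for s
  proof -
    have "0 < poly ?p 0 * poly ?p s"
    proof (rule ccontr)
      assume neg: "\<not> 0 < poly ?p 0 * poly ?p s"
      have "0 < s" using neg nz[of 0] s by (cases "s = 0") (auto simp: zero_less_mult_iff)
      moreover have "poly ?p 0 * poly ?p s < 0" using neg nz[of 0] nz[OF s] by (auto simp: not_less le_less)
      ultimately obtain x where "0 < x" "x < s" "poly ?p x = 0" using poly_IVT[of 0 s ?p] by auto
      then show False using nz[of x] s by auto
    qed
    then show ?thesis unfolding \<sigma>_def by (auto simp: zero_less_mult_iff sgn_if)
  qed
  have "poly ?p 1 - poly ?p 0 = integral {0..1} (poly (pderiv ?p))"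
    using fundamental_theorem_of_calculus[of 0 1 "poly ?p" "poly (pderiv ?p)"]
    by (intro integral_unique[symmetric]) (auto intro: poly_DERIV has_field_derivative_at_within
        simp flip: has_real_derivative_iff_has_vector_derivative)
  also have "\<dots> = (\<Sum>l\<in>L. \<omega> l * poly (pderiv ?p) (\<zeta> l))"
  proof -
    have "degree (pderiv ?p) \<le> CARD('n) - 1" using degree_det_poly[of A B] by (simp add: degree_pderiv)
    then show ?thesis using quad unfolding quadrature_def by metis
  qed
  also have "\<dots> = (\<Sum>l\<in>L. \<omega> l * (poly ?p (\<zeta> l) * trace (B ** D (\<zeta> l))))"
    using quad by (intro sum.cong refl) (simp add: pderiv_det_poly[OF inv] quadrature_def poly_det_poly)
  finally have eq: "\<sigma> * poly ?p 1 - \<sigma> * poly ?p 0 = \<sigma> * (\<Sum>l\<in>L. \<omega> l * (poly ?p (\<zeta> l) * trace (B ** D (\<zeta> l))))"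
    by (simp flip: right_diff_distrib)
  have "\<bar>poly ?p 1\<bar> - \<bar>poly ?p 0\<bar> = (\<Sum>l\<in>L. \<omega> l * (\<bar>poly ?p (\<zeta> l)\<bar> * trace (B ** D (\<zeta> l))))"
  proof -
    have "\<omega> l * (\<bar>poly ?p (\<zeta> l)\<bar> * trace (B ** D (\<zeta> l))) = \<sigma> * (\<omega> l * (poly ?p (\<zeta> l) * trace (B ** D (\<zeta> l))))" if "l \<in> L" for l
      using sgn[of "\<zeta> l"] quad that by (simp add: quadrature_def)
    then have "(\<Sum>l\<in>L. \<omega> l * (\<bar>poly ?p (\<zeta> l)\<bar> * trace (B ** D (\<zeta> l)))) =
        \<sigma> * (\<Sum>l\<in>L. \<omega> l * (poly ?p (\<zeta> l) * trace (B ** D (\<zeta> l))))"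
      unfolding sum_distrib_left by (rule sum.cong[OF refl])
    then show ?thesis using eq sgn[of 0] sgn[of 1] by simp
  qed
  then show ?thesis by (simp add: poly_det_poly)
qed

section \<open>Diffeomorphisms of convex bodies\<close>

lemma C1_on_imp_lipschitz:
  assumes "C1_on S h" "compact S" "convex S"
  shows "\<exists>L\<ge>0. \<forall>x\<in>S. \<forall>y\<in>S. norm (h x - h y) \<le> L * norm (x - y)"
proof -
  obtain h' where h': "\<And>x. x \<in> S \<Longrightarrow> (h has_derivative blinfun_apply (h' x)) (at x within S)" "continuous_on S h'"
    using assms(1) unfolding C1_on_def by auto
  have "bounded (h' ` S)" using h'(2) assms(2) compact_continuous_image compact_imp_bounded by blast
  then obtain C where C: "0 < C" "\<And>x. x \<in> S \<Longrightarrow> norm (h' x) \<le> C" unfolding bounded_pos by auto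
  have "C-lipschitz_on S h"
    using bounded_derivative_imp_lipschitz[OF h'(1) assms(3), of C] C by (auto simp: norm_blinfun.rep_eq)
  then show ?thesis using C(1) by (intro exI[of _ C]) (auto simp: lipschitz_on_def dist_norm)
qed

text \<open>The image of \<open>S\<close> need not be convex, so that the derivative of \<open>k\<close> gives no Lipschitz bound directly.
  If \<open>x\<close> and \<open>y\<close> are close, \<open>g\<close> is close to its linearization at \<open>x\<close>, whose inverse is bounded; otherwise
  \<open>g x\<close> and \<open>g y\<close> are far apart, since \<open>k\<close> is uniformly continuous.  The derivative of \<open>k\<close> is known to
  invert that of \<open>g\<close> at interior points; a limit extends the bound to all of \<open>S\<close>.\<close>

lemma diffeo_on_convex_body:
  fixes g :: "'a::euclidean_space \<Rightarrow> 'a"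
  assumes g: "diffeo_on S g" and S: "compact S" "convex S" "interior S \<noteq> {}"
  obtains g' k k' L where
    "\<And>x. x \<in> S \<Longrightarrow> (g has_derivative g' x) (at x within S)"
    "\<And>x. x \<in> S \<Longrightarrow> (k has_derivative k' x) (at (g x) within g ` S)"
    "\<And>x. x \<in> S \<Longrightarrow> k (g x) = x"
    "continuous_on S g" "inj_on g S" "continuous_on (g ` S) k"
    "0 \<le> L" "\<And>x y. x \<in> S \<Longrightarrow> y \<in> S \<Longrightarrow> norm (x - y) \<le> L * norm (g x - g y)"
proof -
  obtain g' where g': "\<And>x. x \<in> S \<Longrightarrow> (g has_derivative blinfun_apply (g' x)) (at x within S)" "continuous_on S g'"
    using g unfolding diffeo_on_def C1_on_def by auto
  obtain k where "C1_on (g ` S) k" and kg: "\<And>x. x \<in> S \<Longrightarrow> k (g x) = x"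
    using g unfolding diffeo_on_def by blast
  then obtain k' where k': "\<And>y. y \<in> g ` S \<Longrightarrow> (k has_derivative blinfun_apply (k' y)) (at y within g ` S)" "continuous_on (g ` S) k'"
    unfolding C1_on_def by blast
  have cg: "continuous_on S g" by (rule has_derivative_continuous_on[OF g'(1)])
  have ck: "continuous_on (g ` S) k" by (rule has_derivative_continuous_on[OF k'(1)])
  have inj: "inj_on g S" using kg by (metis inj_onI)
  have cgS: "compact (g ` S)" using cg S(1) by (rule compact_continuous_image)
  have "bounded (k' ` g ` S)" using k'(2) cgS compact_continuous_image compact_imp_bounded by blast
  then obtain C where C: "0 < C" "\<And>y. y \<in> g ` S \<Longrightarrow> norm (k' y) \<le> C" unfolding bounded_pos by auto
  obtain \<delta> where \<delta>: "0 < \<delta>" "\<And>x y. x \<in> S \<Longrightarrow> y \<in> S \<Longrightarrow> dist y x < \<delta> \<Longrightarrow> dist (g' y) (g' x) < 1 / (2 * C)"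
  proof -
    have "0 < 1 / (2 * C)" using C(1) by simp
    then obtain \<delta> where "0 < \<delta>" "\<forall>x\<in>S. \<forall>y\<in>S. dist y x < \<delta> \<longrightarrow> dist (g' y) (g' x) < 1 / (2 * C)"
      using compact_uniformly_continuous[OF g'(2) S(1)] unfolding uniformly_continuous_on_def by blast
    then show thesis using that by blast
  qed
  obtain \<eta> where \<eta>: "0 < \<eta>" "\<And>x y. x \<in> g ` S \<Longrightarrow> y \<in> g ` S \<Longrightarrow> dist y x < \<eta> \<Longrightarrow> dist (k y) (k x) < \<delta>"
  proof -
    obtain \<eta> where "0 < \<eta>" "\<forall>x\<in>g ` S. \<forall>y\<in>g ` S. dist y x < \<eta> \<longrightarrow> dist (k y) (k x) < \<delta>"
      using compact_uniformly_continuous[OF ck cgS] \<delta>(1) unfolding uniformly_continuous_on_def by blast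
    then show thesis using that by blast
  qed
  obtain D where D: "0 < D" "\<And>x y. x \<in> S \<Longrightarrow> y \<in> S \<Longrightarrow> norm (x - y) \<le> D"
  proof -
    obtain M where "0 < M" "\<And>x. x \<in> S \<Longrightarrow> norm x \<le> M" using compact_imp_bounded[OF S(1)] unfolding bounded_pos by auto
    then have "norm (x - y) \<le> M + M" if "x \<in> S" "y \<in> S" for x y
      using that norm_triangle_ineq4[of x y] by (meson add_mono order_trans)
    then show thesis using that[of "M + M"] \<open>0 < M\<close> by auto
  qed
  define L where "L = max (2 * C) (D / \<eta>)"
  have L0: "0 \<le> L" using C(1) by (simp add: L_def)
  have int: "norm (x - y) \<le> L * norm (g x - g y)" if x: "x \<in> interior S" and y: "y \<in> S" for x y
  proof (cases "dist x y < \<delta>")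
    case True
    have xS: "x \<in> S" using x interior_subset by blast
    have atx: "at x within S = at x" using x by (rule at_within_interior)
    have "((k \<circ> g) has_derivative (blinfun_apply (k' (g x)) \<circ> blinfun_apply (g' x))) (at x within S)"
      by (rule diff_chain_within[OF g'(1)[OF xS] k'(1)]) (use xS in auto)
    then have "((k \<circ> g) has_derivative (blinfun_apply (k' (g x)) \<circ> blinfun_apply (g' x))) (at x)"
      by (simp add: atx)
    moreover have "((k \<circ> g) has_derivative id) (at x)"
      by (rule has_derivative_transform_within_open[OF has_derivative_id open_interior x])
        (use kg interior_subset[of S] in \<open>auto simp: subset_eq\<close>)
    ultimately have id: "blinfun_apply (k' (g x)) (blinfun_apply (g' x) v) = v" for v
      using has_derivative_unique[of "k \<circ> g" "blinfun_apply (k' (g x)) \<circ> blinfun_apply (g' x)" x id] by (simp add: fun_eq_iff)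
    let ?B = "S \<inter> ball x \<delta>"
    have cB: "convex ?B" using S(2) by (intro convex_Int convex_ball)
    have "norm (g y - g x - g' x (y - x)) \<le> norm (y - x) * (1 / (2 * C))"
    proof (rule differentiable_bound_linearization[where S = ?B and f' = "\<lambda>z. blinfun_apply (g' z)"])
      show "x + t *\<^sub>R (y - x) \<in> ?B" if "t \<in> {0..1}" for t
      proof -
        have "(1 - t) *\<^sub>R x + t *\<^sub>R y \<in> ?B"
          using cB that xS y True \<delta>(1) by (intro convexD) auto
        then show ?thesis by (simp add: algebra_simps)
      qed
      show "(g has_derivative blinfun_apply (g' z)) (at z within ?B)" if "z \<in> ?B" for z
        by (rule has_derivative_subset[OF g'(1)]) (use that in auto)
      show "onorm (blinfun_apply (g' z) - blinfun_apply (g' x)) \<le> 1 / (2 * C)" if "z \<in> ?B" for z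
      proof -
        have "norm (g' z - g' x) \<le> 1 / (2 * C)" using \<delta>(2)[OF xS, of z] that by (auto simp: dist_norm norm_minus_commute)
        moreover have "blinfun_apply (g' z - g' x) = blinfun_apply (g' z) - blinfun_apply (g' x)"
          by (simp add: fun_eq_iff blinfun.diff_left)
        ultimately show ?thesis by (simp add: norm_blinfun.rep_eq)
      qed
      show "x \<in> ?B" using xS \<delta>(1) by auto
    qed
    then have lin: "norm (g' x (y - x)) \<le> norm (g y - g x) + norm (y - x) / (2 * C)"
      using norm_triangle_sub[of "g' x (y - x)" "g y - g x"] by (simp add: norm_minus_commute)
    have "norm (y - x) = norm (k' (g x) (g' x (y - x)))" by (simp add: id)
    also have "\<dots> \<le> norm (k' (g x)) * norm (g' x (y - x))" by (rule norm_blinfun)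
    also have "\<dots> \<le> C * (norm (g y - g x) + norm (y - x) / (2 * C))"
      using C xS lin by (intro mult_mono) auto
    also have "\<dots> = C * norm (g y - g x) + norm (y - x) / 2" using C(1) by (simp add: distrib_left)
    finally have "norm (y - x) \<le> 2 * C * norm (g y - g x)" by simp
    also have "\<dots> \<le> L * norm (g y - g x)" by (intro mult_right_mono) (auto simp: L_def)
    finally show ?thesis by (simp add: norm_minus_commute)
  next
    case False
    have xS: "x \<in> S" using x interior_subset by blast
    then have "\<eta> \<le> norm (g x - g y)"
      using False \<eta>(2)[of "g y" "g x"] y kg by (force simp: dist_norm not_less)
    then have "D \<le> D / \<eta> * norm (g x - g y)"
      using D(1) \<eta>(1) by (simp add: field_simps)
    also have "\<dots> \<le> L * norm (g x - g y)" by (intro mult_right_mono) (auto simp: L_def)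
    finally show ?thesis using D(2)[OF xS y] by simp
  qed
  have cl: "closure (interior S) = S"
    using S convex_closure_interior[of S] compact_imp_closed[of S] by simp
  have lip: "norm (x - y) \<le> L * norm (g x - g y)" if "x \<in> S" "y \<in> S" for x y
  proof -
    have "norm (x - y) - L * norm (g x - g y) \<le> 0"
    proof (rule continuous_le_on_closure[where f = "\<lambda>z. norm (z - y) - L * norm (g z - g y)" and x = x])
      show "continuous_on (closure (interior S)) (\<lambda>z. norm (z - y) - L * norm (g z - g y))"
        unfolding cl by (intro continuous_intros cg)
    qed (use cl that int in auto)
    then show ?thesis by simp
  qed
  show thesis
    by (rule that[of "\<lambda>x. blinfun_apply (g' x)" k "\<lambda>x. blinfun_apply (k' (g x))" L]) (fact | rule g'(1) k'(1) | simp)+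
qed

text \<open>A segment in \<open>S\<close> is traversed piece by piece, with the same constant on each piece.\<close>

lemma lipschitz_from_closed_cover:
  fixes f :: "'a::real_normed_vector \<Rightarrow> 'b::metric_space"
  assumes fin: "finite I" and cl: "\<And>i. i \<in> I \<Longrightarrow> closed (F i)" and cov: "S \<subseteq> (\<Union>i\<in>I. F i)" and S: "convex S"
    and L: "0 \<le> L" "\<And>i. i \<in> I \<Longrightarrow> L-lipschitz_on (F i) f"
  shows "L-lipschitz_on S f"
proof (rule lipschitz_onI[OF _ L(1)])
  fix x y assume xy: "x \<in> S" "y \<in> S"
  let ?\<gamma> = "\<lambda>t. x + t *\<^sub>R (y - x)"
  have "(L * norm (y - x))-lipschitz_on {0..1} (f \<circ> ?\<gamma>)"
  proof (rule lipschitz_on_closed_Union[where I = I and U = "\<lambda>i. ?\<gamma> -` F i"])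
    fix i assume i: "i \<in> I"
    show "(L * norm (y - x))-lipschitz_on (?\<gamma> -` F i) (f \<circ> ?\<gamma>)"
    proof (rule lipschitz_onI)
      fix s t assume st: "s \<in> ?\<gamma> -` F i" "t \<in> ?\<gamma> -` F i"
      have "dist (?\<gamma> s) (?\<gamma> t) = \<bar>s - t\<bar> * norm (y - x)"
        by (simp add: dist_norm flip: scaleR_diff_left)
      then show "dist ((f \<circ> ?\<gamma>) s) ((f \<circ> ?\<gamma>) t) \<le> L * norm (y - x) * dist s t"
        using lipschitz_onD[OF L(2)[OF i], of "?\<gamma> s" "?\<gamma> t"] st by (simp add: dist_norm mult_ac)
    qed (use L in auto)
    show "closed (?\<gamma> -` F i)"
      by (rule continuous_closed_vimage[OF cl[OF i]]) (auto intro!: continuous_intros)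
  next
    have "?\<gamma> t \<in> S" if "t \<in> {0..1}" for t
    proof -
      have "(1 - t) *\<^sub>R x + t *\<^sub>R y \<in> S" using S that xy by (intro convexD) auto
      then show ?thesis by (simp add: algebra_simps)
    qed
    then show "{0..1} \<subseteq> (\<Union>i\<in>I. ?\<gamma> -` F i)" using cov by fastforce
  qed (use fin L in auto)
  then have "dist ((f \<circ> ?\<gamma>) 0) ((f \<circ> ?\<gamma>) 1) \<le> L * norm (y - x) * dist 0 (1::real)"
    by (rule lipschitz_onD) auto
  then show "dist (f x) (f y) \<le> L * dist x y" by (simp add: dist_norm norm_minus_commute)
qed

section \<open>Meshes and their shape functions\<close>

lemma lattice_0: "0 \<in> lattice bc"
  by (cases bc) (auto intro!: exI[of _ "\<lambda>_. 0"] simp: vec_eq_iff)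

lemma lattice_add: "l \<in> lattice bc \<Longrightarrow> l' \<in> lattice bc \<Longrightarrow> l + l' \<in> lattice bc"
proof (cases bc)
  case (Periodic p)
  assume "l \<in> lattice bc" "l' \<in> lattice bc"
  then obtain z z' where "l = (\<chi> k. p $ k * of_int (z k))" "l' = (\<chi> k. p $ k * of_int (z' k))"
    using Periodic by auto
  then show ?thesis using Periodic
    by (auto intro!: exI[of _ "\<lambda>k. z k + z' k"] simp: vec_eq_iff distrib_left)
qed auto

lemma lattice_minus: "l \<in> lattice bc \<Longrightarrow> - l \<in> lattice bc"
proof (cases bc)
  case (Periodic p)
  assume "l \<in> lattice bc"
  then obtain z where "l = (\<chi> k. p $ k * of_int (z k))" using Periodic by auto
  then show ?thesis using Periodic by (auto intro!: exI[of _ "\<lambda>k. - z k"] simp: vec_eq_iff)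
qed auto

lemma flow_domain_unique_translate:
  assumes "boundary_ok bc"
  shows "\<exists>!l. l \<in> lattice bc \<and> x + l \<in> flow_domain bc"
proof (cases bc)
  case (Periodic p)
  have p: "0 < p $ k" for k using assms Periodic by simp
  have iff: "0 \<le> x $ k + p $ k * of_int n \<and> x $ k + p $ k * of_int n < p $ k \<longleftrightarrow> n = - \<lfloor>x $ k / p $ k\<rfloor>" for k n
  proof -
    have "0 \<le> x $ k + p $ k * of_int n \<and> x $ k + p $ k * of_int n < p $ k \<longleftrightarrow>
        of_int (- n) \<le> x $ k / p $ k \<and> x $ k / p $ k < of_int (- n) + 1"
      using p[of k] by (auto simp: field_simps)
    also have "\<dots> \<longleftrightarrow> \<lfloor>x $ k / p $ k\<rfloor> = - n" by (simp add: floor_eq_iff)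
    finally show ?thesis by auto
  qed
  show ?thesis
  proof (rule ex1I[of _ "\<chi> k. p $ k * of_int (- \<lfloor>x $ k / p $ k\<rfloor>)"])
    show "(\<chi> k. p $ k * of_int (- \<lfloor>x $ k / p $ k\<rfloor>)) \<in> lattice bc \<and> x + (\<chi> k. p $ k * of_int (- \<lfloor>x $ k / p $ k\<rfloor>)) \<in> flow_domain bc"
    proof -
      have "0 \<le> x $ k + p $ k * of_int (- \<lfloor>x $ k / p $ k\<rfloor>) \<and> x $ k + p $ k * of_int (- \<lfloor>x $ k / p $ k\<rfloor>) < p $ k" for k
        by (simp only: iff)
      then show ?thesis using Periodic
        by (auto intro!: exI[of _ "\<lambda>k. - \<lfloor>x $ k / p $ k\<rfloor>"])
    qed
    fix l assume "l \<in> lattice bc \<and> x + l \<in> flow_domain bc"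
    then obtain z where z: "l = (\<chi> k. p $ k * of_int (z k))" "x + l \<in> flow_domain bc" using Periodic by auto
    then have "z k = - \<lfloor>x $ k / p $ k\<rfloor>" for k using Periodic iff[of k "z k"] by auto
    then show "l = (\<chi> k. p $ k * of_int (- \<lfloor>x $ k / p $ k\<rfloor>))" using z(1) by simp
  qed
qed auto

lemma flow_domain_borel: "flow_domain bc \<in> sets borel"
proof (cases bc)
  case (Periodic p)
  have "flow_domain bc = (\<Inter>k. {x. 0 \<le> x $ k} \<inter> {x. x $ k < p $ k})" using Periodic by auto
  then show ?thesis by (simp add: borel_closed borel_open closed_halfspace_component_ge_cart open_halfspace_component_lt_cart)
qed auto

lemma flow_domain_lebesgue: "flow_domain bc \<in> sets lebesgue"
  by (rule sets_completionI_sets) (simp add: flow_domain_borel)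

lemma flow_domain_bounded: "bc \<noteq> Whole_Space \<Longrightarrow> bounded (flow_domain bc)"
proof (cases bc)
  case (Periodic p)
  have "flow_domain bc \<subseteq> cbox 0 p" using Periodic by (auto simp: mem_box_cart less_imp_le)
  then show ?thesis using bounded_subset bounded_cbox by blast
qed auto

locale fe_mesh =
  fixes X :: "('c, 'g, 'i, 'd::{finite,wellorder}) mesh_data"
    and bc :: "'d boundary" and a :: "'g \<Rightarrow> (real, 'd) vec"
  assumes bc: "boundary_ok bc" and data: "mesh_data_ok X bc" and mesh: "mesh_ok X bc a"
begin

abbreviation "T \<equiv> geo_map X a"
abbreviation "\<Lambda> \<equiv> lattice bc"
abbreviation "\<Omega> \<equiv> flow_domain bc"
abbreviation "\<psi> \<equiv> psi X bc a"
abbreviation "Kh K \<equiv> Khat (refel X K)"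
abbreviation "cdofs K \<equiv> (\<lambda>i. jdof X i K) ` {..<nf (refel X K)}"

definition cell :: "'c \<Rightarrow> (real, 'd) vec \<Rightarrow> ((real, 'd) vec) set" where
  "cell K l = (\<lambda>xh. T K xh + l) ` Kh K"

definition open_cell :: "'c \<Rightarrow> (real, 'd) vec \<Rightarrow> ((real, 'd) vec) set" where
  "open_cell K l = (\<lambda>xh. T K xh + l) ` interior (Kh K)"

lemma ref_props:
  assumes "K \<in> cells X"
  shows "compact (Kh K)" "convex (Kh K)" "interior (Kh K) \<noteq> {}"
    "\<And>i. i < nf (refel X K) \<Longrightarrow> C1_on (Kh K) (theta (refel X K) i)"
    "\<And>i xh. i < nf (refel X K) \<Longrightarrow> xh \<in> Kh K \<Longrightarrow> 0 \<le> theta (refel X K) i xh"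
    "\<And>xh. xh \<in> Kh K \<Longrightarrow> (\<Sum>i<nf (refel X K). theta (refel X K) i xh) = 1"
    "\<And>i. i < nf_geo (refel X K) \<Longrightarrow> C1_on (Kh K) (theta_geo (refel X K) i)"
    "\<And>c i. (\<And>xh. xh \<in> Kh K \<Longrightarrow> (\<Sum>i<nf (refel X K). c i * theta (refel X K) i xh) = 0) \<Longrightarrow> i < nf (refel X K) \<Longrightarrow> c i = 0"
    "inj_on (\<lambda>i. jdof X i K) {..<nf (refel X K)}"
    "inj_on (\<lambda>i. jgeo X i K) {..<nf_geo (refel X K)}"
proof -
  note d = data[unfolded mesh_data_ok_def]
  have "ref_element_ok (refel X K)" by (rule bspec[OF conjunct1[OF conjunct2[OF d]] assms])
  note r1 = this[unfolded ref_element_ok_def]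
  note r2 = conjunct2[OF r1] note r3 = conjunct2[OF r2] note r4 = conjunct2[OF r3] note r5 = conjunct2[OF r4]
  note r6 = conjunct2[OF r5] note r7 = conjunct2[OF r6] note r8 = conjunct2[OF r7]
  show "compact (Kh K)" by (rule conjunct1[OF r1])
  show "convex (Kh K)" by (rule conjunct1[OF r2])
  show "interior (Kh K) \<noteq> {}" by (rule conjunct1[OF r3])
  show "\<And>i. i < nf (refel X K) \<Longrightarrow> C1_on (Kh K) (theta (refel X K) i)"
    by (rule conjunct1[OF r4, rule_format])
  show "\<And>i xh. i < nf (refel X K) \<Longrightarrow> xh \<in> Kh K \<Longrightarrow> 0 \<le> theta (refel X K) i xh"
    by (rule conjunct1[OF r5, rule_format])
  show "\<And>xh. xh \<in> Kh K \<Longrightarrow> (\<Sum>i<nf (refel X K). theta (refel X K) i xh) = 1"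
    by (rule conjunct1[OF r6, rule_format])
  show "\<And>c i. (\<And>xh. xh \<in> Kh K \<Longrightarrow> (\<Sum>i<nf (refel X K). c i * theta (refel X K) i xh) = 0) \<Longrightarrow> i < nf (refel X K) \<Longrightarrow> c i = 0"
    by (rule conjunct1[OF r7, rule_format])
  show "\<And>i. i < nf_geo (refel X K) \<Longrightarrow> C1_on (Kh K) (theta_geo (refel X K) i)"
    by (rule conjunct1[OF r8, rule_format])
  show "inj_on (\<lambda>i. jgeo X i K) {..<nf_geo (refel X K)}"
    by (rule bspec[OF conjunct1[OF conjunct2[OF conjunct2[OF d]]] assms])
  show "inj_on (\<lambda>i. jdof X i K) {..<nf (refel X K)}"
    by (rule bspec[OF conjunct1[OF conjunct2[OF conjunct2[OF conjunct2[OF d]]]] assms])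
qed

lemma dof_local_jdof:
  assumes "K \<in> cells X" "i < nf (refel X K)"
  shows "dof_local X K (jdof X i K) xh = theta (refel X K) i xh"
proof -
  have "{i'. i' < nf (refel X K) \<and> jdof X i' K = jdof X i K} = {i}"
    using ref_props(9)[OF assms(1)] assms(2) by (auto simp: inj_on_def)
  then show ?thesis by (simp add: dof_local_def)
qed

lemma dof_local_other: "j \<notin> cdofs K \<Longrightarrow> dof_local X K j xh = 0"
proof -
  assume "j \<notin> cdofs K"
  then have "{i. i < nf (refel X K) \<and> jdof X i K = j} = {}" by auto
  then show ?thesis unfolding dof_local_def by (simp only: sum.empty)
qed

lemma dof_local_nonneg: "K \<in> cells X \<Longrightarrow> xh \<in> Kh K \<Longrightarrow> 0 \<le> dof_local X K j xh"
  unfolding dof_local_def using ref_props(5) by (auto intro!: sum_nonneg)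

lemma sum_dof_local:
  assumes "K \<in> cells X"
  shows "(\<Sum>j\<in>cdofs K. dof_local X K j xh *\<^sub>R C j) = (\<Sum>i<nf (refel X K). theta (refel X K) i xh *\<^sub>R C (jdof X i K))"
  by (subst sum.reindex[OF ref_props(9)[OF assms]]) (simp add: dof_local_jdof[OF assms])

lemma dof_local_le_1: 
  assumes "K \<in> cells X" "xh \<in> Kh K"
  shows "dof_local X K j xh \<le> 1"
proof (cases "j \<in> cdofs K")
  case True
  have "dof_local X K j xh \<le> (\<Sum>j\<in>cdofs K. dof_local X K j xh)"
    by (rule member_le_sum[OF True]) (use dof_local_nonneg[OF assms] in auto)
  also have "\<dots> = 1" using sum_dof_local[OF assms(1), of xh "\<lambda>_. 1::real"] ref_props(6)[OF assms] by simp
  finally show ?thesis .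
qed (simp add: dof_local_other)

lemma dof_local_C1: 
  assumes "K \<in> cells X" shows "C1_on (Kh K) (dof_local X K j)"
proof (cases "j \<in> cdofs K")
  case True
  then obtain i where "i < nf (refel X K)" "j = jdof X i K" by auto
  then have "dof_local X K j = theta (refel X K) i" using dof_local_jdof[OF assms] by (simp add: fun_eq_iff)
  then show ?thesis using ref_props(4)[OF assms] \<open>i < nf (refel X K)\<close> by simp
next
  case False
  then have "dof_local X K j = (\<lambda>_. 0)" using dof_local_other by (simp add: fun_eq_iff)
  then show ?thesis unfolding C1_on_def by (auto intro!: exI[of _ "\<lambda>_. 0"] simp: zero_blinfun.rep_eq)
qed

lemma dofs_eq: "dofs X = (\<Union>K\<in>cells X. cdofs K)"
proof -
  note d = data[unfolded mesh_data_ok_def, THEN conjunct2, THEN conjunct2, THEN conjunct2, THEN conjunct2]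
  show ?thesis by (rule conjunct1[OF conjunct2[OF d]])
qed

lemma cdofs_subset: "K \<in> cells X \<Longrightarrow> cdofs K \<subseteq> dofs X"
  using dofs_eq by blast

lemma dof_cells_finite: "j \<in> dofs X \<Longrightarrow> finite {K \<in> cells X. j \<in> cdofs K}"
  using data unfolding mesh_data_ok_def by blast

lemma dof_in_cell: "j \<in> dofs X \<Longrightarrow> \<exists>K\<in>cells X. j \<in> cdofs K"
  using dofs_eq by blast

lemmas mesh_conj = mesh[unfolded mesh_ok_def]

lemma psi_conforming: "conforming X bc a (dof_local X) (dofs X)"
  by (rule mesh_conj[THEN conjunct2, THEN conjunct2, THEN conjunct2, THEN conjunct2])

lemma psi_cell: "j \<in> dofs X \<Longrightarrow> K \<in> cells X \<Longrightarrow> xh \<in> Kh K \<Longrightarrow> l \<in> \<Lambda> \<Longrightarrow> \<psi> j (T K xh + l) = dof_local X K j xh"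
  using psi_conforming unfolding conforming_def psi_def by simp

lemma psi_continuous: "j \<in> dofs X \<Longrightarrow> continuous_on UNIV (\<psi> j)"
  using psi_conforming unfolding conforming_def psi_def by simp

lemma cover:
  obtains K xh l where "K \<in> cells X" "xh \<in> Kh K" "l \<in> \<Lambda>" "x = T K xh + l"
  using mesh_conj[THEN conjunct2, THEN conjunct1, rule_format, of x] by blast

lemma locally_finite: "finite {(K, l). K \<in> cells X \<and> l \<in> \<Lambda> \<and> cball 0 r \<inter> cell K l \<noteq> {}}"
  unfolding cell_def by (rule mesh_conj[THEN conjunct2, THEN conjunct2, THEN conjunct1, rule_format])

lemma psi_periodic:
  assumes "j \<in> dofs X" "l \<in> \<Lambda>"
  shows "\<psi> j (x + l) = \<psi> j x"
proof -
  obtain K xh l' where x: "K \<in> cells X" "xh \<in> Kh K" "l' \<in> \<Lambda>" "x = T K xh + l'" by (rule cover)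
  have "x + l = T K xh + (l' + l)" using x by simp
  then show ?thesis using psi_cell[OF assms(1) x(1,2)] lattice_add[OF x(3) assms(2)] x by metis
qed

lemma psi_nonneg: "j \<in> dofs X \<Longrightarrow> 0 \<le> \<psi> j x"
  by (rule cover[of x]) (simp add: psi_cell dof_local_nonneg)

lemma psi_le_1: "j \<in> dofs X \<Longrightarrow> \<psi> j x \<le> 1"
  by (rule cover[of x]) (simp add: psi_cell dof_local_le_1)

lemma psi_nonzero_cell:
  assumes "j \<in> dofs X" "\<psi> j x \<noteq> 0"
  obtains K l where "K \<in> cells X" "j \<in> cdofs K" "l \<in> \<Lambda>" "x \<in> cell K l"
proof -
  obtain K xh l where x: "K \<in> cells X" "xh \<in> Kh K" "l \<in> \<Lambda>" "x = T K xh + l" by (rule cover)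
  then have "dof_local X K j xh \<noteq> 0" using assms psi_cell by auto
  then show thesis using that[of K l] dof_local_other x by (auto simp: cell_def)
qed

lemma diffeo:
  assumes "K \<in> cells X"
  obtains g' k k' L where
    "\<And>x. x \<in> Kh K \<Longrightarrow> (T K has_derivative g' x) (at x within Kh K)"
    "\<And>x. x \<in> Kh K \<Longrightarrow> (k has_derivative k' x) (at (T K x) within T K ` Kh K)"
    "\<And>x. x \<in> Kh K \<Longrightarrow> k (T K x) = x"
    "continuous_on (Kh K) (T K)" "inj_on (T K) (Kh K)" "continuous_on (T K ` Kh K) k"
    "0 \<le> L" "\<And>x y. x \<in> Kh K \<Longrightarrow> y \<in> Kh K \<Longrightarrow> norm (x - y) \<le> L * norm (T K x - T K y)"
proof -
  have d: "diffeo_on (Kh K) (T K)" by (rule bspec[OF mesh_conj[THEN conjunct1] assms])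
  show thesis
    by (rule diffeo_on_convex_body[OF d ref_props(1-3)[OF assms]]) (rule that; assumption)
qed

lemma T_continuous: "K \<in> cells X \<Longrightarrow> continuous_on (Kh K) (T K)"
  by (erule diffeo) assumption

lemma T_inj: "K \<in> cells X \<Longrightarrow> inj_on (T K) (Kh K)"
  by (erule diffeo) assumption

lemma T_differentiable: "K \<in> cells X \<Longrightarrow> T K differentiable_on Kh K"
  by (erule diffeo) (unfold differentiable_on_def differentiable_def, blast)

lemma cell_compact: "K \<in> cells X \<Longrightarrow> compact (cell K l)"
  unfolding cell_def by (intro compact_continuous_image continuous_intros T_continuous ref_props(1))

lemma cell_closed: "K \<in> cells X \<Longrightarrow> closed (cell K l)"
  by (rule compact_imp_closed[OF cell_compact])

lemma cell_nonempty: "K \<in> cells X \<Longrightarrow> cell K l \<noteq> {}"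
  using ref_props(3) interior_subset unfolding cell_def by fastforce

lemma open_cell_open:
  assumes "K \<in> cells X" shows "open (open_cell K l)"
proof -
  have "continuous_on (interior (Kh K)) (\<lambda>xh. T K xh + l)"
    by (intro continuous_intros continuous_on_subset[OF T_continuous[OF assms]] interior_subset)
  moreover have "inj_on (\<lambda>xh. T K xh + l) (interior (Kh K))"
    using inj_on_subset[OF T_inj[OF assms] interior_subset] by (simp add: inj_on_def)
  ultimately show ?thesis unfolding open_cell_def by (intro invariance_of_domain) auto
qed

lemma open_cell_subset: "open_cell K l \<subseteq> cell K l"
  unfolding cell_def open_cell_def using interior_subset by blast

text \<open>The images of the boundaries of all cells: the null set that the statements valid almost everywhere
  leave out.\<close>

definition skeleton :: "((real, 'd) vec) set" where
  "skeleton = (\<Union>(K, l)\<in>cells X \<times> \<Lambda>. (\<lambda>xh. T K xh + l) ` frontier (Kh K))"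

lemma cells_countable: "countable (cells X \<times> \<Lambda>)"
proof -
  have "cells X \<times> \<Lambda> \<subseteq> (\<Union>n::nat. {(K, l). K \<in> cells X \<and> l \<in> \<Lambda> \<and> cball 0 (real n) \<inter> cell K l \<noteq> {}})"
  proof clarify
    fix K l assume K: "K \<in> cells X" "l \<in> \<Lambda>"
    obtain x where x: "x \<in> cell K l" using cell_nonempty[OF K(1)] by blast
    obtain n :: nat where "norm x \<le> real n" using real_arch_simple by blast
    then have "x \<in> cball 0 (real n) \<inter> cell K l" using x by simp
    then have "(K, l) \<in> {(K, l). K \<in> cells X \<and> l \<in> \<Lambda> \<and> cball 0 (real n) \<inter> cell K l \<noteq> {}}"
      using K by blast
    then show "(K, l) \<in> (\<Union>n::nat. {(K, l). K \<in> cells X \<and> l \<in> \<Lambda> \<and> cball 0 (real n) \<inter> cell K l \<noteq> {}})"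
      by blast
  qed
  then show ?thesis using locally_finite by (meson countable_UN countable_finite countable_subset countableI_type)
qed

lemma lattice_countable: "countable \<Lambda>"
proof -
  obtain K where "K \<in> cells X" by (rule cover)
  then have "\<Lambda> \<subseteq> snd ` (cells X \<times> \<Lambda>)" by force
  then show ?thesis using cells_countable countable_image countable_subset by blast
qed

text \<open>The frontier of a convex set is a null set and differentiable maps preserve null sets; there are
  countably many cells because the mesh is locally finite.\<close>

lemma skeleton_negligible: "negligible skeleton"
  unfolding skeleton_def
proof (rule negligible_countable_Union)
  show "countable ((\<lambda>(K, l). (\<lambda>xh. T K xh + l) ` frontier (Kh K)) ` (cells X \<times> \<Lambda>))"
    using cells_countable by (rule countable_image)
  fix S assume "S \<in> (\<lambda>(K, l). (\<lambda>xh. T K xh + l) ` frontier (Kh K)) ` (cells X \<times> \<Lambda>)"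
  then obtain K l where S: "K \<in> cells X" "S = (\<lambda>xh. T K xh + l) ` frontier (Kh K)" by auto
  have "frontier (Kh K) \<subseteq> Kh K" using ref_props(1)[OF S(1)] compact_imp_closed frontier_subset_closed by blast
  then have "(\<lambda>xh. T K xh + l) differentiable_on frontier (Kh K)"
    by (intro differentiable_on_add differentiable_on_const differentiable_on_subset[OF T_differentiable[OF S(1)]])
  then show "negligible S" unfolding S(2)
    by (intro negligible_differentiable_image_negligible) (use negligible_convex_frontier ref_props(2)[OF S(1)] in auto)
qed

lemma off_skeleton:
  assumes "x \<notin> skeleton"
  obtains K xh l where "K \<in> cells X" "l \<in> \<Lambda>" "xh \<in> interior (Kh K)" "x = T K xh + l" "x \<in> open_cell K l"
proof -
  obtain K xh l where x: "K \<in> cells X" "xh \<in> Kh K" "l \<in> \<Lambda>" "x = T K xh + l" by (rule cover)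
  have "xh \<in> interior (Kh K)"
  proof (rule ccontr)
    assume "xh \<notin> interior (Kh K)"
    then have "xh \<in> frontier (Kh K)" using x(2) closure_subset by (auto simp: frontier_def)
    then show False using assms x unfolding skeleton_def by blast
  qed
  then show thesis using that x by (auto simp: open_cell_def)
qed

text \<open>Two cells meet in the image of a proper face, which contains the image of no interior point.\<close>

lemma open_cells_disjoint:
  assumes "K \<in> cells X" "K' \<in> cells X" "l \<in> \<Lambda>" "l' \<in> \<Lambda>" "open_cell K l \<inter> open_cell K' l' \<noteq> {}"
  shows "K = K' \<and> l = l'"
proof (rule ccontr)
  assume ne: "\<not> (K = K' \<and> l = l')"
  obtain xh yh where xy: "xh \<in> interior (Kh K)" "yh \<in> interior (Kh K')" "T K xh + l = T K' yh + l'"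
    using assms(5) unfolding open_cell_def by blast
  have l: "l' - l \<in> \<Lambda>" using lattice_add[OF assms(4) lattice_minus[OF assms(3)]] by simp
  have c: "K \<noteq> K' \<or> l' - l \<noteq> 0" using ne by auto
  from mesh_conj[THEN conjunct2, THEN conjunct2, THEN conjunct2, THEN conjunct1, rule_format, OF assms(1,2) l c]
  obtain F F' where FF: "F face_of Kh K \<and> F \<noteq> Kh K \<and> F' face_of Kh K' \<and> F' \<noteq> Kh K' \<and>
    T K ` Kh K \<inter> (\<lambda>xh. T K' xh + (l' - l)) ` Kh K' = T K ` F \<and> T K ` F = (\<lambda>xh. T K' xh + (l' - l)) ` F'"
    by (elim exE)
  have F: "F face_of Kh K" "F \<noteq> Kh K" "T K ` Kh K \<inter> (\<lambda>xh. T K' xh + (l' - l)) ` Kh K' = T K ` F"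
    using FF by simp_all
  have e: "T K xh = T K' yh + (l' - l)" using xy(3) by (simp add: algebra_simps)
  have kx: "xh \<in> Kh K" and ky: "yh \<in> Kh K'"
    using xy(1,2) interior_subset[of "Kh K"] interior_subset[of "Kh K'"] by (simp_all add: subsetD)
  have "T K xh \<in> (\<lambda>xh. T K' xh + (l' - l)) ` Kh K'" unfolding e by (rule imageI[OF ky])
  with imageI[OF kx, of "T K"] have "T K xh \<in> T K ` Kh K \<inter> (\<lambda>xh. T K' xh + (l' - l)) ` Kh K'" by (rule IntI)
  then have "T K xh \<in> T K ` F" unfolding F(3) .
  then obtain zh where "zh \<in> F" "T K xh = T K zh" by (rule imageE)
  moreover have "zh \<in> Kh K" using face_of_imp_subset[OF F(1)] \<open>zh \<in> F\<close> by (rule subsetD)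
  ultimately have "xh \<in> F" using inj_onD[OF T_inj[OF assms(1)], of xh zh] kx by simp
  then show False using face_of_disjoint_interior[OF F(1,2)] xy(1) by (metis IntI empty_iff)
qed
end

section \<open>Gradients and neighbours\<close>

lemma difference_quotient_tendsto:
  fixes g :: "'a::real_normed_vector \<Rightarrow> real"
  assumes "(g has_derivative D) (at x)"
  shows "(\<lambda>n. real (Suc n) * (g (x + inverse (real (Suc n)) *\<^sub>R v) - g x)) \<longlonglongrightarrow> D v"
proof -
  interpret bounded_linear D using assms by (rule has_derivative_bounded_linear)
  have "((\<lambda>s. g (x + s *\<^sub>R v)) has_derivative (\<lambda>s. D (s *\<^sub>R v))) (at 0)"
  proof (rule has_derivative_compose[of "\<lambda>s. x + s *\<^sub>R v" "\<lambda>s. s *\<^sub>R v"])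
    show "((\<lambda>s. x + s *\<^sub>R v) has_derivative (\<lambda>s. s *\<^sub>R v)) (at 0)"
      by (auto intro!: derivative_eq_intros)
    show "(g has_derivative D) (at (x + 0 *\<^sub>R v))" using assms by simp
  qed
  then have "((\<lambda>s. g (x + s *\<^sub>R v)) has_real_derivative D v) (at 0)"
    by (simp add: has_field_derivative_def scaleR mult.commute[of _ "D v"])
  then have lim: "((\<lambda>h. (g (x + h *\<^sub>R v) - g x) / h) \<longlongrightarrow> D v) (at 0)"
    by (simp add: DERIV_def)
  have "filterlim (\<lambda>n. inverse (real (Suc n))) (at 0) sequentially"
    using LIMSEQ_inverse_real_of_nat by (simp add: filterlim_at)
  from filterlim_compose[OF lim this] show ?thesis
    by (simp add: divide_inverse mult.commute)
qed

lemma grad_of_derivative: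
  fixes g :: "real^'n \<Rightarrow> real"
  assumes "(g has_derivative D) (at x)"
  shows "D v = grad g x \<bullet> v" "grad g x $ k = D (axis k 1)"
proof -
  have lin: "linear D" using assms has_derivative_linear by blast
  have D: "frechet_derivative g (at x) = D" using frechet_derivative_at[OF assms] by simp
  then show g: "grad g x $ k = D (axis k 1)" for k by (simp add: grad_def)
  have "D v = D (\<Sum>k\<in>UNIV. (v $ k) *\<^sub>R axis k 1)"
    using basis_expansion[of v] by (simp add: scalar_mult_eq_scaleR)
  also have "\<dots> = (\<Sum>k\<in>UNIV. v $ k * D (axis k 1))"
    by (simp add: linear_sum[OF lin] linear_cmul[OF lin])
  also have "\<dots> = grad g x \<bullet> v"
    by (simp add: inner_vec_def g mult.commute)
  finally show "D v = grad g x \<bullet> v" .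
qed

context fe_mesh
begin

lemma psi_differentiable_open_cell:
  assumes j: "j \<in> dofs X" and K: "K \<in> cells X" "l \<in> \<Lambda>" and x: "x \<in> open_cell K l"
  shows "\<psi> j differentiable (at x)"
proof -
  obtain xh where xh: "xh \<in> interior (Kh K)" "x = T K xh + l" using x by (auto simp: open_cell_def)
  have xK: "xh \<in> Kh K" using xh interior_subset by blast
  obtain k k' where k: "(k has_derivative k') (at (T K xh) within T K ` Kh K)" "\<And>x. x \<in> Kh K \<Longrightarrow> k (T K x) = x"
    by (rule diffeo[OF K(1)]) (use xK in blast)
  have "open_cell K 0 \<subseteq> T K ` Kh K" using open_cell_subset[of K 0] by (simp add: cell_def)
  moreover have "T K xh \<in> open_cell K 0" using xh by (simp add: open_cell_def)
  ultimately have "at (T K xh) within T K ` Kh K = at (T K xh)"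
    using open_cell_open[OF K(1)] by (meson at_within_interior interior_maximal subsetD)
  then have k': "(k has_derivative k') (at (x - l))" using k(1) xh by simp
  obtain h' where "(dof_local X K j has_derivative h') (at xh within Kh K)"
    using dof_local_C1[OF K(1)] xK unfolding C1_on_def by blast
  then have h': "(dof_local X K j has_derivative h') (at (k (x - l)))"
    using at_within_interior[OF xh(1)] k(2)[OF xK] xh(2) by simp
  have "((\<lambda>y. k (y - l)) has_derivative (\<lambda>v. k' v)) (at x)"
    by (rule has_derivative_compose[of "\<lambda>y. y - l" "\<lambda>v. v" x UNIV k k', OF _ k']) (auto intro!: derivative_eq_intros)
  from has_derivative_compose[of "\<lambda>y. k (y - l)" "\<lambda>v. k' v" x UNIV "dof_local X K j" h', OF this h']
  have "((\<lambda>y. dof_local X K j (k (y - l))) has_derivative (\<lambda>v. h' (k' v))) (at x)" .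
  then have "(\<psi> j has_derivative (\<lambda>v. h' (k' v))) (at x)"
  proof (rule has_derivative_transform_within_open)
    show "open (open_cell K l)" by (rule open_cell_open[OF K(1)])
    show "x \<in> open_cell K l" by (rule x)
    fix y assume "y \<in> open_cell K l"
    then obtain yh where yh: "yh \<in> Kh K" "y = T K yh + l" using interior_subset by (auto simp: open_cell_def)
    then show "dof_local X K j (k (y - l)) = \<psi> j y" using psi_cell[OF j K(1) yh(1) K(2)] k(2)[OF yh(1)] by simp
  qed
  then show ?thesis by (auto simp: differentiable_def)
qed

lemma psi_has_derivative_grad:
  assumes j: "j \<in> dofs X" and x: "x \<notin> skeleton"
  shows "(\<psi> j has_derivative (\<lambda>v. grad (\<psi> j) x \<bullet> v)) (at x)"
proof -
  obtain K xh l where "K \<in> cells X" "l \<in> \<Lambda>" "x \<in> open_cell K l" by (rule off_skeleton[OF x])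
  then obtain D where D: "(\<psi> j has_derivative D) (at x)"
    using psi_differentiable_open_cell[OF j] unfolding differentiable_def by blast
  have "D = (\<lambda>v. grad (\<psi> j) x \<bullet> v)" using grad_of_derivative(1)[OF D] by (rule ext)
  then show ?thesis using D by simp
qed

text \<open>On a closed cell \<open>\<psi> j\<close> is a \<open>C\<^sup>1\<close> function on a convex reference element, composed with the Lipschitz
  inverse of the geometric map.  Finitely many closed cells cover a ball.\<close>

lemma psi_locally_lipschitz:
  assumes j: "j \<in> dofs X"
  shows "\<exists>L\<ge>0. L-lipschitz_on (cball 0 r) (\<psi> j)"
proof -
  let ?P = "{(K, l). K \<in> cells X \<and> l \<in> \<Lambda> \<and> cball 0 r \<inter> cell K l \<noteq> {}}"
  have "\<exists>L\<ge>0. L-lipschitz_on (cell K l) (\<psi> j)" if K: "K \<in> cells X" "l \<in> \<Lambda>" for K l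
  proof -
    obtain A where A: "0 \<le> A" "\<And>x y. x \<in> Kh K \<Longrightarrow> y \<in> Kh K \<Longrightarrow> norm (x - y) \<le> A * norm (T K x - T K y)"
      by (rule diffeo[OF K(1)]) blast
    obtain B where B: "0 \<le> B" "\<And>x y. x \<in> Kh K \<Longrightarrow> y \<in> Kh K \<Longrightarrow> norm (dof_local X K j x - dof_local X K j y) \<le> B * norm (x - y)"
      using C1_on_imp_lipschitz[OF dof_local_C1[OF K(1)] ref_props(1,2)[OF K(1)]] by blast
    have "(B * A)-lipschitz_on (cell K l) (\<psi> j)"
    proof (rule lipschitz_onI)
      fix x y assume "x \<in> cell K l" "y \<in> cell K l"
      then obtain xh yh where xy: "xh \<in> Kh K" "yh \<in> Kh K" "x = T K xh + l" "y = T K yh + l" by (auto simp: cell_def)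
      have "norm (dof_local X K j xh - dof_local X K j yh) \<le> B * norm (xh - yh)" by (rule B(2)[OF xy(1,2)])
      also have "\<dots> \<le> B * (A * norm (T K xh - T K yh))" by (rule mult_left_mono[OF A(2)[OF xy(1,2)] B(1)])
      finally show "dist (\<psi> j x) (\<psi> j y) \<le> B * A * dist x y"
        using xy psi_cell[OF j K(1) xy(1) K(2)] psi_cell[OF j K(1) xy(2) K(2)] by (simp add: dist_norm mult.assoc)
    qed (use A B in auto)
    then show ?thesis using A(1) B(1) by (intro exI[of _ "B * A"]) auto
  qed
  then have "\<forall>p\<in>?P. \<exists>L\<ge>0. L-lipschitz_on (cell (fst p) (snd p)) (\<psi> j)" by auto
  from bchoice[OF this] obtain L where L': "\<forall>p\<in>?P. 0 \<le> L p \<and> (L p)-lipschitz_on (cell (fst p) (snd p)) (\<psi> j)"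
    by (elim exE)
  have L: "(L p)-lipschitz_on (cell (fst p) (snd p)) (\<psi> j)" if "p \<in> ?P" for p
    by (rule conjunct2[OF bspec[OF L' that]])
  define M where "M = Max (insert 0 (L ` ?P))"
  have M: "L p \<le> M" if "p \<in> ?P" for p unfolding M_def using that locally_finite by (intro Max_ge) auto
  have M0: "0 \<le> M" unfolding M_def using locally_finite by (intro Max_ge) auto
  have "M-lipschitz_on (cball 0 r) (\<psi> j)"
  proof (rule lipschitz_from_closed_cover[where I = ?P and F = "\<lambda>p. cell (fst p) (snd p)"])
    show "finite ?P" by (rule locally_finite)
    show "closed (cell (fst p) (snd p))" if "p \<in> ?P" for p using that cell_closed by auto
    show "M-lipschitz_on (cell (fst p) (snd p)) (\<psi> j)" if "p \<in> ?P" for p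
      by (rule lipschitz_on_le[OF L[OF that] M[OF that]])
    show "cball 0 r \<subseteq> (\<Union>p\<in>?P. cell (fst p) (snd p))"
    proof
      fix x :: "(real, 'd) vec" assume x: "x \<in> cball 0 r"
      obtain K xh l where "K \<in> cells X" "xh \<in> Kh K" "l \<in> \<Lambda>" "x = T K xh + l" by (rule cover)
      then have "(K, l) \<in> ?P" "x \<in> cell K l" using x by (auto simp: cell_def)
      then show "x \<in> (\<Union>p\<in>?P. cell (fst p) (snd p))" by force
    qed
  qed (use M0 in auto)
  then show ?thesis using M0 by blast
qed

text \<open>Difference quotients are bounded by the Lipschitz constant on a slightly larger ball, and so is their
  limit.\<close>

lemma grad_psi_locally_bounded:
  assumes j: "j \<in> dofs X"
  obtains L where "0 \<le> L" "\<And>x. x \<notin> skeleton \<Longrightarrow> norm x \<le> r \<Longrightarrow> norm (grad (\<psi> j) x) \<le> L"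
proof -
  obtain L where L: "0 \<le> L" "L-lipschitz_on (cball 0 (r + 1)) (\<psi> j)" using psi_locally_lipschitz[OF j] by blast
  have comp: "\<bar>grad (\<psi> j) x $ k\<bar> \<le> L" if x: "x \<notin> skeleton" "norm x \<le> r" for x k
  proof -
    let ?q = "\<lambda>n. real (Suc n) * (\<psi> j (x + inverse (real (Suc n)) *\<^sub>R axis k 1) - \<psi> j x)"
    have "?q \<longlonglongrightarrow> grad (\<psi> j) x \<bullet> axis k 1" by (rule difference_quotient_tendsto[OF psi_has_derivative_grad[OF j x(1)]])
    then have lim: "(\<lambda>n. \<bar>?q n\<bar>) \<longlonglongrightarrow> \<bar>grad (\<psi> j) x $ k\<bar>" by (simp add: inner_axis tendsto_rabs)
    have "\<bar>?q n\<bar> \<le> L" for n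
    proof -
      define z where "z = x + inverse (real (Suc n)) *\<^sub>R axis k 1"
      have i: "0 < inverse (real (Suc n))" "inverse (real (Suc n)) \<le> 1" by (simp_all add: inverse_le_1_iff)
      have zx: "dist z x = inverse (real (Suc n))" by (simp add: z_def dist_norm)
      have zr: "norm z \<le> r + 1"
        using x(2) zx i norm_triangle_ineq2[of z x] by (simp add: dist_norm)
      have "\<bar>\<psi> j z - \<psi> j x\<bar> \<le> L * inverse (real (Suc n))"
        using lipschitz_onD[OF L(2), of z x] x(2) zr unfolding zx by (simp add: dist_real_def del: of_nat_Suc)
      then have "real (Suc n) * \<bar>\<psi> j z - \<psi> j x\<bar> \<le> real (Suc n) * (L * inverse (real (Suc n)))"
        by (rule mult_left_mono) simp
      also have "\<dots> = L" by simp
      finally show ?thesis unfolding abs_mult z_def by simp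
    qed
    then show ?thesis using LIMSEQ_le_const2[OF lim] by blast
  qed
  show thesis
  proof (rule that[of "real CARD('d) * L"])
    fix x assume x: "x \<notin> skeleton" "norm x \<le> r"
    have "norm (grad (\<psi> j) x) \<le> (\<Sum>k\<in>UNIV. \<bar>grad (\<psi> j) x $ k\<bar>)" by (rule norm_le_l1_cart)
    also have "\<dots> \<le> (\<Sum>k\<in>(UNIV::'d set). L)" by (rule sum_mono) (rule comp[OF x])
    finally show "norm (grad (\<psi> j) x) \<le> real CARD('d) * L" by simp
  qed (use L in simp)
qed

lemma AE_off_skeleton: "AE x in lebesgue. x \<notin> skeleton"
  using skeleton_negligible by (intro AE_not_in) (simp add: negligible_iff_null_sets)

lemma psi_measurable: "j \<in> dofs X \<Longrightarrow> \<psi> j \<in> borel_measurable lebesgue"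
  by (rule measurable_completion) (simp add: borel_measurable_continuous_onI[OF psi_continuous])

lemma psi_shift_measurable: "j \<in> dofs X \<Longrightarrow> (\<lambda>x. \<psi> j (x + v)) \<in> borel_measurable lebesgue"
proof (rule measurable_completion)
  assume "j \<in> dofs X"
  then have "continuous_on UNIV (\<lambda>x. \<psi> j (x + v))"
    by (intro continuous_on_compose2[OF psi_continuous, of j UNIV "\<lambda>x. x + v"] continuous_intros) auto
  then show "(\<lambda>x. \<psi> j (x + v)) \<in> borel_measurable lborel" using borel_measurable_continuous_onI by simp
qed

text \<open>Off the skeleton the gradient is a limit of difference quotients of a continuous function.\<close>

lemma grad_psi_measurable:
  assumes j: "j \<in> dofs X"
  shows "grad (\<psi> j) \<in> borel_measurable lebesgue"
proof -
  have sk: "skeleton \<in> sets lebesgue" using skeleton_negligible negligible_imp_sets by auto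
  have "(\<lambda>x. grad (\<psi> j) x \<bullet> b) \<in> borel_measurable lebesgue" for b
  proof (rule borel_measurable_AE)
    let ?q = "\<lambda>n x. real (Suc n) * (\<psi> j (x + inverse (real (Suc n)) *\<^sub>R b) - \<psi> j x)"
    show "(\<lambda>x. indicator (- skeleton) x * (grad (\<psi> j) x \<bullet> b)) \<in> borel_measurable lebesgue"
    proof (rule borel_measurable_LIMSEQ_real)
      show "(\<lambda>x. indicator (- skeleton) x * ?q n x) \<in> borel_measurable lebesgue" for n
        using sk by (intro borel_measurable_times borel_measurable_indicator borel_measurable_diff
            borel_measurable_const psi_shift_measurable[OF j] psi_measurable[OF j]) (simp add: Compl_eq_Diff_UNIV sets.Diff)
      show "(\<lambda>n. indicator (- skeleton) x * ?q n x) \<longlonglongrightarrow> indicator (- skeleton) x * (grad (\<psi> j) x \<bullet> b)" for x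
      proof (cases "x \<in> skeleton")
        case False
        show ?thesis
          by (intro tendsto_mult tendsto_const difference_quotient_tendsto[OF psi_has_derivative_grad[OF j False]])
      qed simp
    qed
    show "AE x in lebesgue. indicator (- skeleton) x * (grad (\<psi> j) x \<bullet> b) = grad (\<psi> j) x \<bullet> b"
      using AE_off_skeleton by eventually_elim simp
  qed
  then show ?thesis by (subst borel_measurable_euclidean_space) simp
qed

text \<open>Near \<open>x\<close> only finitely many cells with the index \<open>j\<close> exist, so that their union is closed.\<close>

lemma supp_in_cells:
  assumes j: "j \<in> dofs X" and x: "x \<in> supp \<psi> j"
  obtains K l where "K \<in> cells X" "j \<in> cdofs K" "l \<in> \<Lambda>" "x \<in> cell K l"
proof -
  define P where "P = {p. (fst p \<in> cells X \<and> snd p \<in> \<Lambda> \<and> cball 0 (norm x + 1) \<inter> cell (fst p) (snd p) \<noteq> {}) \<and> j \<in> cdofs (fst p)}"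
  have P_fin: "finite P"
    by (rule finite_subset[OF _ locally_finite[of "norm x + 1"]]) (auto simp: P_def)
  let ?C = "\<Union>p\<in>P. cell (fst p) (snd p)"
  have "ball x 1 \<inter> {y. \<psi> j y \<noteq> 0} \<subseteq> ?C"
  proof
    fix y assume y: "y \<in> ball x 1 \<inter> {y. \<psi> j y \<noteq> 0}"
    then obtain K l where K: "K \<in> cells X" "j \<in> cdofs K" "l \<in> \<Lambda>" "y \<in> cell K l"
      using psi_nonzero_cell[OF j, of y] by auto
    have "norm y \<le> norm x + 1" using y norm_triangle_ineq2[of y x] by (simp add: dist_norm norm_minus_commute)
    then have "y \<in> cball 0 (norm x + 1) \<inter> cell K l" using K(4) by simp
    then have "(K, l) \<in> P" using K by (auto simp: P_def)
    then show "y \<in> ?C" using K(4) by force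
  qed
  moreover have "closed ?C" using P_fin cell_closed by (intro closed_UN) (auto simp: P_def)
  ultimately have "closure (ball x 1 \<inter> {y. \<psi> j y \<noteq> 0}) \<subseteq> ?C" by (rule closure_minimal)
  moreover have "x \<in> ball x 1 \<inter> closure {y. \<psi> j y \<noteq> 0}" using x by (simp add: supp_def)
  moreover have "ball x 1 \<inter> closure {y. \<psi> j y \<noteq> 0} \<subseteq> closure (ball x 1 \<inter> {y. \<psi> j y \<noteq> 0})"
    by (rule open_Int_closure_subset) simp
  ultimately have "x \<in> ?C" by (meson subsetD)
  then obtain p where "p \<in> P" "x \<in> cell (fst p) (snd p)" by (rule UN_E)
  then show thesis using that[of "fst p" "snd p"] by (simp add: P_def)
qed

lemma psi_zero_off_supp: "x \<notin> supp \<psi> j \<Longrightarrow> \<psi> j x = 0"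
  using closure_subset[of "{x. \<psi> j x \<noteq> 0}"] by (auto simp: supp_def)

lemma supp_closed: "closed (supp \<psi> j)" by (simp add: supp_def)

lemma supp_lebesgue: "supp \<psi> j \<in> sets lebesgue" "supp \<psi> i \<inter> supp \<psi> j \<inter> \<Omega> \<in> sets lebesgue" "supp \<psi> i \<inter> \<Omega> \<in> sets lebesgue"
proof -
  show *: "supp \<psi> j \<in> sets lebesgue" for j using borel_closed[OF supp_closed] by (intro sets_completionI_sets) simp
  show "supp \<psi> i \<inter> supp \<psi> j \<inter> \<Omega> \<in> sets lebesgue" "supp \<psi> i \<inter> \<Omega> \<in> sets lebesgue"
    by (intro sets.Int * flow_domain_lebesgue)+
qed

lemma dofs_meeting_ball_finite: "finite {j \<in> dofs X. supp \<psi> j \<inter> cball 0 r \<noteq> {}}"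
proof (rule finite_subset)
  let ?P = "{(K, l). K \<in> cells X \<and> l \<in> \<Lambda> \<and> cball 0 r \<inter> cell K l \<noteq> {}}"
  show "finite (\<Union>p\<in>?P. cdofs (fst p))" using locally_finite by (rule finite_UN_I) simp
  show "{j \<in> dofs X. supp \<psi> j \<inter> cball 0 r \<noteq> {}} \<subseteq> (\<Union>p\<in>?P. cdofs (fst p))"
  proof
    fix j assume "j \<in> {j \<in> dofs X. supp \<psi> j \<inter> cball 0 r \<noteq> {}}"
    then obtain x where j: "j \<in> dofs X" and x: "x \<in> supp \<psi> j" "x \<in> cball 0 r" by auto
    obtain K l where K: "K \<in> cells X" "j \<in> cdofs K" "l \<in> \<Lambda>" "x \<in> cell K l" by (rule supp_in_cells[OF j x(1)])
    then have "(K, l) \<in> ?P" using x(2) by auto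
    then show "j \<in> (\<Union>p\<in>?P. cdofs (fst p))" using K(2) by force
  qed
qed

lemma supp_domain_bounded:
  assumes j: "j \<in> dofs X" shows "bounded (supp \<psi> j \<inter> \<Omega>)"
proof (cases "bc = Whole_Space")
  case True
  have "supp \<psi> j \<subseteq> (\<Union>K\<in>{K \<in> cells X. j \<in> cdofs K}. cell K 0)"
  proof
    fix x assume "x \<in> supp \<psi> j"
    then obtain K l where "K \<in> cells X" "j \<in> cdofs K" "l \<in> \<Lambda>" "x \<in> cell K l" by (rule supp_in_cells[OF j])
    moreover have "l = 0" using \<open>l \<in> \<Lambda>\<close> True by simp
    ultimately show "x \<in> (\<Union>K\<in>{K \<in> cells X. j \<in> cdofs K}. cell K 0)" by auto
  qed
  moreover have "bounded (\<Union>K\<in>{K \<in> cells X. j \<in> cdofs K}. cell K 0)"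
    using dof_cells_finite[OF j] cell_compact by (intro bounded_UN ballI compact_imp_bounded) auto
  ultimately show ?thesis by (meson bounded_Int bounded_subset)
next
  case False
  then show ?thesis using flow_domain_bounded bounded_Int by blast
qed

abbreviation "nb \<equiv> nbrs \<Omega> (dofs X) \<psi>"

lemma nb_sym: "i \<in> dofs X \<Longrightarrow> j \<in> dofs X \<Longrightarrow> j \<in> nb i \<longleftrightarrow> i \<in> nb j"
  by (simp add: nbrs_def Int_commute)

lemma nb_subset: "nb i \<subseteq> dofs X" by (auto simp: nbrs_def)

lemma supp_domain_ball:
  assumes i: "i \<in> dofs X"
  shows "\<exists>r>0. \<forall>x\<in>supp \<psi> i \<inter> \<Omega>. norm x \<le> r"
  using supp_domain_bounded[OF i] unfolding bounded_pos by blast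

lemma nb_finite:
  assumes i: "i \<in> dofs X" shows "finite (nb i)"
proof -
  obtain r where r: "0 < r" "\<And>x. x \<in> supp \<psi> i \<inter> \<Omega> \<Longrightarrow> norm x \<le> r" using supp_domain_ball[OF i] by blast 
  have "nb i \<subseteq> {j \<in> dofs X. supp \<psi> j \<inter> cball 0 r \<noteq> {}}"
  proof
    fix j assume "j \<in> nb i"
    then have "j \<in> dofs X" "supp \<psi> j \<inter> supp \<psi> i \<inter> \<Omega> \<noteq> {}" by (auto simp: nbrs_def)
    then show "j \<in> {j \<in> dofs X. supp \<psi> j \<inter> cball 0 r \<noteq> {}}" using r(2) by fastforce
  qed
  then show ?thesis using dofs_meeting_ball_finite finite_subset by blast
qed

text \<open>Only finitely many supports come near the bounded set \<open>S\<^sub>i \<inter> \<Omega>\<close>; those of indices that are not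
  neighbours of \<open>i\<close> meet it in null sets, and they are closed.\<close>

lemma AE_near_neighbours_only:
  assumes i: "i \<in> dofs X"
  shows "AE x in lebesgue. x \<in> supp \<psi> i \<inter> \<Omega> \<longrightarrow>
    (\<exists>U. open U \<and> x \<in> U \<and> (\<forall>y\<in>U. \<forall>j\<in>dofs X - nb i. \<psi> j y = 0))"
proof -
  obtain r where r: "0 < r" "\<And>x. x \<in> supp \<psi> i \<inter> \<Omega> \<Longrightarrow> norm x \<le> r" using supp_domain_ball[OF i] by blast
  define F where "F = {j \<in> dofs X. supp \<psi> j \<inter> cball 0 (r + 1) \<noteq> {}} - nb i"
  have F: "finite F" unfolding F_def using dofs_meeting_ball_finite by simp
  let ?N = "\<Union>j\<in>F. supp \<psi> j \<inter> supp \<psi> i \<inter> \<Omega>"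
  have "supp \<psi> j \<inter> supp \<psi> i \<inter> \<Omega> \<in> null_sets lebesgue" if "j \<in> F" for j
    using that supp_lebesgue(2) by (auto simp: F_def nbrs_def null_sets_def)
  then have "?N \<in> null_sets lebesgue" using F by (intro null_sets.finite_UN)
  then have "AE x in lebesgue. x \<notin> ?N" by (rule AE_not_in)
  then show ?thesis
  proof eventually_elim
    case (elim x)
    show ?case
    proof
      assume x: "x \<in> supp \<psi> i \<inter> \<Omega>"
      let ?U = "ball x 1 - (\<Union>j\<in>F. supp \<psi> j)"
      have "open ?U" using F supp_closed by (intro open_Diff closed_UN) auto
      moreover have "x \<in> ?U" using elim x by auto
      moreover have "\<psi> j y = 0" if y: "y \<in> ?U" and j: "j \<in> dofs X - nb i" for y j
      proof (rule ccontr)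
        assume "\<psi> j y \<noteq> 0"
        then have "y \<in> supp \<psi> j" using psi_zero_off_supp by blast
        moreover have "norm y \<le> r + 1"
          using y r(2)[OF x] norm_triangle_ineq2[of y x] by (simp add: dist_norm norm_minus_commute)
        ultimately have "j \<in> F" using j by (auto simp: F_def)
        then show False using y \<open>y \<in> supp \<psi> j\<close> by blast
      qed
      ultimately show "\<exists>U. open U \<and> x \<in> U \<and> (\<forall>y\<in>U. \<forall>j\<in>dofs X - nb i. \<psi> j y = 0)" by blast
    qed
  qed
qed

lemma fe_fun_cell:
  assumes K: "K \<in> cells X" "l \<in> \<Lambda>" and xh: "xh \<in> Kh K"
  shows "fe_fun \<psi> (dofs X) C (T K xh + l) = (\<Sum>i<nf (refel X K). theta (refel X K) i xh *\<^sub>R C (jdof X i K))"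
proof -
  have "fe_fun \<psi> (dofs X) C (T K xh + l) = (\<Sum>j\<in>cdofs K. dof_local X K j xh *\<^sub>R C j)"
    unfolding fe_fun_def
  proof (rule sum.mono_neutral_cong_left)
    show "finite (cdofs K)" by simp
    show "{j \<in> dofs X. \<psi> j (T K xh + l) \<noteq> 0} \<subseteq> cdofs K"
      using psi_cell[OF _ K(1) xh K(2)] dof_local_other by fastforce
    show "\<forall>j\<in>cdofs K - {j \<in> dofs X. \<psi> j (T K xh + l) \<noteq> 0}. dof_local X K j xh *\<^sub>R C j = 0"
      using psi_cell[OF _ K(1) xh K(2)] cdofs_subset[OF K(1)] by auto
    fix j assume "j \<in> {j \<in> dofs X. \<psi> j (T K xh + l) \<noteq> 0}"
    then show "\<psi> j (T K xh + l) *\<^sub>R C j = dof_local X K j xh *\<^sub>R C j"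
      using psi_cell[OF _ K(1) xh K(2)] by simp
  qed
  then show ?thesis using sum_dof_local[OF K(1)] by simp
qed

lemma fe_fun_one: "fe_fun \<psi> (dofs X) (\<lambda>_. 1::real) x = 1"
proof -
  obtain K xh l where x: "K \<in> cells X" "xh \<in> Kh K" "l \<in> \<Lambda>" "x = T K xh + l" by (rule cover)
  show ?thesis using fe_fun_cell[OF x(1,3,2), of "\<lambda>_. 1::real"] ref_props(6)[OF x(1,2)] x(4) by simp
qed

lemma fe_fun_eq_sum:
  assumes "finite J" "J \<subseteq> dofs X" "\<And>j. j \<in> dofs X - J \<Longrightarrow> \<psi> j y = 0"
  shows "fe_fun \<psi> (dofs X) C y = (\<Sum>j\<in>J. \<psi> j y *\<^sub>R C j)"
  unfolding fe_fun_def using assms by (intro sum.mono_neutral_left) auto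

text \<open>This makes the sum over the neighbours, as in the scheme, equal to the derivative of the full finite
  element function; it is applied to the ALE velocity and to the constant function \<open>1\<close>.\<close>

lemma AE_fe_fun_derivative:
  fixes C :: "'i \<Rightarrow> 'b::euclidean_space"
  assumes i: "i \<in> dofs X"
  shows "AE x in lebesgue. x \<in> supp \<psi> i \<inter> \<Omega> \<longrightarrow>
    (fe_fun \<psi> (dofs X) C has_derivative (\<lambda>v. \<Sum>j\<in>nb i. (grad (\<psi> j) x \<bullet> v) *\<^sub>R C j)) (at x)"
  using AE_off_skeleton AE_near_neighbours_only[OF i]
proof eventually_elim
  case (elim x)
  show ?case
  proof
    assume "x \<in> supp \<psi> i \<inter> \<Omega>"
    then obtain U where U: "open U" "x \<in> U" "\<And>y j. y \<in> U \<Longrightarrow> j \<in> dofs X - nb i \<Longrightarrow> \<psi> j y = 0"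
      using elim(2) by blast
    have "((\<lambda>y. \<Sum>j\<in>nb i. \<psi> j y *\<^sub>R C j) has_derivative (\<lambda>v. \<Sum>j\<in>nb i. (grad (\<psi> j) x \<bullet> v) *\<^sub>R C j)) (at x)"
      by (intro has_derivative_sum has_derivative_scaleR_left psi_has_derivative_grad elim(1)) (use nb_subset in blast)
    then show "(fe_fun \<psi> (dofs X) C has_derivative (\<lambda>v. \<Sum>j\<in>nb i. (grad (\<psi> j) x \<bullet> v) *\<^sub>R C j)) (at x)"
      by (rule has_derivative_transform_within_open[OF _ U(1,2)])
        (rule fe_fun_eq_sum[symmetric, OF nb_finite[OF i] nb_subset U(3)])
  qed
qed

end

section \<open>Integrals of periodic functions\<close>

lemma lebesgue_translation:
  fixes l :: "'a::euclidean_space"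
  shows "(\<lambda>x. x + l) \<in> lebesgue \<rightarrow>\<^sub>M lebesgue" "distr lebesgue lebesgue (\<lambda>x. x + l) = lebesgue"
proof -
  have eq: "(\<lambda>x. l + (\<Sum>j\<in>Basis. (1 * (x \<bullet> j)) *\<^sub>R j)) = (\<lambda>x. x + l)"
    by (simp add: fun_eq_iff euclidean_representation add.commute)
  show m: "(\<lambda>x. x + l) \<in> lebesgue \<rightarrow>\<^sub>M lebesgue"
    using lebesgue_affine_measurable[of "\<lambda>_. 1" l] unfolding eq by simp
  show "distr lebesgue lebesgue (\<lambda>x. x + l) = lebesgue"
    using lebesgue_affine_euclidean[of "\<lambda>_. 1" l] unfolding eq by (simp add: density_1)
qed

lemma integral_translation:
  fixes f :: "'a::euclidean_space \<Rightarrow> 'b::euclidean_space"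
  assumes "f \<in> borel_measurable lebesgue"
  shows "(LINT x|lebesgue. f (x + l)) = (LINT x|lebesgue. f x)"
  using integral_distr[OF lebesgue_translation(1)[of l] assms] by (simp add: lebesgue_translation(2))

lemma integrable_translation:
  fixes f :: "'a::euclidean_space \<Rightarrow> 'b::euclidean_space"
  assumes "integrable lebesgue f"
  shows "integrable lebesgue (\<lambda>x. f (x + l))"
  using assms integrable_distr_eq[OF lebesgue_translation(1)[of l], of f] by (simp add: lebesgue_translation(2))

text \<open>Both integrals are the sum over \<open>l\<close> of the integrals of \<open>g\<close> over the sets \<open>A \<inter> (B - l)\<close>.  The sets need
  to behave like fundamental domains only where \<open>g\<close> does not vanish, so that \<open>A\<close> can be the union of a
  few cells.\<close>

lemma integral_fundamental_domains:
  fixes g :: "'a::euclidean_space \<Rightarrow> 'b::euclidean_space" and \<Lambda> :: "'a set"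
  assumes neg: "\<And>l. l \<in> \<Lambda> \<Longrightarrow> - l \<in> \<Lambda>" and per: "\<And>l x. l \<in> \<Lambda> \<Longrightarrow> g (x + l) = g x"
    and fin: "finite {l \<in> \<Lambda>. \<exists>x\<in>A. x + l \<in> B \<and> g x \<noteq> 0}"
    and A: "A \<in> sets lebesgue" and B: "set_integrable lebesgue B g"
    and uA: "AE x in lebesgue. x \<in> A \<and> g x \<noteq> 0 \<longrightarrow> (\<exists>!l. l \<in> \<Lambda> \<and> x + l \<in> B)"
    and uB: "AE x in lebesgue. x \<in> B \<and> g x \<noteq> 0 \<longrightarrow> (\<exists>!l. l \<in> \<Lambda> \<and> x + l \<in> A)"
  shows "set_integrable lebesgue A g" "(LINT x:A|lebesgue. g x) = (LINT x:B|lebesgue. g x)"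
proof -
  define M where "M = {l \<in> \<Lambda>. \<exists>x\<in>A. x + l \<in> B \<and> g x \<noteq> 0}"
  define h where "h l x = indicat_real A x *\<^sub>R (indicat_real B (x + l) *\<^sub>R g (x + l))" for l x
  have fM: "finite M" using fin by (simp add: M_def)
  have Bi: "integrable lebesgue (\<lambda>x. indicat_real B x *\<^sub>R g x)" using B by (simp add: set_integrable_def)
  have h_int: "integrable lebesgue (h l)" for l
    unfolding h_def using integrable_mult_indicator[OF A integrable_translation[OF Bi, of l]] .
  have one: "(\<Sum>l\<in>M. indicat_real (P l) x) = 1" if P: "\<exists>!l. l \<in> M \<and> x \<in> P l" for P :: "'a \<Rightarrow> 'a set" and x
  proof -
    obtain l where l: "l \<in> M" "x \<in> P l" "\<And>l'. l' \<in> M \<Longrightarrow> x \<in> P l' \<Longrightarrow> l' = l"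
      using P by auto
    have "(\<Sum>l'\<in>M. indicat_real (P l') x) = (\<Sum>l'\<in>M. if l' = l then 1 else 0)"
    proof (rule sum.cong[OF refl])
      show "indicat_real (P l') x = (if l' = l then 1 else 0)" if "l' \<in> M" for l'
        using l(2) l(3)[OF that] by (cases "x \<in> P l'") (auto simp: indicator_def)
    qed
    then show ?thesis using fM l(1) by simp
  qed
  have eqA: "AE x in lebesgue. indicat_real A x *\<^sub>R g x = (\<Sum>l\<in>M. h l x)"
    using uA
  proof eventually_elim
    case (elim x)
    have h: "h l x = indicat_real {y. y + l \<in> B} x *\<^sub>R (indicat_real A x *\<^sub>R g x)" if "l \<in> M" for l
      using that per[of l x] unfolding h_def M_def by (simp add: indicator_def)
    show ?case
    proof (cases "x \<in> A \<and> g x \<noteq> 0")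
      case True
      then obtain l where l: "l \<in> \<Lambda>" "x + l \<in> B" "\<And>l'. l' \<in> \<Lambda> \<Longrightarrow> x + l' \<in> B \<Longrightarrow> l' = l" using elim by auto
      have "\<exists>!l. l \<in> M \<and> x \<in> {y. y + l \<in> B}"
      proof (rule ex1I[of _ l])
        show "l \<in> M \<and> x \<in> {y. y + l \<in> B}" using l(1,2) True by (auto simp: M_def)
        show "l' = l" if "l' \<in> M \<and> x \<in> {y. y + l' \<in> B}" for l'
          by (rule l(3)) (use that in \<open>simp_all add: M_def\<close>)
      qed
      from one[of x "\<lambda>l. {y. y + l \<in> B}", OF this]
      have "indicat_real A x *\<^sub>R g x = (\<Sum>l\<in>M. indicat_real {y. y + l \<in> B} x) *\<^sub>R (indicat_real A x *\<^sub>R g x)"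
        by (simp only: scaleR_one)
      also have "\<dots> = (\<Sum>l\<in>M. h l x)" unfolding scaleR_sum_left by (rule sum.cong) (simp_all only: h)
      finally show ?thesis .
    next
      case False
      then have z: "indicat_real A x *\<^sub>R g x = 0" by auto
      have "(\<Sum>l\<in>M. h l x) = 0" by (rule sum.neutral) (intro ballI, simp only: h z scaleR_zero_right)
      then show ?thesis by (simp only: z)
    qed
  qed
  have sM: "integrable lebesgue (\<lambda>x. \<Sum>l\<in>M. h l x)" using h_int by simp
  have m: "(\<lambda>x. indicat_real A x *\<^sub>R g x) \<in> borel_measurable lebesgue"
    by (rule borel_measurable_AE[OF borel_measurable_integrable[OF sM]]) (use eqA in \<open>eventually_elim, simp\<close>)
  show "set_integrable lebesgue A g"
    unfolding set_integrable_def using integrable_cong_AE[OF m borel_measurable_integrable[OF sM] eqA] sM by simp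
  have eqB: "AE x in lebesgue. indicat_real B x *\<^sub>R g x = (\<Sum>l\<in>M. h l (x + - l))"
    using uB
  proof eventually_elim
    case (elim x)
    have h: "h l (x + - l) = indicat_real {y. y + - l \<in> A} x *\<^sub>R (indicat_real B x *\<^sub>R g x)" if "l \<in> M" for l
      unfolding h_def by (simp add: indicator_def)
    show ?case
    proof (cases "x \<in> B \<and> g x \<noteq> 0")
      case True
      then obtain l where l: "l \<in> \<Lambda>" "x + l \<in> A" "\<And>l'. l' \<in> \<Lambda> \<Longrightarrow> x + l' \<in> A \<Longrightarrow> l' = l" using elim by auto
      have "\<exists>!l. l \<in> M \<and> x \<in> {y. y + - l \<in> A}"
      proof (rule ex1I[of _ "- l"])
        have "\<exists>y\<in>A. y + - l \<in> B \<and> g y \<noteq> 0"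
          using l(2) True per[OF l(1), of x] by (intro bexI[of _ "x + l"]) simp_all
        then show "- l \<in> M \<and> x \<in> {y. y + - (- l) \<in> A}" using l(2) neg[OF l(1)] by (simp add: M_def)
        show "l' = - l" if "l' \<in> M \<and> x \<in> {y. y + - l' \<in> A}" for l'
        proof -
          have "- l' = l" by (rule l(3)) (use that neg[of l'] in \<open>simp_all add: M_def\<close>)
          then show ?thesis by (metis minus_minus)
        qed
      qed
      from one[of x "\<lambda>l. {y. y + - l \<in> A}", OF this]
      have "indicat_real B x *\<^sub>R g x = (\<Sum>l\<in>M. indicat_real {y. y + - l \<in> A} x) *\<^sub>R (indicat_real B x *\<^sub>R g x)"
        by (simp only: scaleR_one)
      also have "\<dots> = (\<Sum>l\<in>M. h l (x + - l))" unfolding scaleR_sum_left by (rule sum.cong) (simp_all only: h)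
      finally show ?thesis .
    next
      case False
      then have z: "indicat_real B x *\<^sub>R g x = 0" by auto
      have "(\<Sum>l\<in>M. h l (x + - l)) = 0" by (rule sum.neutral) (intro ballI, simp only: h z scaleR_zero_right)
      then show ?thesis by (simp only: z)
    qed
  qed
  have "(LINT x|lebesgue. indicat_real A x *\<^sub>R g x) = (LINT x|lebesgue. (\<Sum>l\<in>M. h l x))"
    by (rule integral_cong_AE[OF m borel_measurable_integrable[OF sM] eqA])
  also have "\<dots> = (\<Sum>l\<in>M. (LINT x|lebesgue. h l x))" using h_int by simp
  also have "\<dots> = (\<Sum>l\<in>M. (LINT x|lebesgue. h l (x + - l)))"
    by (rule sum.cong[OF refl]) (rule integral_translation[symmetric, OF borel_measurable_integrable[OF h_int]])
  also have "\<dots> = (LINT x|lebesgue. (\<Sum>l\<in>M. h l (x + - l)))"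
    by (rule Bochner_Integration.integral_sum[symmetric]) (rule integrable_translation[OF h_int])
  also have "\<dots> = (LINT x|lebesgue. indicat_real B x *\<^sub>R g x)"
    by (rule integral_cong_AE[symmetric, OF borel_measurable_integrable[OF Bi] _ eqB])
      (intro borel_measurable_sum borel_measurable_integrable integrable_translation h_int)
  finally show "(LINT x:A|lebesgue. g x) = (LINT x:B|lebesgue. g x)" by (simp add: set_lebesgue_integral_def)
qed

text \<open>A real-valued \<open>f\<close> is read as a function into \<open>\<real>\<^sup>1\<close>, for which the formula is the vector-valued one.\<close>

lemma change_of_variables_real:
  fixes f :: "real^'n::{finite,wellorder} \<Rightarrow> real" and g :: "real^'n::_ \<Rightarrow> real^'n::_"
  assumes S: "S \<in> sets lebesgue" and g': "\<And>x. x \<in> S \<Longrightarrow> (g has_derivative g' x) (at x within S)" and inj: "inj_on g S"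
    and f: "set_integrable lebesgue (g ` S) f"
  shows "set_integrable lebesgue S (\<lambda>x. \<bar>det (matrix (g' x))\<bar> * f (g x))"
    "(LINT x:S|lebesgue. \<bar>det (matrix (g' x))\<bar> * f (g x)) = (LINT x:g ` S|lebesgue. f x)"
proof -
  let ?F = "\<lambda>x. axis 1 (f x) :: real^1"
  have ax: "bounded_linear (\<lambda>r. axis 1 r :: real^1)"
    by (rule bounded_linear_intro[of _ 1]) (auto simp: axis_def vec_eq_iff norm_vec_def L2_set_def)
  have F: "set_integrable lebesgue (g ` S) ?F"
  proof -
    have "axis 1 (indicat_real (g ` S) x *\<^sub>R f x) = indicat_real (g ` S) x *\<^sub>R ?F x" for x
      by (simp add: axis_def vec_eq_iff indicator_def)
    then show ?thesis
      using integrable_bounded_linear[OF ax f[unfolded set_integrable_def]] by (simp only: set_integrable_def)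
  qed
  have *: "set_integrable lebesgue S (\<lambda>x. \<bar>det (matrix (g' x))\<bar> *\<^sub>R ?F (g x)) \<and>
      integral S (\<lambda>x. \<bar>det (matrix (g' x))\<bar> *\<^sub>R ?F (g x)) = integral (g ` S) ?F"
    using has_absolute_integral_change_of_variables[OF S g' inj, of ?F "integral (g ` S) ?F"] F by blast
  have c: "(axis 1 r :: real^1) $ 1 = r" for r by (simp add: axis_def)
  have i1: "integrable lebesgue (\<lambda>x. indicat_real S x *\<^sub>R (\<bar>det (matrix (g' x))\<bar> *\<^sub>R ?F (g x)))"
    using * by (simp add: set_integrable_def)
  show "set_integrable lebesgue S (\<lambda>x. \<bar>det (matrix (g' x))\<bar> * f (g x))"
    using integrable_bounded_linear[OF bounded_linear_vec_nth i1, of 1] by (simp add: set_integrable_def c mult.assoc)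
  have i2: "integrable lebesgue (\<lambda>x. indicat_real (g ` S) x *\<^sub>R ?F x)" using F by (simp add: set_integrable_def)
  have "(LINT x:S|lebesgue. \<bar>det (matrix (g' x))\<bar> *\<^sub>R ?F (g x)) = (LINT x:g ` S|lebesgue. ?F x)"
    using * set_lebesgue_integral_eq_integral(2)[OF conjunct1[OF *]] set_lebesgue_integral_eq_integral(2)[OF F] by simp
  then have "(LINT x:S|lebesgue. \<bar>det (matrix (g' x))\<bar> *\<^sub>R ?F (g x)) $ 1 = (LINT x:g ` S|lebesgue. ?F x) $ 1" by simp
  then show "(LINT x:S|lebesgue. \<bar>det (matrix (g' x))\<bar> * f (g x)) = (LINT x:g ` S|lebesgue. f x)"
    unfolding set_lebesgue_integral_def
    using integral_bounded_linear[OF bounded_linear_vec_nth i1, of 1] integral_bounded_linear[OF bounded_linear_vec_nth i2, of 1]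
    by (simp add: c mult.assoc)
qed

lemma has_derivative_periodic:
  fixes g :: "'a::real_normed_vector \<Rightarrow> 'b::real_normed_vector"
  assumes "\<And>x. g (x + l) = g x"
  shows "(g has_derivative D) (at (x + l)) \<longleftrightarrow> (g has_derivative D) (at x)"
proof -
  have *: "(g has_derivative D) (at x)" if "(g has_derivative D) (at (x + l))" "\<And>x. g (x + l) = g x" for x l
  proof -
    have "((\<lambda>y. y + l) has_derivative (\<lambda>v. v)) (at x)" by (auto intro!: derivative_eq_intros)
    from has_derivative_compose[of "\<lambda>y. y + l" "\<lambda>v. v" x UNIV g D, OF this that(1)]
    have "((\<lambda>y. g (y + l)) has_derivative D) (at x)" .
    then show ?thesis using that(2) by simp
  qed
  have "g (x + - l) = g x" for x using assms[of "x + - l"] by simp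
  then show ?thesis using *[of x l] *[of "x + l" "- l"] assms by auto
qed

lemma divergence_periodic: "(\<And>x. w (x + l) = w x) \<Longrightarrow> divergence w (x + l) = divergence w x"
  unfolding divergence_def frechet_derivative_def by (simp add: has_derivative_periodic)

section \<open>Partition of unity and masses\<close>

context fe_mesh
begin

lemma lattice_ball_finite: "finite {l \<in> \<Lambda>. norm l \<le> \<rho>}"
proof -
  obtain K where K: "K \<in> cells X" by (rule cover)
  obtain x0 where x0: "x0 \<in> cell K 0" using cell_nonempty[OF K] by blast
  have "{l \<in> \<Lambda>. norm l \<le> \<rho>} \<subseteq> snd ` {(K, l). K \<in> cells X \<and> l \<in> \<Lambda> \<and> cball 0 (\<rho> + norm x0) \<inter> cell K l \<noteq> {}}"
  proof
    fix l assume l: "l \<in> {l \<in> \<Lambda>. norm l \<le> \<rho>}"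
    have "x0 + l \<in> cell K l" using x0 by (auto simp: cell_def)
    moreover have "norm (x0 + l) \<le> \<rho> + norm x0" using l norm_triangle_ineq[of x0 l] by simp
    ultimately have "x0 + l \<in> cball 0 (\<rho> + norm x0) \<inter> cell K l" by simp
    then have "(K, l) \<in> {(K, l). K \<in> cells X \<and> l \<in> \<Lambda> \<and> cball 0 (\<rho> + norm x0) \<inter> cell K l \<noteq> {}}"
      using K l by blast
    then show "l \<in> snd ` {(K, l). K \<in> cells X \<and> l \<in> \<Lambda> \<and> cball 0 (\<rho> + norm x0) \<inter> cell K l \<noteq> {}}" by force
  qed
  then show ?thesis using locally_finite finite_surj by blast
qed

lemma fe_fun_periodic: "l \<in> \<Lambda> \<Longrightarrow> fe_fun \<psi> (dofs X) C (x + l) = fe_fun \<psi> (dofs X) C x"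
  unfolding fe_fun_def using psi_periodic by (intro sum.cong) auto

lemma supp_periodic:
  assumes "j \<in> dofs X" "l \<in> \<Lambda>" "x \<in> supp \<psi> j"
  shows "x + l \<in> supp \<psi> j"
proof -
  have "(\<lambda>y. l + y) ` {y. \<psi> j y \<noteq> 0} \<subseteq> {y. \<psi> j y \<noteq> 0}"
    using psi_periodic[OF assms(1,2)] by (auto simp: add.commute)
  then have "(\<lambda>y. l + y) ` closure {y. \<psi> j y \<noteq> 0} \<subseteq> closure {y. \<psi> j y \<noteq> 0}"
    unfolding closure_translation[symmetric] by (rule closure_mono)
  then show ?thesis using assms(3) unfolding supp_def by (auto simp: add.commute)
qed

text \<open>A periodic set is the union of countably many translates of its part in the domain.\<close>

lemma negligible_if_negligible_in_domain:
  assumes S: "\<And>l x. l \<in> \<Lambda> \<Longrightarrow> x \<in> S \<Longrightarrow> x + l \<in> S" and N: "negligible (S \<inter> \<Omega>)"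
  shows "negligible S"
proof (rule negligible_subset)
  show "negligible (\<Union>l\<in>\<Lambda>. (\<lambda>x. l + x) ` (S \<inter> \<Omega>))"
    by (rule negligible_countable_Union) (use lattice_countable negligible_translation[OF N] in auto)
  show "S \<subseteq> (\<Union>l\<in>\<Lambda>. (\<lambda>x. l + x) ` (S \<inter> \<Omega>))"
  proof
    fix x assume x: "x \<in> S"
    obtain l where l: "l \<in> \<Lambda>" "x + l \<in> \<Omega>" using flow_domain_unique_translate[OF bc, of x] by auto
    then have "x + l \<in> S \<inter> \<Omega>" "- l \<in> \<Lambda>" using S[OF l(1) x] lattice_minus[OF l(1)] by auto
    moreover have "x = - l + (x + l)" by simp
    ultimately show "x \<in> (\<Union>l\<in>\<Lambda>. (\<lambda>x. l + x) ` (S \<inter> \<Omega>))" by blast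
  qed
qed

lemma psi_integrable:
  assumes i: "i \<in> dofs X" and f: "f \<in> borel_measurable lebesgue" and b: "\<And>r. \<exists>C. AE x in lebesgue. norm x \<le> r \<longrightarrow> norm (f x) \<le> C"
  shows "integrable lebesgue (\<lambda>x. indicat_real (supp \<psi> i \<inter> \<Omega>) x *\<^sub>R (\<psi> i x *\<^sub>R (f x :: 'b::euclidean_space)))"
proof -
  obtain r where r: "\<And>x. x \<in> supp \<psi> i \<inter> \<Omega> \<Longrightarrow> norm x \<le> r" using supp_domain_ball[OF i] by auto
  obtain C where C: "AE x in lebesgue. norm x \<le> r \<longrightarrow> norm (f x) \<le> C" using b by auto
  have S: "supp \<psi> i \<inter> \<Omega> \<in> lmeasurable"
    using supp_domain_bounded[OF i] supp_lebesgue(3) by (rule bounded_set_imp_lmeasurable)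
  show ?thesis
  proof (rule Bochner_Integration.integrable_bound)
    show "integrable lebesgue (\<lambda>x. indicat_real (supp \<psi> i \<inter> \<Omega>) x * \<bar>C\<bar>)"
      using S by (intro integrable_mult_left integrable_real_indicator) (auto simp: fmeasurable_def)
    show "(\<lambda>x. indicat_real (supp \<psi> i \<inter> \<Omega>) x *\<^sub>R (\<psi> i x *\<^sub>R f x)) \<in> borel_measurable lebesgue"
      using supp_lebesgue(3) f psi_measurable[OF i]
      by (intro borel_measurable_scaleR borel_measurable_indicator)
    show "AE x in lebesgue. norm (indicat_real (supp \<psi> i \<inter> \<Omega>) x *\<^sub>R (\<psi> i x *\<^sub>R f x)) \<le> norm (indicat_real (supp \<psi> i \<inter> \<Omega>) x * \<bar>C\<bar>)"
      using C
    proof eventually_elim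
      case (elim x)
      show ?case
      proof (cases "x \<in> supp \<psi> i \<inter> \<Omega>")
        case True
        then have "\<psi> i x * norm (f x) \<le> 1 * \<bar>C\<bar>"
          using elim r[OF True] psi_le_1[OF i, of x] by (intro mult_mono) auto
        then show ?thesis using True psi_nonneg[OF i, of x] by simp
      qed simp
    qed
  qed
qed

lemma psi_grad_integrable:
  assumes i: "i \<in> dofs X" and j: "j \<in> dofs X"
  shows "integrable lebesgue (\<lambda>x. indicat_real (supp \<psi> i \<inter> \<Omega>) x *\<^sub>R (\<psi> i x *\<^sub>R grad (\<psi> j) x))"
proof (rule psi_integrable[OF i grad_psi_measurable[OF j]])
  fix r
  obtain L where L: "\<And>x. x \<notin> skeleton \<Longrightarrow> norm x \<le> r \<Longrightarrow> norm (grad (\<psi> j) x) \<le> L"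
    using grad_psi_locally_bounded[OF j, of r] by metis
  show "\<exists>C. AE x in lebesgue. norm x \<le> r \<longrightarrow> norm (grad (\<psi> j) x) \<le> C"
    by (rule exI[of _ L]) (use AE_off_skeleton L in \<open>eventually_elim, simp\<close>)
qed

lemma psi_set_integrable:
  assumes i: "i \<in> dofs X" shows "set_integrable lebesgue (supp \<psi> i \<inter> \<Omega>) (\<psi> i)" "set_integrable lebesgue \<Omega> (\<psi> i)"
proof -
  show "set_integrable lebesgue (supp \<psi> i \<inter> \<Omega>) (\<psi> i)"
  proof -
    from psi_integrable[OF i, of "\<lambda>_. 1::real", OF _ exI[of _ 1]] show ?thesis
      by (simp add: set_integrable_def)
  qed
  moreover have "indicat_real (supp \<psi> i \<inter> \<Omega>) x *\<^sub>R \<psi> i x = indicat_real \<Omega> x *\<^sub>R \<psi> i x" for x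
    using psi_zero_off_supp[of x i] by (auto simp: indicator_def)
  ultimately show "set_integrable lebesgue \<Omega> (\<psi> i)" by (simp only: set_integrable_def)
qed

lemma mass_eq: "mass \<Omega> \<psi> i = (LINT x:supp \<psi> i \<inter> \<Omega>|lebesgue. \<psi> i x)"
  unfolding mass_def set_lebesgue_integral_def using psi_zero_off_supp[of _ i]
  by (intro Bochner_Integration.integral_cong) (auto simp: indicator_def)

text \<open>Near almost every point of \<open>S\<^sub>i \<inter> \<Omega>\<close> the neighbours represent the velocity, which gives its divergence,
  and the constant \<open>1\<close>, whose gradient vanishes.\<close>

lemma sum_cvec:
  assumes i: "i \<in> dofs X"
  shows "(\<Sum>j\<in>nb i. W j \<bullet> cvec \<Omega> \<psi> i j) = (LINT x:supp \<psi> i \<inter> \<Omega>|lebesgue. \<psi> i x * divergence (fe_fun \<psi> (dofs X) W) x)"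
    (is ?div) and "(\<Sum>j\<in>nb i. cvec \<Omega> \<psi> i j) = 0" (is ?zero)
    and "set_integrable lebesgue (supp \<psi> i \<inter> \<Omega>) (\<lambda>x. \<psi> i x * divergence (fe_fun \<psi> (dofs X) W) x)" (is ?int)
proof -
  let ?I = "\<lambda>x. indicat_real (supp \<psi> i \<inter> \<Omega>) x"
  have nbd: "j \<in> dofs X" if "j \<in> nb i" for j using that nb_subset by blast
  have int: "integrable lebesgue (\<lambda>x. v \<bullet> (?I x *\<^sub>R (\<psi> i x *\<^sub>R grad (\<psi> j) x)))" if "j \<in> nb i" for j v
    by (rule integrable_inner_right) (rule psi_grad_integrable[OF i nbd[OF that]])
  have val: "(\<Sum>j\<in>nb i. V j \<bullet> cvec \<Omega> \<psi> i j) = (LINT x|lebesgue. (\<Sum>j\<in>nb i. V j \<bullet> (?I x *\<^sub>R (\<psi> i x *\<^sub>R grad (\<psi> j) x))))" for V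
  proof -
    have "V j \<bullet> cvec \<Omega> \<psi> i j = (LINT x|lebesgue. V j \<bullet> (?I x *\<^sub>R (\<psi> i x *\<^sub>R grad (\<psi> j) x)))" if "j \<in> nb i" for j
      unfolding cvec_def set_lebesgue_integral_def
      by (rule integral_inner_right[symmetric]) (rule psi_grad_integrable[OF i nbd[OF that]])
    then show ?thesis using int by simp
  qed
  have sint: "integrable lebesgue (\<lambda>x. \<Sum>j\<in>nb i. V j \<bullet> (?I x *\<^sub>R (\<psi> i x *\<^sub>R grad (\<psi> j) x)))" for V
    using int by simp
  have eq: "AE x in lebesgue. (\<Sum>j\<in>nb i. W j \<bullet> (?I x *\<^sub>R (\<psi> i x *\<^sub>R grad (\<psi> j) x))) = ?I x *\<^sub>R (\<psi> i x * divergence (fe_fun \<psi> (dofs X) W) x)"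
    using AE_fe_fun_derivative[OF i, of W]
  proof eventually_elim
    case (elim x)
    show ?case
    proof (cases "x \<in> supp \<psi> i \<inter> \<Omega>")
      case True
      then have D: "(fe_fun \<psi> (dofs X) W has_derivative (\<lambda>v. \<Sum>j\<in>nb i. (grad (\<psi> j) x \<bullet> v) *\<^sub>R W j)) (at x)" using elim by blast
      have "divergence (fe_fun \<psi> (dofs X) W) x = (\<Sum>k\<in>UNIV. (\<Sum>j\<in>nb i. (grad (\<psi> j) x $ k) *\<^sub>R W j) $ k)"
        unfolding divergence_def frechet_derivative_at[OF D, symmetric] by (simp add: inner_axis)
      also have "\<dots> = (\<Sum>j\<in>nb i. W j \<bullet> grad (\<psi> j) x)"
        by (simp add: sum_component inner_vec_def mult.commute) (rule sum.swap)
      finally show ?thesis using True by (simp add: sum_distrib_left)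
    qed simp
  qed
  have m: "(\<lambda>x. ?I x *\<^sub>R (\<psi> i x * divergence (fe_fun \<psi> (dofs X) W) x)) \<in> borel_measurable lebesgue"
    by (rule borel_measurable_AE[OF borel_measurable_integrable[OF sint[of W]] eq])
  show ?div unfolding val set_lebesgue_integral_def
    by (rule integral_cong_AE[OF borel_measurable_integrable[OF sint] m eq])
  show ?int unfolding set_integrable_def
    using integrable_cong_AE[OF borel_measurable_integrable[OF sint] m eq] sint[of W] by simp
  have eq1: "AE x in lebesgue. (\<Sum>j\<in>nb i. v \<bullet> (?I x *\<^sub>R (\<psi> i x *\<^sub>R grad (\<psi> j) x))) = 0" for v
    using AE_fe_fun_derivative[OF i, of "\<lambda>_. 1::real"]
  proof eventually_elim
    case (elim x)
    show ?case
    proof (cases "x \<in> supp \<psi> i \<inter> \<Omega>")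
      case True
      have "fe_fun \<psi> (dofs X) (\<lambda>_. 1::real) = (\<lambda>_. 1)" using fe_fun_one by (rule ext)
      then have D: "((\<lambda>_. 1::real) has_derivative (\<lambda>v. \<Sum>j\<in>nb i. (grad (\<psi> j) x \<bullet> v) *\<^sub>R 1)) (at x)" using elim True by simp
      have "(\<lambda>v. \<Sum>j\<in>nb i. (grad (\<psi> j) x \<bullet> v) *\<^sub>R (1::real)) = (\<lambda>_. 0)"
        by (rule has_derivative_unique[OF D]) (rule has_derivative_const)
      then have "(\<Sum>j\<in>nb i. v \<bullet> grad (\<psi> j) x) = 0" by (simp add: fun_eq_iff inner_commute)
      then have "\<psi> i x * (\<Sum>j\<in>nb i. v \<bullet> grad (\<psi> j) x) = 0" by simp
      then show ?thesis using True by (simp add: sum_distrib_left)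
    qed simp
  qed
  have "v \<bullet> (\<Sum>j\<in>nb i. cvec \<Omega> \<psi> i j) = 0" for v
    using val[of "\<lambda>_. v"] integral_eq_zero_AE[OF eq1[of v]] by (simp add: inner_sum_right)
  then show ?zero by (metis inner_eq_zero_iff)
qed

text \<open>A reference shape function is not identically zero by linear independence, hence not zero on the dense
  interior.\<close>

lemma psi_nontrivial:
  assumes i: "i \<in> dofs X"
  obtains K xh where "K \<in> cells X" "xh \<in> interior (Kh K)" "dof_local X K i xh \<noteq> 0"
proof -
  obtain K where K: "K \<in> cells X" "i \<in> cdofs K" using dof_in_cell[OF i] by blast
  then obtain q where q: "q < nf (refel X K)" "i = jdof X q K" by auto
  have "\<exists>xh\<in>Kh K. theta (refel X K) q xh \<noteq> 0"
  proof (rule ccontr)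
    assume "\<not> ?thesis"
    then have "(\<Sum>p<nf (refel X K). (if p = q then 1 else 0) * theta (refel X K) p xh) = 0" if "xh \<in> Kh K" for xh
      using that by (intro sum.neutral) auto
    from ref_props(8)[OF K(1), of "\<lambda>p. if p = q then 1 else 0", OF this q(1)] show False by simp
  qed
  then obtain yh where yh: "yh \<in> Kh K" "dof_local X K i yh \<noteq> 0" using dof_local_jdof[OF K(1) q(1)] q(2) by auto
  have cl: "closure (interior (Kh K)) = Kh K"
    using ref_props(1-3)[OF K(1)] convex_closure_interior[of "Kh K"] compact_imp_closed[of "Kh K"] by simp
  obtain h' where "\<And>x. x \<in> Kh K \<Longrightarrow> (dof_local X K i has_derivative blinfun_apply (h' x)) (at x within Kh K)"
    using dof_local_C1[OF K(1), of i] unfolding C1_on_def by blast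
  then have "continuous_on (closure (interior (Kh K))) (dof_local X K i)"
    unfolding cl by (rule has_derivative_continuous_on)
  then have "\<exists>xh\<in>interior (Kh K). dof_local X K i xh \<noteq> 0"
    using continuous_constant_on_closure[of "interior (Kh K)" "dof_local X K i" 0 yh] yh cl by auto
  then show thesis using that[OF K(1)] by blast
qed

lemma psi_nonzero_not_negligible:
  assumes i: "i \<in> dofs X" shows "\<not> negligible ({x. \<psi> i x \<noteq> 0} \<inter> \<Omega>)"
proof
  assume "negligible ({x. \<psi> i x \<noteq> 0} \<inter> \<Omega>)"
  then have "negligible {x. \<psi> i x \<noteq> 0}"
    by (rule negligible_if_negligible_in_domain[rotated]) (simp add: psi_periodic[OF i])
  moreover have "open {x. \<psi> i x \<noteq> 0}"
    by (rule open_Collect_neq[OF psi_continuous[OF i] continuous_on_const])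
  moreover obtain K xh where K: "K \<in> cells X" "xh \<in> interior (Kh K)" "dof_local X K i xh \<noteq> 0"
    by (rule psi_nontrivial[OF i])
  have "\<psi> i (T K xh + 0) \<noteq> 0"
    using psi_cell[OF i K(1) _ lattice_0, of xh] K(2,3) interior_subset[of "Kh K"] by auto
  ultimately show False using open_not_negligible[of "{x. \<psi> i x \<noteq> 0}"] by blast
qed

lemma nb_refl: assumes i: "i \<in> dofs X" shows "i \<in> nb i"
proof -
  have "{x. \<psi> i x \<noteq> 0} \<inter> \<Omega> \<subseteq> supp \<psi> i \<inter> supp \<psi> i \<inter> \<Omega>" using psi_zero_off_supp by auto
  then have "\<not> negligible (supp \<psi> i \<inter> supp \<psi> i \<inter> \<Omega>)"
    using psi_nonzero_not_negligible[OF i] negligible_subset by blast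
  then show ?thesis using i negligible_iff_emeasure0[OF supp_lebesgue(2)[of i i]] by (simp add: nbrs_def)
qed

lemma mass_positive: assumes i: "i \<in> dofs X" shows "0 < mass \<Omega> \<psi> i"
proof -
  let ?f = "\<lambda>x. indicat_real \<Omega> x *\<^sub>R \<psi> i x"
  have int: "integrable lebesgue ?f" using psi_set_integrable(2)[OF i] by (simp add: set_integrable_def)
  have nn: "AE x in lebesgue. 0 \<le> ?f x" using psi_nonneg[OF i] by simp
  have "0 \<le> mass \<Omega> \<psi> i" unfolding mass_def set_lebesgue_integral_def by (rule integral_nonneg_AE[OF nn])
  moreover have "mass \<Omega> \<psi> i \<noteq> 0"
  proof
    assume "mass \<Omega> \<psi> i = 0"
    then have "AE x in lebesgue. ?f x = 0"
      unfolding mass_def set_lebesgue_integral_def using integral_nonneg_eq_0_iff_AE[OF int nn] by simp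
    then have "{x. ?f x \<noteq> 0} \<in> null_sets lebesgue" by (simp add: completion.AE_iff_null_sets)
    moreover have "{x. ?f x \<noteq> 0} = {x. \<psi> i x \<noteq> 0} \<inter> \<Omega>" by (auto simp: indicator_def)
    ultimately show False using psi_nonzero_not_negligible[OF i] by (simp add: negligible_iff_null_sets)
  qed
  ultimately show ?thesis by simp
qed

lemma grad_zero_off_supp:
  assumes "x \<notin> supp \<psi> j" shows "grad (\<psi> j) x = 0"
proof -
  have "(\<psi> j has_derivative (\<lambda>_. 0)) (at x)"
  proof (rule has_derivative_transform_within_open[of "\<lambda>_. 0" "\<lambda>_. 0" x UNIV "- supp \<psi> j"])
    show "open (- supp \<psi> j)" using supp_closed by (simp add: open_Compl)
  qed (use assms psi_zero_off_supp in auto)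
  from grad_of_derivative(2)[OF this] show ?thesis by (simp add: vec_eq_iff)
qed

text \<open>The gradient of \<open>\<psi> j\<close> vanishes off its support, so that only \<open>S\<^sub>i\<^sub>j\<close> contributes.  In extended numbers the
  bound is meaningful whether or not the essential supremum is finite.\<close>

lemma cvec_bound:
  assumes i: "i \<in> dofs X" and j: "j \<in> dofs X"
  shows "ennreal (norm (cvec \<Omega> \<psi> i j)) \<le>
    esssup (lebesgue_on (supp \<psi> i \<inter> supp \<psi> j \<inter> \<Omega>)) (\<lambda>x. ennreal (norm (grad (\<psi> j) x))) * ennreal (overlap_mass \<Omega> \<psi> i j)"
proof -
  let ?S = "supp \<psi> i \<inter> supp \<psi> j \<inter> \<Omega>"
  define e where "e = esssup (lebesgue_on ?S) (\<lambda>x. ennreal (norm (grad (\<psi> j) x)))"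
  have "AE x in lebesgue_on ?S. ennreal (norm (grad (\<psi> j) x)) \<le> e"
    unfolding e_def by (rule esssup_AE)
  then have e: "AE x in lebesgue. x \<in> ?S \<longrightarrow> ennreal (norm (grad (\<psi> j) x)) \<le> e"
    using supp_lebesgue(2) by (subst (asm) AE_restrict_space_iff) auto
  have oint: "integrable lebesgue (\<lambda>x. indicat_real ?S x *\<^sub>R \<psi> i x)"
    using set_integrable_subset[OF psi_set_integrable(1)[OF i] supp_lebesgue(2)[of i j]] by (auto simp: set_integrable_def)
  have "ennreal (norm (cvec \<Omega> \<psi> i j)) \<le> (\<integral>\<^sup>+x. norm (indicat_real (supp \<psi> i \<inter> \<Omega>) x *\<^sub>R (\<psi> i x *\<^sub>R grad (\<psi> j) x)) \<partial>lebesgue)"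
    unfolding cvec_def set_lebesgue_integral_def by (rule integral_norm_bound_ennreal[OF psi_grad_integrable[OF i j]])
  also have "\<dots> \<le> (\<integral>\<^sup>+x. e * ennreal (indicat_real ?S x *\<^sub>R \<psi> i x) \<partial>lebesgue)"
  proof (rule nn_integral_mono_AE)
    show "AE x in lebesgue. ennreal (norm (indicat_real (supp \<psi> i \<inter> \<Omega>) x *\<^sub>R (\<psi> i x *\<^sub>R grad (\<psi> j) x))) \<le> e * ennreal (indicat_real ?S x *\<^sub>R \<psi> i x)"
      using e
    proof eventually_elim
      case (elim x)
      show ?case
      proof (cases "x \<in> ?S")
        case True
        have "ennreal (\<psi> i x * norm (grad (\<psi> j) x)) = ennreal (norm (grad (\<psi> j) x)) * ennreal (\<psi> i x)"
          using psi_nonneg[OF i, of x] by (simp add: ennreal_mult mult.commute)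
        also have "\<dots> \<le> e * ennreal (\<psi> i x)" using elim True by (intro mult_right_mono) auto
        finally show ?thesis using True psi_nonneg[OF i, of x] by simp
      next
        case False
        then have "indicat_real (supp \<psi> i \<inter> \<Omega>) x *\<^sub>R (\<psi> i x *\<^sub>R grad (\<psi> j) x) = 0"
          using grad_zero_off_supp[of x j] by (auto simp: indicator_def)
        then show ?thesis by (simp only: norm_zero ennreal_0) simp
      qed
    qed
  qed
  also have "\<dots> = e * (\<integral>\<^sup>+x. ennreal (indicat_real ?S x *\<^sub>R \<psi> i x) \<partial>lebesgue)"
    using borel_measurable_integrable[OF oint] by (intro nn_integral_cmult) auto
  also have "(\<integral>\<^sup>+x. ennreal (indicat_real ?S x *\<^sub>R \<psi> i x) \<partial>lebesgue) = ennreal (overlap_mass \<Omega> \<psi> i j)"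
    unfolding overlap_mass_def set_lebesgue_integral_def
    by (rule nn_integral_eq_integral[OF oint]) (use psi_nonneg[OF i] in simp)
  finally show ?thesis unfolding e_def .
qed
end

section \<open>Integration by parts and the dependence of neighbours on the nodes\<close>

context fe_mesh
begin

text \<open>Provides a ball outside which all difference quotients with steps of length at most \<open>1\<close> vanish on the
  domain.\<close>

lemma shifted_supp_domain_ball:
  assumes i: "i \<in> dofs X"
  shows "\<exists>r>0. \<forall>x v. x \<in> \<Omega> \<longrightarrow> norm v \<le> 1 \<longrightarrow> x + v \<in> supp \<psi> i \<longrightarrow> norm x \<le> r"
proof (cases "bc = Whole_Space")
  case True
  obtain r where r: "0 < r" "\<And>x. x \<in> supp \<psi> i \<inter> \<Omega> \<Longrightarrow> norm x \<le> r" using supp_domain_ball[OF i] by blast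
  have "norm x \<le> r + 1" if "norm v \<le> 1" "x + v \<in> supp \<psi> i" for x v
  proof -
    have "norm (x + v) \<le> r" using r(2)[of "x + v"] that True by simp
    then show ?thesis using that(1) norm_triangle_ineq4[of "x + v" v] by simp
  qed
  then show ?thesis using r(1) by (intro exI[of _ "r + 1"]) simp
next
  case False
  then obtain r where "0 < r" "\<And>x. x \<in> \<Omega> \<Longrightarrow> norm x \<le> r"
    using flow_domain_bounded unfolding bounded_pos by blast
  then show ?thesis by blast
qed

text \<open>Translating the domain by \<open>v\<close> gives another fundamental domain.\<close>

lemma psi_product_shift_integral:
  assumes i: "i \<in> dofs X" and j: "j \<in> dofs X"
  shows "(LINT x:\<Omega>|lebesgue. \<psi> i (x + v) * \<psi> j (x + v)) = (LINT x:\<Omega>|lebesgue. \<psi> i x * \<psi> j x)"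
    and "set_integrable lebesgue \<Omega> (\<lambda>x. \<psi> i (x + v) * \<psi> j (x + v))"
proof -
  let ?g = "\<lambda>x. \<psi> i x * \<psi> j x"
  let ?A = "(\<lambda>x. v + x) ` \<Omega>"
  have memA: "x \<in> ?A \<longleftrightarrow> x + - v \<in> \<Omega>" for x
    by (auto intro: image_eqI[of _ _ "x + - v"])
  have B: "set_integrable lebesgue \<Omega> ?g"
  proof -
    have "integrable lebesgue (\<lambda>x. indicat_real (supp \<psi> i \<inter> \<Omega>) x *\<^sub>R (\<psi> i x *\<^sub>R \<psi> j x))"
      by (rule psi_integrable[OF i psi_measurable[OF j]])
        (rule exI[of _ 1], use psi_nonneg[OF j] psi_le_1[OF j] in simp)
    moreover have "indicat_real (supp \<psi> i \<inter> \<Omega>) x *\<^sub>R (\<psi> i x *\<^sub>R \<psi> j x) = indicat_real \<Omega> x *\<^sub>R ?g x" for x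
      using psi_zero_off_supp[of x i] by (auto simp: indicator_def)
    ultimately show ?thesis by (simp only: set_integrable_def)
  qed
  have A: "?A \<in> sets lebesgue" using lebesgue_sets_translation[OF flow_domain_lebesgue] .
  have uA: "\<exists>!l. l \<in> \<Lambda> \<and> x + l \<in> \<Omega>" for x by (rule flow_domain_unique_translate[OF bc])
  have uB: "\<exists>!l. l \<in> \<Lambda> \<and> x + l \<in> ?A" for x
    using flow_domain_unique_translate[OF bc, of "x + - v"] unfolding memA by (simp add: add.commute add.left_commute)
  have fin: "finite {l \<in> \<Lambda>. \<exists>x\<in>?A. x + l \<in> \<Omega> \<and> ?g x \<noteq> 0}"
  proof (cases "bc = Whole_Space")
    case True then show ?thesis by simp
  next
    case False
    then obtain r where r: "\<And>x. x \<in> \<Omega> \<Longrightarrow> norm x \<le> r" using flow_domain_bounded unfolding bounded_pos by blast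
    have "{l \<in> \<Lambda>. \<exists>x\<in>?A. x + l \<in> \<Omega> \<and> ?g x \<noteq> 0} \<subseteq> {l \<in> \<Lambda>. norm l \<le> r + r + norm v}"
    proof clarify
      fix l y assume l: "l \<in> \<Lambda>" "y \<in> \<Omega>" "v + y + l \<in> \<Omega>"
      have "norm ((v + y + l) - y - v) \<le> norm (v + y + l) + norm y + norm v"
        by (meson add_right_mono norm_triangle_ineq4 order_trans)
      then show "norm l \<le> r + r + norm v" using r[OF l(2)] r[OF l(3)] by simp
    qed
    then show ?thesis using lattice_ball_finite finite_subset by blast
  qed
  have per: "?g (x + l) = ?g x" if "l \<in> \<Lambda>" for l x using psi_periodic[OF i that] psi_periodic[OF j that] by simp
  have sA: "set_integrable lebesgue ?A ?g" and eq: "(LINT x:?A|lebesgue. ?g x) = (LINT x:\<Omega>|lebesgue. ?g x)"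
    by (rule integral_fundamental_domains[OF lattice_minus per fin A B]; use uA uB in simp)+
  have iA: "integrable lebesgue (\<lambda>x. indicat_real ?A x *\<^sub>R ?g x)" using sA by (simp only: set_integrable_def)
  have sh: "indicat_real ?A (x + v) *\<^sub>R ?g (x + v) = indicat_real \<Omega> x *\<^sub>R ?g (x + v)" for x
    using memA[of "x + v"] by (simp add: indicator_def)
  show "set_integrable lebesgue \<Omega> (\<lambda>x. \<psi> i (x + v) * \<psi> j (x + v))"
    using integrable_translation[OF iA, of v] unfolding sh set_integrable_def .
  show "(LINT x:\<Omega>|lebesgue. \<psi> i (x + v) * \<psi> j (x + v)) = (LINT x:\<Omega>|lebesgue. ?g x)"
    using integral_translation[OF borel_measurable_integrable[OF iA], of v] eq
    unfolding sh set_lebesgue_integral_def by simp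
qed

text \<open>Integration by parts: by translation invariance the difference quotients of \<open>\<psi>\<^sub>i \<psi>\<^sub>j\<close> have integral zero
  over the domain.  They converge off the skeleton and are bounded by Lipschitz constants, so that the
  derivative of \<open>\<psi>\<^sub>i \<psi>\<^sub>j\<close> has integral zero as well.\<close>

lemma cvec_antisym:
  assumes i: "i \<in> dofs X" and j: "j \<in> dofs X"
  shows "cvec \<Omega> \<psi> j i = - cvec \<Omega> \<psi> i j"
proof -
  let ?g = "\<lambda>x. \<psi> i x * \<psi> j x"
  have fold: "integrable lebesgue (\<lambda>x. indicat_real \<Omega> x *\<^sub>R (\<psi> p x *\<^sub>R grad (\<psi> q) x))"
    "cvec \<Omega> \<psi> p q = (LINT x|lebesgue. indicat_real \<Omega> x *\<^sub>R (\<psi> p x *\<^sub>R grad (\<psi> q) x))"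
    if "p \<in> dofs X" "q \<in> dofs X" for p q
  proof -
    have "indicat_real (supp \<psi> p \<inter> \<Omega>) x *\<^sub>R (\<psi> p x *\<^sub>R grad (\<psi> q) x) = indicat_real \<Omega> x *\<^sub>R (\<psi> p x *\<^sub>R grad (\<psi> q) x)" for x
      using psi_zero_off_supp[of x p] by (auto simp: indicator_def)
    then show "integrable lebesgue (\<lambda>x. indicat_real \<Omega> x *\<^sub>R (\<psi> p x *\<^sub>R grad (\<psi> q) x))"
      "cvec \<Omega> \<psi> p q = (LINT x|lebesgue. indicat_real \<Omega> x *\<^sub>R (\<psi> p x *\<^sub>R grad (\<psi> q) x))"
      using psi_grad_integrable[OF that] unfolding cvec_def set_lebesgue_integral_def by (simp_all only:)
  qed
  have "(cvec \<Omega> \<psi> i j + cvec \<Omega> \<psi> j i) \<bullet> axis k 1 = 0" for k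
  proof -
    let ?v = "axis k 1 :: (real, 'd) vec"
    let ?D = "\<lambda>x. (\<psi> i x *\<^sub>R grad (\<psi> j) x + \<psi> j x *\<^sub>R grad (\<psi> i) x) \<bullet> ?v"
    let ?q = "\<lambda>n x. real (Suc n) * (?g (x + inverse (real (Suc n)) *\<^sub>R ?v) - ?g x)"
    obtain r where r: "0 < r" "\<And>x v. x \<in> \<Omega> \<Longrightarrow> norm v \<le> 1 \<Longrightarrow> x + v \<in> supp \<psi> i \<Longrightarrow> norm x \<le> r"
      using shifted_supp_domain_ball[OF i] by blast
    obtain Li where Li: "0 \<le> Li" "Li-lipschitz_on (cball 0 (r + 1)) (\<psi> i)" using psi_locally_lipschitz[OF i] by blast
    obtain Lj where Lj: "0 \<le> Lj" "Lj-lipschitz_on (cball 0 (r + 1)) (\<psi> j)" using psi_locally_lipschitz[OF j] by blast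
    have lip: "\<bar>?g x - ?g y\<bar> \<le> (Li + Lj) * norm (x - y)" if "norm x \<le> r + 1" "norm y \<le> r + 1" for x y
    proof -
      have "?g x - ?g y = (\<psi> i x - \<psi> i y) * \<psi> j x + \<psi> i y * (\<psi> j x - \<psi> j y)" by (simp add: algebra_simps)
      also have "\<bar>\<dots>\<bar> \<le> \<bar>\<psi> i x - \<psi> i y\<bar> * \<bar>\<psi> j x\<bar> + \<bar>\<psi> i y\<bar> * \<bar>\<psi> j x - \<psi> j y\<bar>"
        using abs_triangle_ineq[of "(\<psi> i x - \<psi> i y) * \<psi> j x" "\<psi> i y * (\<psi> j x - \<psi> j y)"] by (simp only: abs_mult)
      also have "\<dots> \<le> (Li * norm (x - y)) * 1 + 1 * (Lj * norm (x - y))"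
        using lipschitz_onD[OF Li(2), of x y] lipschitz_onD[OF Lj(2), of x y] that Li(1)
          psi_nonneg[OF j, of x] psi_le_1[OF j, of x] psi_nonneg[OF i, of y] psi_le_1[OF i, of y]
        by (intro add_mono mult_mono) (simp_all add: dist_norm)
      finally show ?thesis by (simp add: algebra_simps)
    qed
    have qint: "integrable lebesgue (\<lambda>x. indicat_real \<Omega> x *\<^sub>R ?q n x)" "(LINT x|lebesgue. indicat_real \<Omega> x *\<^sub>R ?q n x) = 0" for n
    proof -
      let ?w = "inverse (real (Suc n)) *\<^sub>R ?v"
      have s: "integrable lebesgue (\<lambda>x. indicat_real \<Omega> x *\<^sub>R ?g (x + ?w))" "integrable lebesgue (\<lambda>x. indicat_real \<Omega> x *\<^sub>R ?g x)"
        using psi_product_shift_integral(2)[OF i j, of ?w] psi_product_shift_integral(2)[OF i j, of 0]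
        unfolding set_integrable_def by simp_all
      have e: "indicat_real \<Omega> x *\<^sub>R ?q n x = real (Suc n) * (indicat_real \<Omega> x *\<^sub>R ?g (x + ?w) - indicat_real \<Omega> x *\<^sub>R ?g x)" for x
        by (simp add: algebra_simps)
      show "integrable lebesgue (\<lambda>x. indicat_real \<Omega> x *\<^sub>R ?q n x)"
        unfolding e by (intro integrable_mult_right Bochner_Integration.integrable_diff s)
      have "(LINT x|lebesgue. indicat_real \<Omega> x *\<^sub>R ?g (x + ?w) - indicat_real \<Omega> x *\<^sub>R ?g x) = 0"
        using psi_product_shift_integral(1)[OF i j, of ?w] unfolding set_lebesgue_integral_def
        by (subst Bochner_Integration.integral_diff[OF s]) simp
      then show "(LINT x|lebesgue. indicat_real \<Omega> x *\<^sub>R ?q n x) = 0" unfolding e integral_mult_right_zero by simp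
    qed
    have Dint: "integrable lebesgue (\<lambda>x. indicat_real \<Omega> x *\<^sub>R ?D x)"
      "(LINT x|lebesgue. indicat_real \<Omega> x *\<^sub>R ?D x) = (cvec \<Omega> \<psi> i j + cvec \<Omega> \<psi> j i) \<bullet> ?v"
    proof -
      have e: "indicat_real \<Omega> x *\<^sub>R ?D x = (indicat_real \<Omega> x *\<^sub>R (\<psi> i x *\<^sub>R grad (\<psi> j) x) + indicat_real \<Omega> x *\<^sub>R (\<psi> j x *\<^sub>R grad (\<psi> i) x)) \<bullet> ?v" for x
        by (simp add: inner_add_left distrib_left)
      note s = Bochner_Integration.integrable_add[OF fold(1)[OF i j] fold(1)[OF j i]]
      show "integrable lebesgue (\<lambda>x. indicat_real \<Omega> x *\<^sub>R ?D x)" unfolding e by (rule integrable_inner_left) (rule s)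
      show "(LINT x|lebesgue. indicat_real \<Omega> x *\<^sub>R ?D x) = (cvec \<Omega> \<psi> i j + cvec \<Omega> \<psi> j i) \<bullet> ?v"
        unfolding e fold(2)[OF i j] fold(2)[OF j i] Bochner_Integration.integral_add[OF fold(1)[OF i j] fold(1)[OF j i], symmetric]
        by (rule integral_inner_left) (rule s)
    qed
    have "(\<lambda>n. LINT x|lebesgue. indicat_real \<Omega> x *\<^sub>R ?q n x) \<longlonglongrightarrow> (LINT x|lebesgue. indicat_real \<Omega> x *\<^sub>R ?D x)"
    proof (rule integral_dominated_convergence[where w = "\<lambda>x. indicat_real (cball 0 r) x * (Li + Lj)"])
      show "(\<lambda>x. indicat_real \<Omega> x *\<^sub>R ?D x) \<in> borel_measurable lebesgue" using Dint(1) by (rule borel_measurable_integrable)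
      show "(\<lambda>x. indicat_real \<Omega> x *\<^sub>R ?q n x) \<in> borel_measurable lebesgue" for n using qint(1) by (rule borel_measurable_integrable)
      show "integrable lebesgue (\<lambda>x::(real, 'd) vec. indicat_real (cball 0 r) x * (Li + Lj))"
        by (intro integrable_mult_left integrable_real_indicator) (use lmeasurable_cball[of "0 :: (real, 'd) vec" r] in \<open>auto simp: fmeasurable_def\<close>)
      show "AE x in lebesgue. (\<lambda>n. indicat_real \<Omega> x *\<^sub>R ?q n x) \<longlonglongrightarrow> indicat_real \<Omega> x *\<^sub>R ?D x"
        using AE_off_skeleton
      proof eventually_elim
        case (elim x)
        have "(?g has_derivative (\<lambda>v. \<psi> i x * (grad (\<psi> j) x \<bullet> v) + (grad (\<psi> i) x \<bullet> v) * \<psi> j x)) (at x)"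
          by (rule has_derivative_mult[OF psi_has_derivative_grad[OF i elim] psi_has_derivative_grad[OF j elim]])
        from difference_quotient_tendsto[OF this, of ?v]
        have "(\<lambda>n. ?q n x) \<longlonglongrightarrow> ?D x" by (simp add: inner_add_left mult.commute)
        then show ?case by (intro tendsto_intros)
      qed
      show "AE x in lebesgue. norm (indicat_real \<Omega> x *\<^sub>R ?q n x) \<le> indicat_real (cball 0 r) x * (Li + Lj)" for n
      proof (rule AE_I2)
        fix x
        define z where "z = x + inverse (real (Suc n)) *\<^sub>R ?v"
        have w1: "norm (inverse (real (Suc n)) *\<^sub>R ?v) \<le> 1" by (simp add: inverse_le_1_iff)
        have zx: "norm (z - x) = inverse (real (Suc n))" by (simp add: z_def)
        show "norm (indicat_real \<Omega> x *\<^sub>R ?q n x) \<le> indicat_real (cball 0 r) x * (Li + Lj)"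
        proof (cases "x \<in> \<Omega> \<and> norm x \<le> r")
          case True
          have "norm z \<le> r + 1" using True w1 norm_triangle_ineq[of x "inverse (real (Suc n)) *\<^sub>R ?v"] unfolding z_def by linarith
          then have "\<bar>?g z - ?g x\<bar> \<le> (Li + Lj) * inverse (real (Suc n))" using lip[of z x] True unfolding zx by simp
          then have "real (Suc n) * \<bar>?g z - ?g x\<bar> \<le> real (Suc n) * ((Li + Lj) * inverse (real (Suc n)))"
            by (rule mult_left_mono) simp
          also have "\<dots> = Li + Lj" by simp
          finally have "\<bar>?q n x\<bar> \<le> Li + Lj" unfolding abs_mult z_def by simp
          then show ?thesis using True by simp
        next
          case False
          have "indicat_real \<Omega> x *\<^sub>R ?q n x = 0"
          proof (cases "x \<in> \<Omega>")
            case xO: True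
            then have n: "\<not> norm x \<le> r" using False by simp
            have "z \<notin> supp \<psi> i" using r(2)[OF xO w1] n unfolding z_def by blast
            moreover have "x \<notin> supp \<psi> i" using r(2)[OF xO, of 0] n by auto
            ultimately have "?g z = 0" "?g x = 0" using psi_zero_off_supp by auto
            then have "?q n x = 0" unfolding z_def by (simp only: diff_self mult_zero_right)
            then show ?thesis by (simp only: scaleR_zero_right)
          qed simp
          then show ?thesis using Li(1) Lj(1) by (simp only: norm_zero) simp
        qed
      qed
    qed
    then show ?thesis unfolding qint(2) Dint(2) by (simp add: LIMSEQ_const_iff)
  qed
  then have "cvec \<Omega> \<psi> i j + cvec \<Omega> \<psi> j i = 0" by (simp add: vec_eq_iff inner_axis)
  then show ?thesis by (simp add: add_eq_0_iff)
qed

text \<open>The support of a shape function, seen in the open reference element.  It involves no nodes, and hence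
  does not change when the mesh moves.\<close>

definition ref_supp :: "'c \<Rightarrow> 'i \<Rightarrow> (real, 'd) vec set" where
  "ref_supp K i = interior (Khat (refel X K)) \<inter> closure {xh \<in> interior (Khat (refel X K)). dof_local X K i xh \<noteq> 0}"

lemma supp_off_skeleton:
  assumes i: "i \<in> dofs X" and K: "K \<in> cells X" "l \<in> \<Lambda>" and xh: "xh \<in> interior (Kh K)" and x: "T K xh + l \<in> supp \<psi> i"
  shows "xh \<in> ref_supp K i"
proof (rule ccontr)
  assume n: "xh \<notin> ref_supp K i"
  let ?Y = "{xh \<in> interior (Kh K). dof_local X K i xh \<noteq> 0}"
  let ?V = "interior (Kh K) - closure ?Y"
  let ?f = "\<lambda>xh. T K xh + l"
  have "xh \<in> ?V" using n xh by (simp add: ref_supp_def)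
  have VK: "?V \<subseteq> Kh K" using interior_subset by auto
  have "open (?f ` ?V)"
  proof (rule invariance_of_domain)
    show "continuous_on ?V ?f" by (intro continuous_intros continuous_on_subset[OF T_continuous[OF K(1)] VK])
    show "open ?V" by (rule open_Diff) auto
    show "inj_on ?f ?V" using inj_on_subset[OF T_inj[OF K(1)] VK] by (simp add: inj_on_def)
  qed
  moreover have "?f ` ?V \<inter> {y. \<psi> i y \<noteq> 0} = {}"
  proof -
    have "\<psi> i (?f yh) = 0" if "yh \<in> ?V" for yh
    proof -
      have "yh \<in> Kh K" "yh \<notin> ?Y" using that VK closure_subset[of ?Y] by auto
      then show ?thesis using psi_cell[OF i K(1) _ K(2), of yh] that by auto
    qed
    then show ?thesis by auto
  qed
  ultimately have "?f ` ?V \<inter> closure {y. \<psi> i y \<noteq> 0} = {}" using open_Int_closure_eq_empty by blast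
  moreover have "?f xh \<in> ?f ` ?V" using \<open>xh \<in> ?V\<close> by (rule imageI)
  ultimately show False using x unfolding supp_def by blast
qed

lemma ref_supp_in_supp:
  assumes i: "i \<in> dofs X" and K: "K \<in> cells X" and xh: "xh \<in> ref_supp K i"
  shows "T K xh \<in> supp \<psi> i"
proof -
  let ?Y = "{xh \<in> interior (Kh K). dof_local X K i xh \<noteq> 0}"
  have YK: "?Y \<subseteq> Kh K" using interior_subset by auto
  then have cY: "closure ?Y \<subseteq> Kh K" using compact_imp_closed[OF ref_props(1)[OF K]] by (rule closure_minimal)
  have "T K ` closure ?Y \<subseteq> supp \<psi> i"
  proof (rule image_closure_subset)
    show "continuous_on (closure ?Y) (T K)" by (rule continuous_on_subset[OF T_continuous[OF K] cY])
    show "closed (supp \<psi> i)" by (rule supp_closed)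
    have "\<psi> i (T K yh) \<noteq> 0" if "yh \<in> ?Y" for yh
      using psi_cell[OF i K _ lattice_0, of yh] that YK by auto
    then show "T K ` ?Y \<subseteq> supp \<psi> i" using psi_zero_off_supp by auto
  qed
  then show ?thesis using xh unfolding ref_supp_def by blast
qed

text \<open>Geometric maps and their inverses are differentiable and preserve null sets.\<close>

lemma nb_iff_ref_supp:
  assumes i: "i \<in> dofs X" and j: "j \<in> dofs X"
  shows "j \<in> nb i \<longleftrightarrow> (\<exists>K\<in>cells X. \<not> negligible (ref_supp K i \<inter> ref_supp K j))"
proof -
  let ?S = "supp \<psi> j \<inter> supp \<psi> i"
  have nb: "j \<in> nb i \<longleftrightarrow> \<not> negligible (?S \<inter> \<Omega>)"
    using j negligible_iff_emeasure0[OF supp_lebesgue(2)[of j i]] by (simp add: nbrs_def)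
  have sub: "ref_supp K i \<inter> ref_supp K j \<subseteq> Kh K" for K using interior_subset by (auto simp: ref_supp_def)
  show ?thesis
  proof
    assume "j \<in> nb i"
    show "\<exists>K\<in>cells X. \<not> negligible (ref_supp K i \<inter> ref_supp K j)"
    proof (rule ccontr)
      assume "\<not> ?thesis"
      then have N: "negligible (ref_supp K i \<inter> ref_supp K j)" if "K \<in> cells X" for K using that by blast
      have "negligible (\<Union>((\<lambda>(K, l). (\<lambda>xh. T K xh + l) ` (ref_supp K i \<inter> ref_supp K j)) ` (cells X \<times> \<Lambda>)))"
      proof (rule negligible_countable_Union)
        fix Q assume "Q \<in> (\<lambda>(K, l). (\<lambda>xh. T K xh + l) ` (ref_supp K i \<inter> ref_supp K j)) ` (cells X \<times> \<Lambda>)"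
        then obtain K l where Q: "K \<in> cells X" "Q = (\<lambda>xh. T K xh + l) ` (ref_supp K i \<inter> ref_supp K j)" by auto
        have "(\<lambda>xh. T K xh + l) differentiable_on (ref_supp K i \<inter> ref_supp K j)"
          by (intro differentiable_on_add differentiable_on_const differentiable_on_subset[OF T_differentiable[OF Q(1)] sub])
        then show "negligible Q" unfolding Q(2)
          by (intro negligible_differentiable_image_negligible N[OF Q(1)]) auto
      qed (intro countable_image cells_countable)
      then have "negligible (skeleton \<union> (\<Union>((\<lambda>(K, l). (\<lambda>xh. T K xh + l) ` (ref_supp K i \<inter> ref_supp K j)) ` (cells X \<times> \<Lambda>))))"
        using skeleton_negligible by (rule negligible_Un[rotated])
      moreover have "?S \<inter> \<Omega> \<subseteq> skeleton \<union> (\<Union>((\<lambda>(K, l). (\<lambda>xh. T K xh + l) ` (ref_supp K i \<inter> ref_supp K j)) ` (cells X \<times> \<Lambda>)))"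
      proof
        fix x assume x: "x \<in> ?S \<inter> \<Omega>"
        show "x \<in> skeleton \<union> (\<Union>((\<lambda>(K, l). (\<lambda>xh. T K xh + l) ` (ref_supp K i \<inter> ref_supp K j)) ` (cells X \<times> \<Lambda>)))"
        proof (cases "x \<in> skeleton")
          case False
          then obtain K xh l where K: "K \<in> cells X" "l \<in> \<Lambda>" "xh \<in> interior (Kh K)" "x = T K xh + l" by (rule off_skeleton)
          have "xh \<in> ref_supp K i" "xh \<in> ref_supp K j"
            using supp_off_skeleton[OF i K(1-3)] supp_off_skeleton[OF j K(1-3)] x K(4) by auto
          then show ?thesis using K by force
        qed simp
      qed
      ultimately show False using \<open>j \<in> nb i\<close> nb negligible_subset by blast
    qed
  next
    assume "\<exists>K\<in>cells X. \<not> negligible (ref_supp K i \<inter> ref_supp K j)"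
    then obtain K where K: "K \<in> cells X" and nn: "\<not> negligible (ref_supp K i \<inter> ref_supp K j)" by blast
    let ?R = "ref_supp K i \<inter> ref_supp K j"
    obtain k k' where k: "\<And>x. x \<in> Kh K \<Longrightarrow> (k has_derivative k' x) (at (T K x) within T K ` Kh K)"
      and kT: "\<And>x. x \<in> Kh K \<Longrightarrow> k (T K x) = x"
      by (rule diffeo[OF K]) (rule that; assumption)
    show "j \<in> nb i"
    proof (rule ccontr)
      assume "j \<notin> nb i"
      then have "negligible (?S \<inter> \<Omega>)" using nb by blast
      then have "negligible ?S"
        by (rule negligible_if_negligible_in_domain[rotated]) (use supp_periodic[OF i] supp_periodic[OF j] in auto)
      moreover have "T K ` ?R \<subseteq> ?S" using ref_supp_in_supp[OF i K] ref_supp_in_supp[OF j K] by auto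
      ultimately have "negligible (T K ` ?R)" by (rule negligible_subset)
      moreover have "k differentiable_on (T K ` Kh K)"
        unfolding differentiable_on_def differentiable_def using k by blast
      then have "k differentiable_on (T K ` ?R)" by (rule differentiable_on_subset) (use sub in auto)
      ultimately have "negligible (k ` T K ` ?R)"
        using negligible_differentiable_image_negligible[OF order_refl, of "T K ` ?R" k] by blast
      moreover have "k ` T K ` ?R = ?R"
      proof -
        have "k (T K x) = x" if "x \<in> ?R" for x using kT sub that by blast
        then show ?thesis unfolding image_image by simp
      qed
      ultimately show False using nn by simp
    qed
  qed
qed

end

section \<open>Pull-back of integrals to the reference elements\<close>

text \<open>The derivative of the geometric map.  It is affine in the nodes, which makes the Jacobian determinant of a
  mesh with uniformly moving nodes polynomial in time.\<close>

definition geo_deriv ::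
  "('c, 'g, 'i, 'd::finite) mesh_data \<Rightarrow> ('g \<Rightarrow> real^'d) \<Rightarrow> 'c \<Rightarrow> real^'d \<Rightarrow> real^'d \<Rightarrow> real^'d" where
  "geo_deriv X a K xh v = (\<Sum>i<nf_geo (refel X K).
     frechet_derivative (theta_geo (refel X K) i) (at xh) v *\<^sub>R (a (jgeo X i K) + shift X i K))"

definition vel_deriv ::
  "('c, 'g, 'i, 'd::finite) mesh_data \<Rightarrow> ('g \<Rightarrow> real^'d) \<Rightarrow> 'c \<Rightarrow> real^'d \<Rightarrow> real^'d \<Rightarrow> real^'d" where
  "vel_deriv X w K xh v = (\<Sum>i<nf_geo (refel X K).
     frechet_derivative (theta_geo (refel X K) i) (at xh) v *\<^sub>R w (jgeo X i K))"

context fe_mesh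
begin

lemma theta_geo_derivative:
  assumes K: "K \<in> cells X" and xh: "xh \<in> interior (Kh K)" and i: "i < nf_geo (refel X K)"
  shows "(theta_geo (refel X K) i has_derivative frechet_derivative (theta_geo (refel X K) i) (at xh)) (at xh)"
proof -
  obtain h where "\<And>x. x \<in> Kh K \<Longrightarrow> (theta_geo (refel X K) i has_derivative blinfun_apply (h x)) (at x within Kh K)"
    using ref_props(7)[OF K i] unfolding C1_on_def by blast
  then have "(theta_geo (refel X K) i has_derivative blinfun_apply (h xh)) (at xh within Kh K)"
    using xh interior_subset[of "Kh K"] by (simp add: subset_eq)
  then have "(theta_geo (refel X K) i has_derivative blinfun_apply (h xh)) (at xh)"
    by (simp add: at_within_interior[OF xh])
  then have "theta_geo (refel X K) i differentiable (at xh)" by (auto simp: differentiable_def)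
  then show ?thesis by (simp add: frechet_derivative_works)
qed

lemma T_has_derivative:
  assumes K: "K \<in> cells X" and xh: "xh \<in> interior (Kh K)"
  shows "(T K has_derivative geo_deriv X a K xh) (at xh)"
  unfolding geo_map_def[abs_def] geo_deriv_def[abs_def]
  by (intro has_derivative_sum has_derivative_scaleR_left theta_geo_derivative[OF K xh]) simp

lemma velocity_has_derivative:
  assumes K: "K \<in> cells X" and xh: "xh \<in> interior (Kh K)"
  shows "((\<lambda>yh. \<Sum>i<nf_geo (refel X K). theta_geo (refel X K) i yh *\<^sub>R w (jgeo X i K)) has_derivative vel_deriv X w K xh) (at xh)"
  unfolding vel_deriv_def[abs_def]
  by (intro has_derivative_sum has_derivative_scaleR_left theta_geo_derivative[OF K xh]) simp

text \<open>By the chain rule the derivative of the velocity is that of its pull-back times the inverse \<open>D\<close> of the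
  derivative of the geometric map.  The pull-back is the same function of the reference point at all
  times.\<close>

lemma divergence_reference:
  assumes K: "K \<in> cells X" and xh: "xh \<in> interior (Kh K)"
  obtains D where "D ** matrix (geo_deriv X a K xh) = mat 1"
    "\<And>(W :: 'i \<Rightarrow> (real, 'd) vec) w. (\<And>yh. yh \<in> Kh K \<Longrightarrow> (\<Sum>i<nf (refel X K). theta (refel X K) i yh *\<^sub>R W (jdof X i K)) =
        (\<Sum>i<nf_geo (refel X K). theta_geo (refel X K) i yh *\<^sub>R w (jgeo X i K))) \<Longrightarrow>
      divergence (fe_fun \<psi> (dofs X) W) (T K xh) = trace (matrix (vel_deriv X w K xh) ** D)"
proof -
  have xK: "xh \<in> Kh K" using xh interior_subset by blast
  obtain k k' where k: "\<And>x. x \<in> Kh K \<Longrightarrow> (k has_derivative k' x) (at (T K x) within T K ` Kh K)"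
    and kT: "\<And>x. x \<in> Kh K \<Longrightarrow> k (T K x) = x"
    by (rule diffeo[OF K]) (rule that; assumption)
  have "open_cell K 0 \<subseteq> T K ` Kh K" using open_cell_subset[of K 0] by (simp add: cell_def)
  moreover have xo: "T K xh \<in> open_cell K 0" using xh by (simp add: open_cell_def)
  ultimately have "at (T K xh) within T K ` Kh K = at (T K xh)"
    using open_cell_open[OF K] by (meson at_within_interior interior_maximal subsetD)
  then have kx: "(k has_derivative k' xh) (at (T K xh))" using k[OF xK] by simp
  note Td = T_has_derivative[OF K xh]
  have "((\<lambda>y. k (T K y)) has_derivative (\<lambda>v. k' xh (geo_deriv X a K xh v))) (at xh)"
    by (rule has_derivative_compose[OF Td kx])
  moreover have "((\<lambda>y. k (T K y)) has_derivative (\<lambda>v. v)) (at xh)"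
    by (rule has_derivative_transform_within_open[OF has_derivative_ident open_interior xh])
      (use kT interior_subset[of "Kh K"] in \<open>simp add: subset_eq\<close>)
  ultimately have id: "(\<lambda>v. k' xh (geo_deriv X a K xh v)) = (\<lambda>v. v)" by (rule has_derivative_unique)
  have lk: "linear (k' xh)" and lT: "linear (geo_deriv X a K xh)"
    using kx Td has_derivative_linear by blast+
  have "matrix (k' xh) ** matrix (geo_deriv X a K xh) = matrix (k' xh \<circ> geo_deriv X a K xh)"
    by (rule matrix_compose[OF lT lk, symmetric])
  also have "\<dots> = mat 1" using id by (simp add: comp_def matrix_id_mat_1[unfolded id_def])
  finally have inv: "matrix (k' xh) ** matrix (geo_deriv X a K xh) = mat 1" .
  then have inv': "matrix (geo_deriv X a K xh) ** matrix (k' xh) = mat 1" using matrix_left_right_inverse by blast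
  show thesis
  proof (rule that[OF inv])
    fix W :: "'i \<Rightarrow> (real, 'd) vec" and w
    assume eq: "\<And>yh. yh \<in> Kh K \<Longrightarrow> (\<Sum>i<nf (refel X K). theta (refel X K) i yh *\<^sub>R W (jdof X i K)) =
        (\<Sum>i<nf_geo (refel X K). theta_geo (refel X K) i yh *\<^sub>R w (jgeo X i K))"
    let ?G = "fe_fun \<psi> (dofs X) W"
    have "(\<lambda>y. \<Sum>j\<in>cdofs K. \<psi> j y *\<^sub>R W j) differentiable (at (T K xh))"
      by (intro differentiable_sum differentiable_scaleR differentiable_const ballI)
        (use psi_differentiable_open_cell[OF _ K lattice_0 xo] cdofs_subset[OF K] in auto)
    then obtain E where E: "((\<lambda>y. \<Sum>j\<in>cdofs K. \<psi> j y *\<^sub>R W j) has_derivative E) (at (T K xh))"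
      unfolding differentiable_def by blast
    have D: "(?G has_derivative E) (at (T K xh))"
    proof (rule has_derivative_transform_within_open[OF E open_cell_open[OF K] xo])
      fix y assume "y \<in> open_cell K 0"
      then obtain yh where y: "yh \<in> Kh K" "y = T K yh + 0" using open_cell_subset[of K 0] by (auto simp: cell_def)
      have "?G y = (\<Sum>j\<in>cdofs K. dof_local X K j yh *\<^sub>R W j)"
        unfolding y(2) fe_fun_cell[OF K lattice_0 y(1)] sum_dof_local[OF K] ..
      also have "\<dots> = (\<Sum>j\<in>cdofs K. \<psi> j y *\<^sub>R W j)"
        by (rule sum.cong[OF refl]) (use psi_cell[OF _ K y(1) lattice_0] cdofs_subset[OF K] y(2) in auto)
      finally show "(\<Sum>j\<in>cdofs K. \<psi> j y *\<^sub>R W j) = ?G y" ..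
    qed
    have "((\<lambda>y. ?G (T K y)) has_derivative (\<lambda>v. E (geo_deriv X a K xh v))) (at xh)"
      by (rule has_derivative_compose[OF Td D])
    moreover have "((\<lambda>y. ?G (T K y)) has_derivative vel_deriv X w K xh) (at xh)"
    proof (rule has_derivative_transform_within_open[OF velocity_has_derivative[OF K xh] open_interior xh])
      fix y assume "y \<in> interior (Kh K)"
      then have y: "y \<in> Kh K" using interior_subset by blast
      show "(\<Sum>i<nf_geo (refel X K). theta_geo (refel X K) i y *\<^sub>R w (jgeo X i K)) = ?G (T K y)"
        using fe_fun_cell[OF K lattice_0 y, of W] eq[OF y] by simp
    qed
    ultimately have "(\<lambda>v. E (geo_deriv X a K xh v)) = vel_deriv X w K xh" by (rule has_derivative_unique)
    then have "E \<circ> geo_deriv X a K xh = vel_deriv X w K xh" by (simp add: comp_def)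
    moreover have lE: "linear E" using D has_derivative_linear by blast
    ultimately have "matrix E ** matrix (geo_deriv X a K xh) = matrix (vel_deriv X w K xh)"
      using matrix_compose[OF lT lE] by simp
    then have "matrix (vel_deriv X w K xh) ** matrix (k' xh) = matrix E"
      using inv' by (metis matrix_mul_assoc matrix_mul_rid)
    moreover have "divergence ?G (T K xh) = trace (matrix E)"
      unfolding divergence_def frechet_derivative_at[OF D, symmetric] by (simp add: trace_def matrix_def)
    ultimately show "divergence ?G (T K xh) = trace (matrix (vel_deriv X w K xh) ** matrix (k' xh))" by simp
  qed
qed

text \<open>For functions that vanish where \<open>\<psi> i\<close> does, the union of the open cells with the index \<open>i\<close> serves as a
  fundamental domain.\<close>

lemma integral_over_reference_cells:
  fixes F :: "(real, 'd) vec \<Rightarrow> real"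
  assumes i: "i \<in> dofs X" and F: "set_integrable lebesgue \<Omega> F" and per: "\<And>l x. l \<in> \<Lambda> \<Longrightarrow> F (x + l) = F x"
    and F0: "\<And>x. \<psi> i x = 0 \<Longrightarrow> F x = 0"
  shows "(LINT x:\<Omega>|lebesgue. F x) = (\<Sum>K | K \<in> cells X \<and> i \<in> cdofs K.
      LINT xh:interior (Kh K)|lebesgue. \<bar>det (matrix (geo_deriv X a K xh))\<bar> * F (T K xh))"
    and "\<And>K. K \<in> cells X \<Longrightarrow> i \<in> cdofs K \<Longrightarrow>
      set_integrable lebesgue (interior (Kh K)) (\<lambda>xh. \<bar>det (matrix (geo_deriv X a K xh))\<bar> * F (T K xh))"
proof -
  let ?C = "{K \<in> cells X. i \<in> cdofs K}"
  let ?A = "\<Union>K\<in>?C. open_cell K 0"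
  have oc: "open_cell K 0 = T K ` interior (Kh K)" for K by (simp add: open_cell_def)
  have fC: "finite ?C" by (rule dof_cells_finite[OF i])
  have oL: "open_cell K 0 \<in> sets lebesgue" if "K \<in> cells X" for K
    using borel_open[OF open_cell_open[OF that]] by (intro sets_completionI_sets) simp
  have A: "?A \<in> sets lebesgue" using fC oL by (intro sets.finite_UN) auto
  have uA: "\<exists>!l. l \<in> \<Lambda> \<and> x + l \<in> \<Omega>" for x by (rule flow_domain_unique_translate[OF bc])
  have uB: "AE x in lebesgue. x \<in> \<Omega> \<and> F x \<noteq> 0 \<longrightarrow> (\<exists>!l. l \<in> \<Lambda> \<and> x + l \<in> ?A)"
    using AE_off_skeleton
  proof eventually_elim
    case (elim x)
    show ?case
    proof
      assume x: "x \<in> \<Omega> \<and> F x \<noteq> 0"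
      obtain K xh l where K: "K \<in> cells X" "l \<in> \<Lambda>" "xh \<in> interior (Kh K)" "x = T K xh + l" "x \<in> open_cell K l"
        by (rule off_skeleton[OF elim])
      have xK: "xh \<in> Kh K" using K(3) interior_subset by blast
      have "\<psi> i x \<noteq> 0" using x F0 by blast
      then have KC: "K \<in> ?C" using psi_cell[OF i K(1) xK K(2)] K(1,4) dof_local_other by auto
      show "\<exists>!l. l \<in> \<Lambda> \<and> x + l \<in> ?A"
      proof (rule ex1I[of _ "- l"])
        have "x + - l \<in> open_cell K 0" using K(3,4) by (auto simp: open_cell_def)
        then show "- l \<in> \<Lambda> \<and> x + - l \<in> ?A" using KC lattice_minus[OF K(2)] by auto
        fix l' assume l': "l' \<in> \<Lambda> \<and> x + l' \<in> ?A"
        then obtain K' yh where K': "K' \<in> cells X" "yh \<in> interior (Kh K')" "x + l' = T K' yh" by (auto simp: open_cell_def)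
        have "x = T K' yh + - l'" using K'(3) by (simp add: algebra_simps)
        then have "x \<in> open_cell K' (- l')" using K'(2) by (auto simp: open_cell_def)
        then have "open_cell K l \<inter> open_cell K' (- l') \<noteq> {}" using K(5) by blast
        then have "l = - l'" using open_cells_disjoint[OF K(1) K'(1) K(2)] lattice_minus l' by blast
        then show "l' = - l" by (metis minus_minus)
      qed
    qed
  qed
  have fin: "finite {l \<in> \<Lambda>. \<exists>x\<in>?A. x + l \<in> \<Omega> \<and> F x \<noteq> 0}"
  proof -
    obtain r where r: "\<And>x. x \<in> supp \<psi> i \<inter> \<Omega> \<Longrightarrow> norm x \<le> r" using supp_domain_ball[OF i] by blast
    have "bounded ?A"
      using fC by (intro bounded_UN ballI) (auto intro: bounded_subset[OF compact_imp_bounded[OF cell_compact] open_cell_subset])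
    then obtain q where q: "\<And>x. x \<in> ?A \<Longrightarrow> norm x \<le> q" unfolding bounded_iff by blast
    have "{l \<in> \<Lambda>. \<exists>x\<in>?A. x + l \<in> \<Omega> \<and> F x \<noteq> 0} \<subseteq> {l \<in> \<Lambda>. norm l \<le> r + q}"
    proof
      fix l assume "l \<in> {l \<in> \<Lambda>. \<exists>x\<in>?A. x + l \<in> \<Omega> \<and> F x \<noteq> 0}"
      then obtain x where x: "l \<in> \<Lambda>" "x \<in> ?A" "x + l \<in> \<Omega>" "F x \<noteq> 0" by blast
      have "\<psi> i (x + l) \<noteq> 0" using F0[of x] x psi_periodic[OF i x(1)] by auto
      then have "x + l \<in> supp \<psi> i" using psi_zero_off_supp by blast
      then have "norm (x + l) \<le> r" using r x(3) by blast
      then show "l \<in> {l \<in> \<Lambda>. norm l \<le> r + q}" using x(1) q[OF x(2)] norm_triangle_ineq4[of "x + l" x] by simp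
    qed
    then show ?thesis using lattice_ball_finite finite_subset by blast
  qed
  have sA: "set_integrable lebesgue ?A F" and eq: "(LINT x:?A|lebesgue. F x) = (LINT x:\<Omega>|lebesgue. F x)"
    by (rule integral_fundamental_domains[OF lattice_minus per fin A F _ uB]; use uA in simp)+
  have sK: "set_integrable lebesgue (open_cell K 0) F" if "K \<in> ?C" for K
    using set_integrable_subset[OF sA, of "open_cell K 0"] oL that by auto
  have cv: "set_integrable lebesgue (interior (Kh K)) (\<lambda>xh. \<bar>det (matrix (geo_deriv X a K xh))\<bar> * F (T K xh))"
    "(LINT xh:interior (Kh K)|lebesgue. \<bar>det (matrix (geo_deriv X a K xh))\<bar> * F (T K xh)) = (LINT x:open_cell K 0|lebesgue. F x)"
    if K: "K \<in> ?C" for K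
  proof -
    have KX: "K \<in> cells X" using K by simp
    have S: "interior (Kh K) \<in> sets lebesgue" using borel_open[OF open_interior] by (intro sets_completionI_sets) simp
    have d: "(T K has_derivative geo_deriv X a K xh) (at xh within interior (Kh K))" if "xh \<in> interior (Kh K)" for xh
      by (rule has_derivative_at_withinI[OF T_has_derivative[OF KX that]])
    have inj: "inj_on (T K) (interior (Kh K))" by (rule inj_on_subset[OF T_inj[OF KX] interior_subset])
    show "set_integrable lebesgue (interior (Kh K)) (\<lambda>xh. \<bar>det (matrix (geo_deriv X a K xh))\<bar> * F (T K xh))"
      "(LINT xh:interior (Kh K)|lebesgue. \<bar>det (matrix (geo_deriv X a K xh))\<bar> * F (T K xh)) = (LINT x:open_cell K 0|lebesgue. F x)"
      unfolding oc by (rule change_of_variables_real[OF S d inj sK[OF K, unfolded oc]]; assumption)+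
  qed
  show "set_integrable lebesgue (interior (Kh K)) (\<lambda>xh. \<bar>det (matrix (geo_deriv X a K xh))\<bar> * F (T K xh))"
    if "K \<in> cells X" "i \<in> cdofs K" for K by (rule cv(1)) (use that in simp)
  have "disjoint_family_on (\<lambda>K. open_cell K 0) ?C"
    unfolding disjoint_family_on_def using open_cells_disjoint[OF _ _ lattice_0 lattice_0] by blast
  then have "(LINT x:?A|lebesgue. F x) = (\<Sum>K\<in>?C. LINT x:open_cell K 0|lebesgue. F x)"
    using fC sK oL by (intro set_integral_finite_Union) auto
  then show "(LINT x:\<Omega>|lebesgue. F x) = (\<Sum>K\<in>?C.
      LINT xh:interior (Kh K)|lebesgue. \<bar>det (matrix (geo_deriv X a K xh))\<bar> * F (T K xh))"
    unfolding eq by (rule trans) (rule sum.cong[OF refl], rule cv(2)[symmetric], assumption)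
qed

lemma mass_reference:
  assumes i: "i \<in> dofs X"
  shows "mass \<Omega> \<psi> i = (\<Sum>K | K \<in> cells X \<and> i \<in> cdofs K.
      LINT xh:interior (Kh K)|lebesgue. \<bar>det (matrix (geo_deriv X a K xh))\<bar> * \<psi> i (T K xh))"
    and "\<And>K. K \<in> cells X \<Longrightarrow> i \<in> cdofs K \<Longrightarrow>
      set_integrable lebesgue (interior (Kh K)) (\<lambda>xh. \<bar>det (matrix (geo_deriv X a K xh))\<bar> * \<psi> i (T K xh))"
  unfolding mass_def
  by (rule integral_over_reference_cells[OF i psi_set_integrable(2)[OF i] psi_periodic[OF i]]; assumption)+

lemma sum_cvec_reference:
  assumes i: "i \<in> dofs X"
  shows "(\<Sum>j\<in>nb i. W j \<bullet> cvec \<Omega> \<psi> i j) = (\<Sum>K | K \<in> cells X \<and> i \<in> cdofs K.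
      LINT xh:interior (Kh K)|lebesgue. \<bar>det (matrix (geo_deriv X a K xh))\<bar> *
        (\<psi> i (T K xh) * divergence (fe_fun \<psi> (dofs X) W) (T K xh)))"
    and "\<And>K. K \<in> cells X \<Longrightarrow> i \<in> cdofs K \<Longrightarrow>
      set_integrable lebesgue (interior (Kh K)) (\<lambda>xh. \<bar>det (matrix (geo_deriv X a K xh))\<bar> *
        (\<psi> i (T K xh) * divergence (fe_fun \<psi> (dofs X) W) (T K xh)))"
proof -
  let ?F = "\<lambda>x. \<psi> i x * divergence (fe_fun \<psi> (dofs X) W) x"
  have e: "indicat_real (supp \<psi> i \<inter> \<Omega>) x *\<^sub>R ?F x = indicat_real \<Omega> x *\<^sub>R ?F x" for x
    using psi_zero_off_supp[of x i] by (auto simp: indicator_def)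
  have s: "set_integrable lebesgue \<Omega> ?F"
    using sum_cvec(3)[OF i, of W] unfolding set_integrable_def e .
  have eq: "(\<Sum>j\<in>nb i. W j \<bullet> cvec \<Omega> \<psi> i j) = (LINT x:\<Omega>|lebesgue. ?F x)"
    unfolding sum_cvec(1)[OF i] set_lebesgue_integral_def e ..
  have per: "?F (x + l) = ?F x" if "l \<in> \<Lambda>" for l x
    using psi_periodic[OF i that, of x] divergence_periodic[of "fe_fun \<psi> (dofs X) W" l x, OF fe_fun_periodic[OF that]] by simp
  show "(\<Sum>j\<in>nb i. W j \<bullet> cvec \<Omega> \<psi> i j) = (\<Sum>K | K \<in> cells X \<and> i \<in> cdofs K.
      LINT xh:interior (Kh K)|lebesgue. \<bar>det (matrix (geo_deriv X a K xh))\<bar> * ?F (T K xh))"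
    unfolding eq by (rule integral_over_reference_cells(1)[OF i s per]) simp_all
  show "set_integrable lebesgue (interior (Kh K)) (\<lambda>xh. \<bar>det (matrix (geo_deriv X a K xh))\<bar> * ?F (T K xh))"
    if "K \<in> cells X" "i \<in> cdofs K" for K
    by (rule integral_over_reference_cells(2)[OF i s per]) (use that in simp_all)
qed

end

section \<open>The time step restriction\<close>

lemma ennreal_mult_le_divide:
  fixes e h x :: ennreal
  assumes "h \<le> 1 / e" shows "x * e \<le> x / h"
proof -
  have "e \<le> inverse h"
  proof (cases e)
    case e: (real r)
    show ?thesis
    proof (cases "r = 0")
      case False
      then have r: "0 < r" using e by simp
      have h: "h \<le> ennreal (inverse r)" using assms e r by (simp add: divide_ennreal_def inverse_ennreal)
      then obtain q where q: "h = ennreal q" "0 \<le> q" by (cases h) (auto simp: top_unique)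
      show ?thesis
      proof (cases "q = 0")
        case False
        then have "0 < q" using q by simp
        moreover have "q \<le> inverse r" using h q r by simp
        ultimately have "r \<le> inverse q" using r by (simp add: field_simps)
        then show ?thesis using \<open>0 < q\<close> e q by (simp add: inverse_ennreal ennreal_leI)
      qed (simp add: q)
    qed (simp add: e)
  next
    case top
    then have "h = 0" using assms by (simp add: divide_ennreal_def)
    then show ?thesis by simp
  qed
  then show ?thesis unfolding divide_ennreal_def by (rule mult_left_mono) simp
qed

text \<open>Here \<open>ov l j\<close> is an overlap mass times a quadrature weight, \<open>e l j\<close> a bound for a gradient and \<open>N j\<close> the
  norm of \<open>c\<^sub>i\<^sub>j\<close>.  The chain is
  \<open>\<Sum>\<^sub>j d j \<le> lam \<Sum>\<^sub>j N j \<le> (lam / h) \<Sum>\<^sub>j \<Sum>\<^sub>l ov l j = (lam / h) \<kappa> M\<close>; the factor \<open>M / m'\<close> of the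
  CFL number replaces \<open>M\<close> by \<open>m'\<close>.  Version 1 has a single index \<open>l\<close>.\<close>

lemma viscosity_le_if_cfl:
  assumes \<tau>: "0 < \<tau>" and lam: "0 \<le> lam" and m': "0 < m'" and M: "0 < M"
    and ov: "\<And>l j. l \<in> L \<Longrightarrow> j \<in> J \<Longrightarrow> 0 \<le> ov l j"
    and N: "\<And>j. j \<in> J \<Longrightarrow> 0 \<le> N j \<and> ennreal (N j) \<le> (\<Sum>l\<in>L. e l j * ennreal (ov l j))"
    and e: "\<And>l j. l \<in> L \<Longrightarrow> j \<in> J \<Longrightarrow> ov l j = 0 \<or> h \<le> 1 / e l j"
    and d: "\<And>j. j \<in> J \<Longrightarrow> d j \<le> lam * N j"
    and cfl: "cfl_number \<tau> lam h ((\<Sum>j\<in>J. \<Sum>l\<in>L. ov l j) / M) (M / m') \<le> 1"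
  shows "2 * \<tau> * (\<Sum>j\<in>J. d j) \<le> m'"
proof -
  define Z where "Z = (\<Sum>j\<in>J. \<Sum>l\<in>L. ov l j)"
  have Z0: "0 \<le> Z" unfolding Z_def by (intro sum_nonneg ov)
  have step: "ennreal (lam * N j) \<le> (\<Sum>l\<in>L. (ennreal lam / h) * ennreal (ov l j))" if j: "j \<in> J" for j
  proof -
    have "ennreal (lam * N j) = ennreal lam * ennreal (N j)" by (rule ennreal_mult) (use lam N[OF j] in simp_all)
    also have "\<dots> \<le> ennreal lam * (\<Sum>l\<in>L. e l j * ennreal (ov l j))" using N[OF j] by (intro mult_left_mono) simp_all
    also have "\<dots> = (\<Sum>l\<in>L. (ennreal lam * e l j) * ennreal (ov l j))" by (simp add: sum_distrib_left mult.assoc)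
    also have "\<dots> \<le> (\<Sum>l\<in>L. (ennreal lam / h) * ennreal (ov l j))"
    proof (rule sum_mono)
      fix l assume l: "l \<in> L"
      show "(ennreal lam * e l j) * ennreal (ov l j) \<le> (ennreal lam / h) * ennreal (ov l j)"
        using e[OF l j]
      proof
        assume "h \<le> 1 / e l j"
        then show ?thesis by (intro mult_right_mono ennreal_mult_le_divide) simp_all
      qed simp
    qed
    finally show ?thesis .
  qed
  have "ennreal (\<Sum>j\<in>J. lam * N j) = (\<Sum>j\<in>J. ennreal (lam * N j))"
    by (rule sum_ennreal[symmetric]) (use N lam in simp)
  also have "\<dots> \<le> (\<Sum>j\<in>J. \<Sum>l\<in>L. (ennreal lam / h) * ennreal (ov l j))" by (rule sum_mono[OF step])
  also have "\<dots> = (ennreal lam / h) * (\<Sum>j\<in>J. \<Sum>l\<in>L. ennreal (ov l j))" by (simp add: sum_distrib_left)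
  also have "(\<Sum>j\<in>J. \<Sum>l\<in>L. ennreal (ov l j)) = ennreal Z"
  proof -
    have "(\<Sum>j\<in>J. \<Sum>l\<in>L. ennreal (ov l j)) = (\<Sum>j\<in>J. ennreal (\<Sum>l\<in>L. ov l j))"
      by (intro sum.cong refl sum_ennreal ov)
    also have "\<dots> = ennreal Z" unfolding Z_def by (intro sum_ennreal sum_nonneg ov)
    finally show ?thesis .
  qed
  finally have S: "ennreal (\<Sum>j\<in>J. lam * N j) \<le> (ennreal lam / h) * ennreal Z" .
  have OM: "ennreal (Z / M) * ennreal (M / m') * ennreal m' = ennreal Z"
    using Z0 M m' by (simp flip: ennreal_mult)
  have "(\<Sum>j\<in>J. d j) \<le> (\<Sum>j\<in>J. lam * N j)" by (rule sum_mono[OF d])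
  then have "2 * \<tau> * (\<Sum>j\<in>J. d j) \<le> 2 * \<tau> * (\<Sum>j\<in>J. lam * N j)" using \<tau> by simp
  then have "ennreal (2 * \<tau> * (\<Sum>j\<in>J. d j)) \<le> ennreal (2 * \<tau>) * ennreal (\<Sum>j\<in>J. lam * N j)"
    using \<tau> by (subst ennreal_mult'[symmetric]) (auto intro: ennreal_leI)
  also have "\<dots> \<le> ennreal (2 * \<tau>) * ((ennreal lam / h) * ennreal Z)" by (rule mult_left_mono[OF S]) simp
  also have "\<dots> = cfl_number \<tau> lam h (Z / M) (M / m') * ennreal m'"
    unfolding cfl_number_def OM[symmetric] by (simp only: mult.assoc)
  also have "\<dots> \<le> 1 * ennreal m'" by (rule mult_right_mono) (use cfl in \<open>simp_all add: Z_def\<close>)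
  finally show ?thesis using m' by simp
qed

lemma visc_off_le:
  assumes fin: "finite (I i)" and j: "j \<in> I i" and anti: "norm (c j i) = norm (c i j)"
  shows "visc_off R f I W c U i j \<le> lam_local R f I W c U i * norm (c i j)"
proof -
  have "max (dir_speed R (ale_flux f (W j)) (c i j) (U i) (U j)) (dir_speed R (ale_flux f (W i)) (c j i) (U j) (U i)) \<le> lam_local R f I W c U i"
    unfolding lam_local_def using fin j by (intro Max_ge) auto
  then show ?thesis using j anti by (auto simp: visc_off_def intro!: mult_right_mono)
qed

lemma lam_local_nonneg:
  assumes fin: "finite (I i)" and j: "j \<in> I i"
  shows "0 \<le> lam_local R f I W c U i"
proof -
  have "0 \<le> max (dir_speed R (ale_flux f (W j)) (c i j) (U i) (U j)) (dir_speed R (ale_flux f (W i)) (c j i) (U j) (U i))"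
    by (simp add: dir_speed_nonneg le_max_iff_disj)
  also have "\<dots> \<le> lam_local R f I W c U i"
    unfolding lam_local_def using fin j by (intro Max_ge) auto
  finally show ?thesis .
qed

context fe_mesh
begin

lemma overlap_mass_nonneg: "i \<in> dofs X \<Longrightarrow> 0 \<le> overlap_mass \<Omega> \<psi> i j"
  unfolding overlap_mass_def set_lebesgue_integral_def by (rule integral_nonneg_AE) (simp add: psi_nonneg)

end

section \<open>Version 1\<close>

text \<open>The denominator of \<open>kappa1\<close> is the exact mass, which is therefore the mass to be divided by the new one in
  the CFL number.\<close>

lemma version1_invariant:
  fixes X :: "('c, 'g, 'i, 'd::{finite,wellorder}) mesh_data" and R :: "('m::finite, 'd) riemann"
  assumes bc: "boundary_ok bc" and data: "mesh_data_ok X bc"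
    and solv: "riemann_solvable R f" and tr: "ale_translates R f" and i: "i \<in> dofs X"
    and v: "version1 X bc R f t a W \<mu> U n"
    and cfl: "cfl1 X bc R f t a W \<mu> U n i (mass (flow_domain bc) (psi X bc (a n)) i) \<le> 1"
    and inv: "invariant_set R f B" and UB: "U n ` nbrs (flow_domain bc) (dofs X) (psi X bc (a n)) i \<subseteq> B"
  shows "U (Suc n) i \<in> B"
proof -
  note v = v[unfolded version1_def]
  have "mesh_ok X bc (a n)" using v by auto
  then interpret fe_mesh X bc "a n" using bc data by unfold_locales
  let ?\<tau> = "t (Suc n) - t n" and ?c = "cvec \<Omega> \<psi>"
  have \<tau>: "0 < ?\<tau>" using v by auto
  have m': "0 < \<mu> (Suc n) i" using v i by auto
  have upd: "ale_update R f nb (W n) ?c ?\<tau> (\<mu> n) (\<mu> (Suc n)) (U n) (U (Suc n)) i" using v i by auto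
  have gcl: "\<mu> (Suc n) i = \<mu> n i + ?\<tau> * (\<Sum>j\<in>nb i. W n j \<bullet> ?c i j)"
    using v i unfolding sum_cvec(1)[OF i] by auto
  have nbd: "j \<in> dofs X" if "j \<in> nb i" for j using that nb_subset by blast
  have visc: "2 * ?\<tau> * (\<Sum>j\<in>nb i - {i}. visc_off R f nb (W n) ?c (U n) i j) \<le> \<mu> (Suc n) i"
  proof (rule viscosity_le_if_cfl[where L = "{()}" and lam = "lam_local R f nb (W n) ?c (U n) i" and M = "mass \<Omega> \<psi> i"
        and h = "mesh_size \<Omega> (dofs X) \<psi> i" and N = "\<lambda>j. norm (?c i j)" and ov = "\<lambda>_ j. overlap_mass \<Omega> \<psi> i j"
        and e = "\<lambda>_ j. esssup (lebesgue_on (supp \<psi> i \<inter> supp \<psi> j \<inter> \<Omega>)) (\<lambda>x. ennreal (norm (grad (\<psi> j) x)))"])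
    show "0 \<le> lam_local R f nb (W n) ?c (U n) i" by (rule lam_local_nonneg[where I = nb, OF nb_finite[OF i] nb_refl[OF i]])
    fix j assume "j \<in> nb i - {i}"
    then have j: "j \<in> nb i" by simp
    show "visc_off R f nb (W n) ?c (U n) i j \<le> lam_local R f nb (W n) ?c (U n) i * norm (?c i j)"
      by (rule visc_off_le[where I = nb, OF nb_finite[OF i] j]) (simp add: cvec_antisym[OF i nbd[OF j]])
    show "0 \<le> norm (?c i j) \<and> ennreal (norm (?c i j)) \<le> (\<Sum>l\<in>{()}. esssup (lebesgue_on (supp \<psi> i \<inter> supp \<psi> j \<inter> \<Omega>)) (\<lambda>x. ennreal (norm (grad (\<psi> j) x))) * ennreal (overlap_mass \<Omega> \<psi> i j))"
      using cvec_bound[OF i nbd[OF j]] by simp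
    show "overlap_mass \<Omega> \<psi> i j = 0 \<or> mesh_size \<Omega> (dofs X) \<psi> i \<le> 1 / esssup (lebesgue_on (supp \<psi> i \<inter> supp \<psi> j \<inter> \<Omega>)) (\<lambda>x. ennreal (norm (grad (\<psi> j) x)))"
      unfolding mesh_size_def mesh_size_pair_def[symmetric] using j by (intro disjI2 INF_lower)
  next
    show "cfl_number ?\<tau> (lam_local R f nb (W n) ?c (U n) i) (mesh_size \<Omega> (dofs X) \<psi> i)
        ((\<Sum>j\<in>nb i - {i}. \<Sum>l\<in>{()}. overlap_mass \<Omega> \<psi> i j) / mass \<Omega> \<psi> i) (mass \<Omega> \<psi> i / \<mu> (Suc n) i) \<le> 1"
      using cfl unfolding cfl1_def Let_def kappa1_def mass_eq[of i] by simp
  qed (use \<tau> m' mass_positive[OF i] nb_finite[OF i] overlap_mass_nonneg[OF i] in auto)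
  have sym: "i \<in> nb j" if "j \<in> nb i" for j using nb_sym[OF i nbd[OF that]] that by blast
  show ?thesis
    by (rule ale_update_in_invariant_set[OF solv tr inv nb_finite[OF i] nb_refl[OF i] sym UB \<tau> m' upd sum_cvec(2)[OF i] gcl visc])
qed

section \<open>Version 2\<close>

lemma psi_cong_nodes:
  assumes data: "mesh_data_ok X bc" and eq: "\<And>g. g \<in> geo_nodes X \<Longrightarrow> a g = b g"
  shows "psi X bc a = psi X bc b"
proof -
  have nodes: "geo_nodes X = (\<Union>K\<in>cells X. (\<lambda>i. jgeo X i K) ` {..<nf_geo (refel X K)})"
    using data unfolding mesh_data_ok_def by (elim conjE)
  have T: "geo_map X a K = geo_map X b K" if "K \<in> cells X" for K
  proof -
    have "a (jgeo X i K) = b (jgeo X i K)" if "i < nf_geo (refel X K)" for i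
      by (rule eq) (unfold nodes, use \<open>K \<in> cells X\<close> that in auto)
    then show ?thesis unfolding geo_map_def by (intro ext sum.cong) auto
  qed
  show ?thesis unfolding psi_def global_shape_def[abs_def] using T by (simp cong: bex_cong)
qed

text \<open>The nodes move with constant velocity \<open>w\<close>; the time is rescaled such that the step is \<open>[0, 1]\<close>.\<close>

locale moving_mesh =
  fixes X :: "('c, 'g, 'i, 'd::{finite,wellorder}) mesh_data" and bc :: "'d boundary"
    and a0 w :: "'g \<Rightarrow> (real, 'd) vec" and \<tau> :: real
  assumes bc: "boundary_ok bc" and data: "mesh_data_ok X bc"
    and mesh: "\<And>s. 0 \<le> s \<Longrightarrow> s \<le> 1 \<Longrightarrow> mesh_ok X bc (\<lambda>g. a0 g + (s * \<tau>) *\<^sub>R w g)"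
begin

abbreviation "nodes s \<equiv> (\<lambda>g. a0 g + (s * \<tau>) *\<^sub>R w g)"

lemma fe_mesh_at: "0 \<le> s \<Longrightarrow> s \<le> 1 \<Longrightarrow> fe_mesh X bc (nodes s)"
  using bc data mesh by (intro fe_mesh.intro)

lemma nb_time_independent:
  assumes i: "i \<in> dofs X" and s: "0 \<le> s" "s \<le> 1" "0 \<le> s'" "s' \<le> 1"
  shows "nbrs (flow_domain bc) (dofs X) (psi X bc (nodes s)) i = nbrs (flow_domain bc) (dofs X) (psi X bc (nodes s')) i"
proof -
  interpret A: fe_mesh X bc "nodes s" using fe_mesh_at s by blast
  interpret B: fe_mesh X bc "nodes s'" using fe_mesh_at s by blast
  have "A.ref_supp = B.ref_supp" by (simp add: fun_eq_iff A.ref_supp_def B.ref_supp_def)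
  then have "j \<in> A.nb i \<longleftrightarrow> j \<in> B.nb i" if "j \<in> dofs X" for j
    using A.nb_iff_ref_supp[OF i that] B.nb_iff_ref_supp[OF i that] by simp
  then show ?thesis using A.nb_subset[of i] B.nb_subset[of i] by blast
qed

lemma matrix_geo_deriv:
  assumes K: "K \<in> cells X" and xh: "xh \<in> interior (Khat (refel X K))"
  shows "matrix (geo_deriv X (nodes s) K xh) = matrix (geo_deriv X a0 K xh) + s *\<^sub>R (\<tau> *\<^sub>R matrix (vel_deriv X w K xh))"
  by (simp add: matrix_def vec_eq_iff geo_deriv_def vel_deriv_def sum.distrib sum_distrib_left algebra_simps)

text \<open>The geometric conservation law.  Pulled back to the reference elements, both sides are integrals of the two
  sides of \<open>quadrature_integrates_abs_det\<close> times a shape function; the derivative in time is taken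
  pointwise, and none has to be exchanged with an integral.\<close>

lemma mass_increment:
  assumes i: "i \<in> dofs X" and quad: "quadrature L \<omega> \<zeta> (CARD('d) - 1)"
    and vel: "\<And>K yh. K \<in> cells X \<Longrightarrow> yh \<in> Khat (refel X K) \<Longrightarrow>
        (\<Sum>i<nf (refel X K). theta (refel X K) i yh *\<^sub>R W (jdof X i K)) =
        (\<Sum>i<nf_geo (refel X K). theta_geo (refel X K) i yh *\<^sub>R w (jgeo X i K))"
  shows "mass (flow_domain bc) (psi X bc (nodes 1)) i - mass (flow_domain bc) (psi X bc (nodes 0)) i =
    \<tau> * (\<Sum>l\<in>L. \<omega> l * (\<Sum>j\<in>nbrs (flow_domain bc) (dofs X) (psi X bc (nodes (\<zeta> l))) i.
        W j \<bullet> cvec (flow_domain bc) (psi X bc (nodes (\<zeta> l))) i j))"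
proof -
  let ?C = "{K \<in> cells X. i \<in> (\<lambda>i. jdof X i K) ` {..<nf (refel X K)}}"
  let ?int = "\<lambda>K. interior (Khat (refel X K))"
  define A B where "A K xh = matrix (geo_deriv X a0 K xh)" and "B K xh = \<tau> *\<^sub>R matrix (vel_deriv X w K xh)" for K xh
  define \<theta> where "\<theta> K = dof_local X K i" for K
  have \<zeta>: "0 \<le> \<zeta> l" "\<zeta> l \<le> 1" if "l \<in> L" for l using quad that unfolding quadrature_def by auto
  have "\<exists>D. D ** (A K xh + s *\<^sub>R B K xh) = mat 1 \<and>
      divergence (fe_fun (psi X bc (nodes s)) (dofs X) W) (geo_map X (nodes s) K xh) = trace (matrix (vel_deriv X w K xh) ** D)"
    if K: "K \<in> cells X" "xh \<in> ?int K" and s: "0 \<le> s" "s \<le> 1" for K xh s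
  proof -
    interpret M: fe_mesh X bc "nodes s" using fe_mesh_at s by blast
    obtain D where D: "D ** matrix (geo_deriv X (nodes s) K xh) = mat 1"
      "divergence (fe_fun (psi X bc (nodes s)) (dofs X) W) (geo_map X (nodes s) K xh) = trace (matrix (vel_deriv X w K xh) ** D)"
      by (rule M.divergence_reference[OF K]) (use vel[OF K(1)] in blast)
    then show ?thesis unfolding matrix_geo_deriv[OF K] A_def B_def by blast
  qed
  note ex = this
  \<comment> \<open>the inverse of the Jacobian matrix at time \<open>s\<close>\<close>
  define D where "D K xh s = (SOME D. D ** (A K xh + s *\<^sub>R B K xh) = mat 1 \<and>
      divergence (fe_fun (psi X bc (nodes s)) (dofs X) W) (geo_map X (nodes s) K xh) = trace (matrix (vel_deriv X w K xh) ** D))" for K xh s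
  have D: "\<And>K xh s. K \<in> cells X \<Longrightarrow> xh \<in> ?int K \<Longrightarrow> 0 \<le> s \<Longrightarrow> s \<le> 1 \<Longrightarrow> D K xh s ** (A K xh + s *\<^sub>R B K xh) = mat 1"
    and div: "\<And>K xh s. K \<in> cells X \<Longrightarrow> xh \<in> ?int K \<Longrightarrow> 0 \<le> s \<Longrightarrow> s \<le> 1 \<Longrightarrow>
      divergence (fe_fun (psi X bc (nodes s)) (dofs X) W) (geo_map X (nodes s) K xh) = trace (matrix (vel_deriv X w K xh) ** D K xh s)"
    unfolding D_def by (rule conjunct1[OF someI_ex[OF ex]] conjunct2[OF someI_ex[OF ex]]; assumption)+
  define P where "P s K xh = indicat_real (?int K) xh *\<^sub>R (\<bar>det (A K xh + s *\<^sub>R B K xh)\<bar> * \<theta> K xh)" for s K xh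
  define Q where "Q s K xh = indicat_real (?int K) xh *\<^sub>R (\<bar>det (A K xh + s *\<^sub>R B K xh)\<bar> * (\<theta> K xh * trace (matrix (vel_deriv X w K xh) ** D K xh s)))" for s K xh
  have PQ: "(K \<in> ?C \<longrightarrow> integrable lebesgue (P s K)) \<and> (K \<in> ?C \<longrightarrow> integrable lebesgue (Q s K)) \<and>
      mass (flow_domain bc) (psi X bc (nodes s)) i = (\<Sum>K\<in>?C. LINT xh|lebesgue. P s K xh) \<and>
      (\<Sum>j\<in>nbrs (flow_domain bc) (dofs X) (psi X bc (nodes s)) i. W j \<bullet> cvec (flow_domain bc) (psi X bc (nodes s)) i j) = (\<Sum>K\<in>?C. LINT xh|lebesgue. Q s K xh)"
    if s: "0 \<le> s" "s \<le> 1" for s K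
  proof -
    interpret M: fe_mesh X bc "nodes s" using fe_mesh_at s by blast
    have psi: "M.\<psi> i (M.T K xh) = \<theta> K xh" if "K \<in> cells X" "xh \<in> ?int K" for K xh
      using M.psi_cell[OF i that(1) _ lattice_0, of xh] that(2) interior_subset[of "Khat (refel X K)"] by (auto simp: \<theta>_def)
    have P: "P s K = (\<lambda>xh. indicat_real (?int K) xh *\<^sub>R (\<bar>det (matrix (geo_deriv X (nodes s) K xh))\<bar> * M.\<psi> i (M.T K xh)))" if "K \<in> ?C" for K
      using that psi[of K] matrix_geo_deriv[of K _ s] unfolding P_def A_def B_def by (auto simp: fun_eq_iff indicator_def)
    have Q: "Q s K = (\<lambda>xh. indicat_real (?int K) xh *\<^sub>R (\<bar>det (matrix (geo_deriv X (nodes s) K xh))\<bar> * (M.\<psi> i (M.T K xh) * divergence (fe_fun M.\<psi> (dofs X) W) (M.T K xh))))" if "K \<in> ?C" for K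
      using that psi[of K] matrix_geo_deriv[of K _ s] div[of K _ s] s unfolding Q_def A_def B_def by (auto simp: fun_eq_iff indicator_def)
    show ?thesis
      unfolding M.mass_reference(1)[OF i] M.sum_cvec_reference(1)[OF i] set_lebesgue_integral_def
      using P Q M.mass_reference(2)[OF i, of K] M.sum_cvec_reference(2)[OF i, of K W]
      by (auto simp: set_integrable_def intro!: sum.cong)
  qed
  have diff: "P 1 K xh - P 0 K xh = \<tau> * (\<Sum>l\<in>L. \<omega> l * Q (\<zeta> l) K xh)" if K: "K \<in> cells X" for K xh
  proof (cases "xh \<in> ?int K")
    case True
    have "\<bar>det (A K xh + B K xh)\<bar> - \<bar>det (A K xh)\<bar> = (\<Sum>l\<in>L. \<omega> l * (\<bar>det (A K xh + \<zeta> l *\<^sub>R B K xh)\<bar> * trace (B K xh ** D K xh (\<zeta> l))))"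
      by (rule quadrature_integrates_abs_det[OF quad D[OF K True]])
    also have "\<dots> = \<tau> * (\<Sum>l\<in>L. \<omega> l * (\<bar>det (A K xh + \<zeta> l *\<^sub>R B K xh)\<bar> * trace (matrix (vel_deriv X w K xh) ** D K xh (\<zeta> l))))"
    proof -
      have "trace (B K xh ** E) = \<tau> * trace (matrix (vel_deriv X w K xh) ** E)" for E :: "((real, 'd) vec, 'd) vec"
        unfolding B_def by (simp add: trace_def matrix_matrix_mult_def sum_distrib_left mult.assoc)
      then show ?thesis by (simp add: sum_distrib_left mult_ac)
    qed
    finally have "(\<bar>det (A K xh + B K xh)\<bar> - \<bar>det (A K xh)\<bar>) * \<theta> K xh =
        (\<tau> * (\<Sum>l\<in>L. \<omega> l * (\<bar>det (A K xh + \<zeta> l *\<^sub>R B K xh)\<bar> * trace (matrix (vel_deriv X w K xh) ** D K xh (\<zeta> l))))) * \<theta> K xh" by simp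
    then show ?thesis using True unfolding P_def Q_def
      by (simp add: left_diff_distrib right_diff_distrib sum_distrib_left sum_distrib_right mult_ac)
  qed (simp add: P_def Q_def)
  have "(\<Sum>K\<in>?C. LINT xh|lebesgue. P 1 K xh) - (\<Sum>K\<in>?C. LINT xh|lebesgue. P 0 K xh) = (\<Sum>K\<in>?C. LINT xh|lebesgue. P 1 K xh - P 0 K xh)"
    using PQ[of 0] PQ[of 1] by (simp flip: sum_subtractf)
  also have "\<dots> = (\<Sum>K\<in>?C. LINT xh|lebesgue. \<tau> * (\<Sum>l\<in>L. \<omega> l * Q (\<zeta> l) K xh))"
    using diff by (intro sum.cong refl) simp
  also have "\<dots> = (\<Sum>K\<in>?C. \<tau> * (\<Sum>l\<in>L. \<omega> l * (LINT xh|lebesgue. Q (\<zeta> l) K xh)))"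
  proof (rule sum.cong[OF refl])
    fix K assume "K \<in> ?C"
    then have "integrable lebesgue (Q (\<zeta> l) K)" if "l \<in> L" for l using PQ[OF \<zeta>[OF that], of K] by blast
    then show "(LINT xh|lebesgue. \<tau> * (\<Sum>l\<in>L. \<omega> l * Q (\<zeta> l) K xh)) = \<tau> * (\<Sum>l\<in>L. \<omega> l * (LINT xh|lebesgue. Q (\<zeta> l) K xh))"
      by simp
  qed
  also have "\<dots> = \<tau> * (\<Sum>l\<in>L. \<omega> l * (\<Sum>K\<in>?C. LINT xh|lebesgue. Q (\<zeta> l) K xh))"
    by (simp add: sum_distrib_left) (rule sum.swap)
  finally show ?thesis using PQ[of 0] PQ[of 1] PQ[OF \<zeta>] by (simp cong: sum.cong)
qed

end

lemma (in fe_mesh) fe_fun_geo_cell: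
  assumes geo: "conforming X bc a (geo_local X) (geo_nodes X)"
    and K: "K \<in> cells X" "l \<in> \<Lambda>" and xh: "xh \<in> Kh K"
  shows "fe_fun (psi_geo X bc a) (geo_nodes X) C (T K xh + l) = (\<Sum>i<nf_geo (refel X K). theta_geo (refel X K) i xh *\<^sub>R C (jgeo X i K))"
proof -
  let ?G = "(\<lambda>i. jgeo X i K) ` {..<nf_geo (refel X K)}"
  have nodes: "geo_nodes X = (\<Union>K\<in>cells X. (\<lambda>i. jgeo X i K) ` {..<nf_geo (refel X K)})"
    using data unfolding mesh_data_ok_def by (elim conjE)
  then have sub: "?G \<subseteq> geo_nodes X" using K(1) by blast
  have val: "psi_geo X bc a g (T K xh + l) = geo_local X K g xh" if "g \<in> geo_nodes X" for g
    using geo that K xh unfolding conforming_def psi_geo_def by simp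
  have other: "geo_local X K g xh = 0" if "g \<notin> ?G" for g
  proof -
    have "{i. i < nf_geo (refel X K) \<and> jgeo X i K = g} = {}" using that by auto
    then show ?thesis unfolding geo_local_def by (simp only: sum.empty)
  qed
  have loc: "geo_local X K (jgeo X i K) xh = theta_geo (refel X K) i xh" if "i < nf_geo (refel X K)" for i
  proof -
    have "{i'. i' < nf_geo (refel X K) \<and> jgeo X i' K = jgeo X i K} = {i}"
      using ref_props(10)[OF K(1)] that by (auto simp: inj_on_def)
    then show ?thesis by (simp add: geo_local_def)
  qed
  have "fe_fun (psi_geo X bc a) (geo_nodes X) C (T K xh + l) = (\<Sum>g\<in>?G. geo_local X K g xh *\<^sub>R C g)"
    unfolding fe_fun_def
  proof (rule sum.mono_neutral_cong_left)
    show "{g \<in> geo_nodes X. psi_geo X bc a g (T K xh + l) \<noteq> 0} \<subseteq> ?G"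
    proof
      fix g assume "g \<in> {g \<in> geo_nodes X. psi_geo X bc a g (T K xh + l) \<noteq> 0}"
      then have "geo_local X K g xh \<noteq> 0" using val[of g] by auto
      then show "g \<in> ?G" using other by blast
    qed
    show "\<forall>g\<in>?G - {g \<in> geo_nodes X. psi_geo X bc a g (T K xh + l) \<noteq> 0}. geo_local X K g xh *\<^sub>R C g = 0"
    proof
      fix g assume g: "g \<in> ?G - {g \<in> geo_nodes X. psi_geo X bc a g (T K xh + l) \<noteq> 0}"
      then have "g \<in> geo_nodes X" using sub by blast
      then show "geo_local X K g xh *\<^sub>R C g = 0" using g val by simp
    qed
  qed (simp_all add: val)
  also have "\<dots> = (\<Sum>i<nf_geo (refel X K). theta_geo (refel X K) i xh *\<^sub>R C (jgeo X i K))"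
    by (subst sum.reindex[OF ref_props(10)[OF K(1)]]) (simp add: loc)
  finally show ?thesis .
qed

text \<open>The vectors \<open>c\<^sub>i\<^sub>j\<close> are weighted sums over the quadrature times, so that \<open>\<Sum>\<^sub>j c\<^sub>i\<^sub>j = 0\<close>, the antisymmetry and
  the bounds are inherited from the meshes at these times; all of them have the same neighbours.\<close>

lemma version2_invariant:
  fixes X :: "('c, 'g, 'i, 'd::{finite,wellorder}) mesh_data" and R :: "('m::finite, 'd) riemann"
  assumes bc: "boundary_ok bc" and data: "mesh_data_ok X bc"
    and solv: "riemann_solvable R f" and tr: "ale_translates R f" and i: "i \<in> dofs X"
    and v: "version2 X bc R f L \<omega> \<zeta> t a Wgeo W U n"
    and cfl: "cfl2 X bc R f L \<omega> \<zeta> t a Wgeo W U n i \<le> 1"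
    and inv: "invariant_set R f B" and UB: "U n ` nbrs (flow_domain bc) (dofs X) (psi X bc (a n)) i \<subseteq> B"
  shows "U (Suc n) i \<in> B"
proof -
  let ?\<tau> = "t (Suc n) - t n" and ?\<Omega> = "flow_domain bc"
  note v1 = v[unfolded version2_def, THEN conjunct1] and v2 = v[unfolded version2_def, THEN conjunct2, THEN conjunct2]
  note quad = v2[THEN conjunct1] and v3 = v2[THEN conjunct2]
  note geo = v3[THEN conjunct1] and v4 = v3[THEN conjunct2]
  note vel = v4[THEN conjunct1, rule_format] and v5 = v4[THEN conjunct2]
  note mok = v5[THEN conjunct1, THEN bspec, THEN conjunct1] and v6 = v5[THEN conjunct2]
  note aS = v6[THEN conjunct1, rule_format] and upd = v6[THEN conjunct2, THEN bspec, OF i]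
  have \<tau>: "0 < ?\<tau>" using v1 by simp
  have moved: "moved_nodes t a Wgeo n (t n + s * ?\<tau>) = (\<lambda>g. a n g + (s * ?\<tau>) *\<^sub>R Wgeo n g)" for s
    by (simp add: moved_nodes_def fun_eq_iff)
  interpret moving_mesh X bc "a n" "Wgeo n" ?\<tau>
  proof
    fix s :: real assume s: "0 \<le> s" "s \<le> 1"
    then have "s * ?\<tau> \<le> 1 * ?\<tau>" "0 \<le> s * ?\<tau>" using \<tau> by (intro mult_right_mono mult_nonneg_nonneg; simp)+
    then have "t n + s * ?\<tau> \<in> {t n..t (Suc n)}" by simp
    from mok[OF this] show "mesh_ok X bc (\<lambda>g. a n g + (s * ?\<tau>) *\<^sub>R Wgeo n g)" unfolding moved .
  qed (use bc data in auto)
  have n0: "nodes 0 = a n" by simp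
  have M0: "fe_mesh X bc (a n)" using fe_mesh_at[of 0] by simp
  interpret M: fe_mesh X bc "a n" by (rule M0)
  have psi1: "psi X bc (a (Suc n)) = psi X bc (nodes 1)"
    by (rule psi_cong_nodes[OF data]) (simp add: aS moved_nodes_def)
  define \<phi> where "\<phi> l = psi X bc (nodes (\<zeta> l))" for l
  have phi: "phi X bc t a Wgeo n (quad_time t \<zeta> n l) = \<phi> l" for l
    unfolding phi_def \<phi>_def quad_time_def using moved[of "\<zeta> l"] by (simp add: mult.commute)
  have \<zeta>: "0 \<le> \<zeta> l" "\<zeta> l \<le> 1" and \<omega>: "0 \<le> \<omega> l" if "l \<in> L" for l using quad that unfolding quadrature_def by auto
  have fL: "finite L" using quad unfolding quadrature_def by blast
  have \<omega>1: "(\<Sum>l\<in>L. \<omega> l) = 1"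
  proof -
    have "(\<Sum>l\<in>L. \<omega> l * poly 1 (\<zeta> l)) = integral {0..1} (poly (1 :: real poly))"
      using quad unfolding quadrature_def by (metis degree_1 le0)
    then show ?thesis by (simp add: poly_1[abs_def])
  qed
  let ?c = "cvec2 X bc L \<omega> \<zeta> t a Wgeo n"
  have c: "?c p q = (\<Sum>l\<in>L. \<omega> l *\<^sub>R cvec ?\<Omega> (\<phi> l) p q)" for p q
    unfolding cvec2_def phi ..
  note mesh_l = fe_mesh_at[OF \<zeta>]
  have nbl: "nbrs ?\<Omega> (dofs X) (\<phi> l) i = M.nb i" if "l \<in> L" for l
    using nb_time_independent[OF i \<zeta>[OF that], of 0] unfolding \<phi>_def by simp
  have nbd: "j \<in> dofs X" if "j \<in> M.nb i" for j using that M.nb_subset by blast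
  have anti: "?c j i = - ?c i j" if "j \<in> dofs X" for j
  proof -
    have "cvec ?\<Omega> (\<phi> l) j i = - cvec ?\<Omega> (\<phi> l) i j" if "l \<in> L" for l
      unfolding \<phi>_def by (rule fe_mesh.cvec_antisym[OF mesh_l[OF that that] i \<open>j \<in> dofs X\<close>])
    then show ?thesis unfolding c by (simp add: sum_negf)
  qed
  have c0: "(\<Sum>j\<in>M.nb i. ?c i j) = 0"
  proof -
    have "(\<Sum>j\<in>M.nb i. cvec ?\<Omega> (\<phi> l) i j) = 0" if "l \<in> L" for l
      using fe_mesh.sum_cvec(2)[OF mesh_l[OF that that] i] nbl[OF that] unfolding \<phi>_def by simp
    then have "(\<Sum>l\<in>L. \<omega> l *\<^sub>R (\<Sum>j\<in>M.nb i. cvec ?\<Omega> (\<phi> l) i j)) = 0" by simp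
    then show ?thesis unfolding c by (subst sum.swap) (simp add: scaleR_sum_right)
  qed
  let ?m' = "mass ?\<Omega> (psi X bc (a (Suc n)))"
  have gcl: "?m' i = mass ?\<Omega> M.\<psi> i + ?\<tau> * (\<Sum>j\<in>M.nb i. W n j \<bullet> ?c i j)"
  proof -
    have "mass ?\<Omega> (psi X bc (nodes 1)) i - mass ?\<Omega> (psi X bc (nodes 0)) i =
      ?\<tau> * (\<Sum>l\<in>L. \<omega> l * (\<Sum>j\<in>nbrs ?\<Omega> (dofs X) (psi X bc (nodes (\<zeta> l))) i. W n j \<bullet> cvec ?\<Omega> (psi X bc (nodes (\<zeta> l))) i j))"
    proof (rule mass_increment[OF i quad])
      fix K yh assume K: "K \<in> cells X" and yh: "yh \<in> Khat (refel X K)"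
      show "(\<Sum>i<nf (refel X K). theta (refel X K) i yh *\<^sub>R W n (jdof X i K)) =
        (\<Sum>i<nf_geo (refel X K). theta_geo (refel X K) i yh *\<^sub>R Wgeo n (jgeo X i K))"
        using vel[of "M.T K yh + 0"] unfolding M.fe_fun_cell[OF K lattice_0 yh] M.fe_fun_geo_cell[OF geo K lattice_0 yh] by (rule sym)
    qed
    moreover have "(\<Sum>l\<in>L. \<omega> l * (\<Sum>j\<in>nbrs ?\<Omega> (dofs X) (psi X bc (nodes (\<zeta> l))) i. W n j \<bullet> cvec ?\<Omega> (psi X bc (nodes (\<zeta> l))) i j))
      = (\<Sum>l\<in>L. \<omega> l * (\<Sum>j\<in>M.nb i. W n j \<bullet> cvec ?\<Omega> (\<phi> l) i j))"
      by (rule sum.cong[OF refl]) (simp only: nbl[unfolded \<phi>_def] \<phi>_def)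
    moreover have "\<dots> = (\<Sum>j\<in>M.nb i. W n j \<bullet> ?c i j)"
      unfolding c inner_sum_right by (subst sum.swap) (simp add: sum_distrib_left)
    ultimately show ?thesis unfolding psi1 by simp
  qed
  have m': "0 < ?m' i" unfolding psi1 using fe_mesh.mass_positive[OF fe_mesh_at[of 1] i] by simp
  have mass_l: "0 < mass ?\<Omega> (\<phi> l) i" if "l \<in> L" for l
    unfolding \<phi>_def by (rule fe_mesh.mass_positive[OF mesh_l[OF that that] i])
  have Mpos: "0 < (\<Sum>l\<in>L. \<omega> l * mass ?\<Omega> (\<phi> l) i)"
  proof -
    obtain l where l: "l \<in> L" "0 < \<omega> l"
    proof (rule ccontr)
      assume "\<not> thesis"
      then have "\<omega> l = 0" if "l \<in> L" for l using that \<omega>[OF that] \<open>\<And>l. l \<in> L \<Longrightarrow> 0 < \<omega> l \<Longrightarrow> thesis\<close> by force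
      then show False using \<omega>1 by simp
    qed
    show ?thesis
      by (rule sum_pos2[OF fL l(1)]) (use l mass_l \<omega> in \<open>auto intro!: mult_nonneg_nonneg less_imp_le[OF mass_l]\<close>)
  qed
  define e where "e l j = esssup (lebesgue_on (supp (\<phi> l) i \<inter> supp (\<phi> l) j \<inter> ?\<Omega>)) (\<lambda>x. ennreal (norm (grad (\<phi> l j) x)))" for l j
  let ?lam = "lam_local R f M.nb (W n) ?c (U n) i"
  have visc: "2 * ?\<tau> * (\<Sum>j\<in>M.nb i - {i}. visc_off R f M.nb (W n) ?c (U n) i j) \<le> ?m' i"
  proof (rule viscosity_le_if_cfl[where L = L and lam = ?lam and M = "\<Sum>l\<in>L. \<omega> l * mass ?\<Omega> (\<phi> l) i"
        and h = "INF l\<in>L. mesh_size ?\<Omega> (dofs X) (\<phi> l) i" and N = "\<lambda>j. norm (?c i j)"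
        and ov = "\<lambda>l j. \<omega> l * overlap_mass ?\<Omega> (\<phi> l) i j" and e = e])
    show "0 \<le> ?lam" by (rule lam_local_nonneg[where I = M.nb, OF M.nb_finite[OF i] M.nb_refl[OF i]])
    have ov: "0 \<le> overlap_mass ?\<Omega> (\<phi> l) i j" if "l \<in> L" for l j
      unfolding \<phi>_def by (rule fe_mesh.overlap_mass_nonneg[OF mesh_l[OF that that] i])
    then show "0 \<le> \<omega> l * overlap_mass ?\<Omega> (\<phi> l) i j" if "l \<in> L" for l j using \<omega>[OF that] that by simp
    fix j assume "j \<in> M.nb i - {i}"
    then have j: "j \<in> M.nb i" by simp
    show "visc_off R f M.nb (W n) ?c (U n) i j \<le> ?lam * norm (?c i j)"
      by (rule visc_off_le[where I = M.nb, OF M.nb_finite[OF i] j]) (simp add: anti[OF nbd[OF j]])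
    have "ennreal (norm (?c i j)) \<le> ennreal (\<Sum>l\<in>L. \<omega> l * norm (cvec ?\<Omega> (\<phi> l) i j))"
      unfolding c by (intro ennreal_leI order.trans[OF norm_sum] sum_mono) (simp add: \<omega>)
    also have "\<dots> = (\<Sum>l\<in>L. ennreal (\<omega> l * norm (cvec ?\<Omega> (\<phi> l) i j)))" by (rule sum_ennreal[symmetric]) (simp add: \<omega>)
    also have "\<dots> \<le> (\<Sum>l\<in>L. e l j * ennreal (\<omega> l * overlap_mass ?\<Omega> (\<phi> l) i j))"
    proof (rule sum_mono)
      fix l assume l: "l \<in> L"
      have "ennreal (norm (cvec ?\<Omega> (\<phi> l) i j)) \<le> e l j * ennreal (overlap_mass ?\<Omega> (\<phi> l) i j)"
        unfolding e_def \<phi>_def by (rule fe_mesh.cvec_bound[OF mesh_l[OF l l] i nbd[OF j]])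
      then have "ennreal (\<omega> l) * ennreal (norm (cvec ?\<Omega> (\<phi> l) i j)) \<le> ennreal (\<omega> l) * (e l j * ennreal (overlap_mass ?\<Omega> (\<phi> l) i j))"
        by (rule mult_left_mono) simp
      then show "ennreal (\<omega> l * norm (cvec ?\<Omega> (\<phi> l) i j)) \<le> e l j * ennreal (\<omega> l * overlap_mass ?\<Omega> (\<phi> l) i j)"
        using \<omega>[OF l] ov[OF l, of j] by (simp add: ennreal_mult mult_ac)
    qed
    finally show "0 \<le> norm (?c i j) \<and> ennreal (norm (?c i j)) \<le> (\<Sum>l\<in>L. e l j * ennreal (\<omega> l * overlap_mass ?\<Omega> (\<phi> l) i j))" by simp
    fix l assume l: "l \<in> L"
    have "(INF l\<in>L. mesh_size ?\<Omega> (dofs X) (\<phi> l) i) \<le> mesh_size ?\<Omega> (dofs X) (\<phi> l) i" using l by (rule INF_lower)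
    also have "\<dots> \<le> 1 / e l j" unfolding mesh_size_def e_def mesh_size_pair_def[symmetric] using j nbl[OF l] by (intro INF_lower) simp
    finally show "\<omega> l * overlap_mass ?\<Omega> (\<phi> l) i j = 0 \<or> (INF l\<in>L. mesh_size ?\<Omega> (dofs X) (\<phi> l) i) \<le> 1 / e l j" ..
  next
    show "cfl_number ?\<tau> ?lam (INF l\<in>L. mesh_size ?\<Omega> (dofs X) (\<phi> l) i)
        ((\<Sum>j\<in>M.nb i - {i}. \<Sum>l\<in>L. \<omega> l * overlap_mass ?\<Omega> (\<phi> l) i j) / (\<Sum>l\<in>L. \<omega> l * mass ?\<Omega> (\<phi> l) i))
        ((\<Sum>l\<in>L. \<omega> l * mass ?\<Omega> (\<phi> l) i) / ?m' i) \<le> 1"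
      using cfl unfolding cfl2_def Let_def phi .
  qed (use \<tau> m' Mpos fL M.nb_finite[OF i] in auto)
  have symm: "i \<in> M.nb j" if "j \<in> M.nb i" for j using M.nb_sym[OF i nbd[OF that]] that by blast
  show ?thesis
    by (rule ale_update_in_invariant_set[OF solv tr inv M.nb_finite[OF i] M.nb_refl[OF i] symm UB \<tau> m' upd c0 gcl visc])
qed

section \<open>Convex invariant sets are preserved\<close>

theorem theorem5p2:
  fixes X :: "('c, 'g, 'i, 'd::{finite,wellorder}) mesh_data"
    and bc :: "'d boundary"
    and R :: "('m::finite, 'd) riemann"
    and f :: "('m, 'd) flux"
    and L :: "'l set" and \<omega> \<zeta> :: "'l \<Rightarrow> real"
    and t :: "nat \<Rightarrow> real"
    and a Wgeo :: "nat \<Rightarrow> 'g \<Rightarrow> real^'d::_"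
    and W :: "nat \<Rightarrow> 'i \<Rightarrow> real^'d::_"
    and \<mu> :: "nat \<Rightarrow> 'i \<Rightarrow> real"
    and U :: "nat \<Rightarrow> 'i \<Rightarrow> real^'m"
    and n :: nat and i :: 'i
    and B :: "(real^'m) set"
  assumes "boundary_ok bc" and "mesh_data_ok X bc"
    and "riemann_solvable R f" and "ale_translates R f"
    and "i \<in> dofs X"
    and "(version1 X bc R f t a W \<mu> U n \<and>
            cfl1 X bc R f t a W \<mu> U n i (\<mu> n i) \<le> 1 \<and>
            cfl1 X bc R f t a W \<mu> U n i (mass (flow_domain bc) (psi X bc (a n)) i) \<le> 1) \<or>
         (version2 X bc R f L \<omega> \<zeta> t a Wgeo W U n \<and>
            cfl2 X bc R f L \<omega> \<zeta> t a Wgeo W U n i \<le> 1)"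
    and "invariant_set R f B"
    and "U n ` nbrs (flow_domain bc) (dofs X) (psi X bc (a n)) i \<subseteq> B"
  shows "U (Suc n) i \<in> B"
  using assms(6)
proof (elim disjE conjE)
  assume v: "version1 X bc R f t a W \<mu> U n"
    and cfl: "cfl1 X bc R f t a W \<mu> U n i (mass (flow_domain bc) (psi X bc (a n)) i) \<le> 1"
  show ?thesis by (rule version1_invariant[OF assms(1-5) v cfl assms(7,8)])
next
  assume v: "version2 X bc R f L \<omega> \<zeta> t a Wgeo W U n" and cfl: "cfl2 X bc R f L \<omega> \<zeta> t a Wgeo W U n i \<le> 1"
  show ?thesis by (rule version2_invariant[OF assms(1-5) v cfl assms(7,8)])
qed

end
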